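(* Fix $0<\delta<1/10$, and assume that for every $\chi\in\mathcal{S}$, all the zeros of $L(s,\chi)$ in the disk $|z-1|<\delta$ are real. For all $\varepsilon>0$, there exists a (not effectively computable) constant $c(\delta,\varepsilon)>0$ such that if $\chi\in\mathcal{S}$ with $q_\chi>1$ and $\sigma\in\mathbb{R}$ satisfies $\sigma\geq 1-c(\delta,\varepsilon)(\log q_\chi)^{-\varepsilon}$, then $L(\sigma,\chi)\neq 0$.
   Context: $\mathcal{S}$ denotes the set of all primitive real Dirichlet characters $\chi\pmod{q_\chi}$, where $q_\chi$ is the modulus (equal to the conductor) of $\chi$. $L(s,\chi)$ is the Dirichlet $L$-function of $\chi$ (meromorphically continued to $\mathbb{C}$). The word "ineffective" in the description of the constant only means that no procedure for computing it is claimed; the assertion is the existence of the constant. *)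

theory Defs
  imports "HOL-Complex_Analysis.Complex_Analysis"
begin

definition dirichlet_character :: "nat \<Rightarrow> (int \<Rightarrow> complex) \<Rightarrow> bool" where
  "dirichlet_character q chi \<longleftrightarrow>
     q > 0 \<and>
     (\<forall>m n. chi (m * n) = chi m * chi n) \<and>
     (\<forall>n. chi (n + int q) = chi n) \<and>
     (\<forall>n. chi n \<noteq> 0 \<longleftrightarrow> coprime n (int q))"

text \<open>The character \<open>chi\<close> mod \<open>q\<close> is induced by a character mod \<open>d\<close>.\<close>

definition induced_from :: "nat \<Rightarrow> (int \<Rightarrow> complex) \<Rightarrow> nat \<Rightarrow> bool" where
  "induced_from q chi d \<longleftrightarrow>
     d dvd q \<and> (\<exists>\<psi>. dirichlet_character d \<psi> \<and> (\<forall>n. coprime n (int q) \<longrightarrow> chi n = \<psi> n))"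

definition conductor :: "nat \<Rightarrow> (int \<Rightarrow> complex) \<Rightarrow> nat" where
  "conductor q chi = (LEAST d. induced_from q chi d)"

definition primitive_character :: "nat \<Rightarrow> (int \<Rightarrow> complex) \<Rightarrow> bool" where
  "primitive_character q chi \<longleftrightarrow> dirichlet_character q chi \<and> conductor q chi = q"

text \<open>
  A character is paired with its modulus \<open>q\<close>.  The trivial character mod 1 (whose L-function
  is the Riemann zeta function) is included.
\<close>

definition real_primitive_characters :: "(nat \<times> (int \<Rightarrow> complex)) set" where
  "real_primitive_characters =
     {(q, chi). primitive_character q chi \<and> (\<forall>n. chi n \<in> \<real>)}"

text \<open>
  The meromorphic continuation to the whole plane of the Dirichlet series
  \<open>\<Sum>n\<ge>1. chi(n) n\<^sup>-\<^sup>s\<close>.  The predicate \<open>nicely_meromorphic_on\<close> makes it unique as a total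
  function: removable singularities are filled in, and the value at a pole is 0.
  For a character the only possible pole is the real point 1, so this convention
  does not create non-real zeros.
\<close>

definition Dirichlet_L :: "(int \<Rightarrow> complex) \<Rightarrow> complex \<Rightarrow> complex" where
  "Dirichlet_L chi = (THE f. f nicely_meromorphic_on UNIV \<and>
     (\<forall>s. Re s > 1 \<longrightarrow> (\<lambda>n. chi (int (Suc n)) * of_nat (Suc n) powr (- s)) sums f s))"

end

theory Submission
  imports Defs "HOL-Number_Theory.Number_Theory"
begin

text \<open>
  For real characters \<open>\<chi>\<^sub>1\<close>, \<open>\<chi>\<^sub>2\<close> with \<open>\<chi>\<^sub>1 \<chi>\<^sub>2\<close> not principal, the product
  \<open>F = \<zeta>(s) L(s, \<chi>\<^sub>1) L(s, \<chi>\<^sub>2) L(s, \<chi>\<^sub>1 \<chi>\<^sub>2)\<close> has a logarithmic derivative whose negative has the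
  nonnegative Dirichlet coefficients \<open>\<Lambda>(n) (1 + \<chi>\<^sub>1(n)) (1 + \<chi>\<^sub>2(n))\<close>.  Differentiating \<open>k - 1\<close> times
  at \<open>s = 1 + \<eta>\<close> turns each zero \<open>\<rho>\<close> near \<open>1\<close> into a term \<open>(s - \<rho>)\<^sup>-\<^sup>k\<close>, which is positive because
  \<open>\<rho>\<close> is real, while the zeros outside the disk contribute only \<open>O(k (4/\<delta>)\<^sup>k log(q\<^sub>1 q\<^sub>2))\<close>.  Hence two
  real zeros \<open>\<beta>\<^sub>1\<close>, \<open>\<beta>\<^sub>2\<close> satisfy
  \<open>(s - \<beta>\<^sub>1)\<^sup>-\<^sup>k + (s - \<beta>\<^sub>2)\<^sup>-\<^sup>k \<le> \<eta>\<^sup>-\<^sup>k + O(k (4/\<delta>)\<^sup>k log(q\<^sub>1 q\<^sub>2))\<close>.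
  If some \<open>\<beta>\<^sub>1\<close> is extremely close to \<open>1\<close> (otherwise there is nothing to prove), fix it, put
  \<open>\<eta> = 1 - \<beta>\<^sub>1\<close> and take \<open>k\<close> a small multiple of \<open>log log q\<^sub>2\<close>: the inequality forces
  \<open>1 - \<beta>\<^sub>2 \<ge> c (log q\<^sub>2)\<^sup>-\<^sup>\<epsilon>\<close>.  When \<open>\<chi>\<^sub>1 \<chi>\<^sub>2\<close> is principal, the two L-functions have the same zeros in
  \<open>Re s > 0\<close>, and \<open>L(1, \<chi>\<^sub>1) \<noteq> 0\<close> suffices.
\<close>

text \<open>Whatever depends on the chosen zero \<open>\<beta>1\<close> (the point 1 +
  \<open>\<eta>\<close>, the size of zeta there, the modulus \<open>q1\<close>) counts as a
  constant, and none of it is bounded in terms of \<delta> and \<epsilon>: this is where effectivity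
  is lost. It also permits crude estimates. The size of L enters only through the logarithm of a
  bound polynomial in the modulus, so q^4 is good enough. Passing from size to zeros requires that L
  is not small at the centre 1 + \<open>\<eta>\<close>; this holds uniformly in q because zeta L has
  nonnegative coefficients and first coefficient 1.

  The exponent \<epsilon> comes from comparing two rates. After scaling by \<open>\<eta>\<close>^k,
  the zero \<open>\<beta>1\<close> yields a gain 2^-k, while the error is about k (4
  \<open>\<eta>\<close>/\<delta>)^k log q. If 4 \<open>\<eta>\<close>/\<delta> is at most 4^-(N + 1)
  with N >= 1/\<epsilon>, then k near log log q / (N log 4) makes the error smaller than the gain,
  and the final bound loses only 4^k, about (log q)^(1/N).

  The four factors are treated one by one, with (s - 1) zeta(s) in place of zeta(s), so that only
  entire functions have their zeros divided out.\<close>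

text \<open>Termwise differentiation under a locally uniform majorant. The majorant is only required
  eventually: in \<open>powr_remainder_series\<close> it is a power of \<open>n\<close>, which is 0
  at \<open>n = 0\<close> by the convention for \<open>0 powr e\<close>.\<close>

lemma holomorphic_series:
  fixes f :: "nat \<Rightarrow> complex \<Rightarrow> complex"
  assumes S: "open S" and hol: "\<And>n. f n holomorphic_on S"
    and bd: "\<And>z. z \<in> S \<Longrightarrow> \<exists>d h. d > 0 \<and> summable h \<and>
          (\<forall>\<^sub>F n in sequentially. \<forall>y\<in>ball z d \<inter> S. norm (f n y) \<le> h n)"
  shows "(\<lambda>z. \<Sum>n. f n z) holomorphic_on S"
    and "z \<in> S \<Longrightarrow> summable (\<lambda>n. f n z)"
    and "z \<in> S \<Longrightarrow> (\<lambda>n. deriv (f n) z) sums deriv (\<lambda>z. \<Sum>n. f n z) z"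
proof -
  have "\<exists>g g'. \<forall>x \<in> S. ((\<lambda>n. f n x) sums g x) \<and> ((\<lambda>n. deriv (f n) x) sums g' x)
                      \<and> (g has_field_derivative g' x) (at x)"
  proof (rule series_and_derivative_comparison_complex [OF S])
    show "(f n has_field_derivative deriv (f n) x) (at x)" if "x \<in> S" for n x
      using hol S that by (rule holomorphic_derivI)
    fix x assume "x \<in> S"
    then obtain d h where dh: "d > 0" "summable h"
          "\<forall>\<^sub>F n in sequentially. \<forall>y\<in>ball x d \<inter> S. norm (f n y) \<le> h n"
      using bd by blast
    have nn: "\<forall>\<^sub>F n in sequentially. h n \<ge> 0"
      using dh(3)
      by eventually_elim (use \<open>x \<in> S\<close> dh(1) in \<open>metis IntI centre_in_ball norm_ge_zero order_trans\<close>)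
    have sh: "summable (\<lambda>n. \<bar>h n\<bar>)"
      by (rule iffD2 [OF summable_cong \<open>summable h\<close>])
         (use nn in \<open>auto elim!: eventually_mono\<close>)
    show "\<exists>d h. 0 < d \<and> summable h \<and> range h \<subseteq> \<real>\<^sub>\<ge>\<^sub>0 \<and>
           (\<forall>\<^sub>F n in sequentially. \<forall>y\<in>ball x d \<inter> S. norm (f n y) \<le> norm (h n :: complex))"
    proof (intro exI conjI)
      show "summable (\<lambda>n. complex_of_real \<bar>h n\<bar>)"
        using sh by (rule summable_of_real)
      show "\<forall>\<^sub>F n in sequentially. \<forall>y\<in>ball x d \<inter> S. norm (f n y) \<le> norm (complex_of_real \<bar>h n\<bar>)"
        using dh(3) by eventually_elim force
    qed (use dh in auto)
  qed
  then obtain g g' where g: "\<And>x. x \<in> S \<Longrightarrow> (\<lambda>n. f n x) sums g x"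
      "\<And>x. x \<in> S \<Longrightarrow> (\<lambda>n. deriv (f n) x) sums g' x"
      "\<And>x. x \<in> S \<Longrightarrow> (g has_field_derivative g' x) (at x)"
    by metis
  have eq: "g x = (\<Sum>n. f n x)" if "x \<in> S" for x
    using g(1) [OF that] by (simp add: sums_iff)
  have der: "((\<lambda>z. \<Sum>n. f n z) has_field_derivative g' x) (at x)" if "x \<in> S" for x
    using g(3) [OF that] S that eq by (rule has_field_derivative_transform_within_open) auto
  show "(\<lambda>z. \<Sum>n. f n z) holomorphic_on S"
    using der S by (auto simp: holomorphic_on_open)
  show "z \<in> S \<Longrightarrow> summable (\<lambda>n. f n z)"
    using g(1) by (auto simp: sums_iff)
  show "z \<in> S \<Longrightarrow> (\<lambda>n. deriv (f n) z) sums deriv (\<lambda>z. \<Sum>n. f n z) z"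
    using g(2) [of z] by (simp add: DERIV_imp_deriv [OF der])
qed

subsection \<open>The Hurwitz zeta function\<close>

text \<open>The falling factorial, so that \<open>falling k w / fact k\<close> is the binomial
  coefficient of w over k.\<close>

definition falling :: "nat \<Rightarrow> complex \<Rightarrow> complex" where
  "falling k w = (\<Prod>j<k. w - of_nat j)"

text \<open>The Taylor remainder after order \<open>K\<close> of (x + 1)^w around x. Summed over x =
  n + a with w = 1 - s, the main terms telescope or become Hurwitz zeta values at s, s + 1, ...,
  which yields the analytic continuation.\<close>

definition powr_remainder :: "nat \<Rightarrow> real \<Rightarrow> complex \<Rightarrow> complex" where
  "powr_remainder K x w = of_real (x + 1) powr w
     - (\<Sum>i\<le>K. falling i w / fact i * of_real x powr (w - of_nat i))"

text \<open>Taylor's formula on the segment from x to x + 1. The condition on \<open>Re w\<close>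
  keeps the derivative of order K + 1 from growing along it, so its bound is taken at x; the factor
  1 / K! is given away.\<close>

lemma norm_powr_remainder_le:
  assumes x: "x > 0" and w: "Re w \<le> real K + 1"
  shows "norm (powr_remainder K x w) \<le> norm (falling (Suc K) w) * x powr (Re w - real K - 1)"
proof -
  define f where "f = (\<lambda>i u. falling i w * u powr (w - of_nat i))"
  define S where "S = closed_segment (complex_of_real x) (of_real (x + 1))"
  have S: "\<exists>t. u = of_real t \<and> x \<le> t" if "u \<in> S" for u
  proof -
    obtain v where v: "0 \<le> v" "v \<le> 1" "u = (1 - v) *\<^sub>R of_real x + v *\<^sub>R of_real (x + 1)"
      using \<open>u \<in> S\<close> unfolding S_def in_segment by blast
    hence "u = of_real (x + v)"
      by (simp add: scaleR_conv_of_real algebra_simps)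
    thus ?thesis using v(1) by (intro exI [of _ "x + v"]) simp
  qed
  have "norm (f 0 (of_real (x + 1)) - (\<Sum>i\<le>K. f i (of_real x) * (of_real (x + 1) - of_real x) ^ i / fact i))
      \<le> (norm (falling (Suc K) w) * x powr (Re w - real K - 1)) * norm (complex_of_real (x + 1) - of_real x) ^ Suc K / fact K"
  proof (rule complex_Taylor [where S = S])
    show "convex S" by (simp add: S_def)
    fix u assume u: "u \<in> S"
    then obtain t where t: "u = of_real t" "x \<le> t" using S by blast
    have un: "u \<notin> \<real>\<^sub>\<le>\<^sub>0" using t x by auto
    show "(f i has_field_derivative f (Suc i) u) (at u within S)" for i
    proof -
      have "((\<lambda>u. u powr (w - of_nat i)) has_field_derivative (w - of_nat i) * u powr (w - of_nat i - 1)) (at u within S)"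
        by (rule has_field_derivative_at_within, rule has_field_derivative_powr [OF un])
      from DERIV_cmult [OF this, of "falling i w"] show ?thesis
        by (simp add: f_def falling_def algebra_simps)
    qed
    have "norm (f (Suc K) u) = norm (falling (Suc K) w) * t powr (Re w - real K - 1)"
      using t x by (simp add: f_def norm_mult norm_powr_real_powr algebra_simps)
    also have "t powr (Re w - real K - 1) \<le> x powr (Re w - real K - 1)"
      using t x w by (intro powr_mono2') auto
    finally show "norm (f (Suc K) u) \<le> norm (falling (Suc K) w) * x powr (Re w - real K - 1)"
      by (simp add: mult_left_mono)
  qed (auto simp: S_def)
  also have "f 0 (of_real (x + 1)) - (\<Sum>i\<le>K. f i (of_real x) * (of_real (x + 1) - of_real x) ^ i / fact i)
      = powr_remainder K x w"
    by (simp add: f_def powr_remainder_def falling_def)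
  also have "(norm (falling (Suc K) w) * x powr (Re w - real K - 1)) * norm (complex_of_real (x + 1) - of_real x) ^ Suc K / fact K
      \<le> norm (falling (Suc K) w) * x powr (Re w - real K - 1)"
  proof -
    have "A / fact K \<le> A" if "A \<ge> 0" for A :: real
      using that fact_ge_1 [of K, where 'a = real] divide_left_mono [of 1 "fact K" A] by simp
    thus ?thesis by simp
  qed
  finally show ?thesis .
qed

lemma holomorphic_falling [holomorphic_intros]:
  "f holomorphic_on S \<Longrightarrow> (\<lambda>s. falling k (f s)) holomorphic_on S"
  unfolding falling_def by (intro holomorphic_intros)

text \<open>With w = 1 - s the remainder is O(n^(-Re s - K)) locally uniformly, so each further
  order of the expansion extends convergence by one unit to the left.\<close>

lemma powr_remainder_series:
  assumes a: "a > 0"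
  shows "(\<lambda>s. \<Sum>n. powr_remainder K (real n + a) (1 - s)) holomorphic_on {s. Re s > 1 - real K}"
    and "Re s > 1 - real K \<Longrightarrow> summable (\<lambda>n. powr_remainder K (real n + a) (1 - s))"
proof -
  let ?S = "{s. Re s > 1 - real K}"
  have op: "open ?S" by (simp add: open_halfspace_Re_gt)
  have hol: "(\<lambda>s. powr_remainder K (real n + a) (1 - s)) holomorphic_on ?S" for n
    unfolding powr_remainder_def by (intro holomorphic_intros) (use a in \<open>auto simp: falling_def\<close>)
  have bd: "\<exists>d h. d > 0 \<and> summable h \<and>
          (\<forall>\<^sub>F n in sequentially. \<forall>y\<in>ball z d \<inter> ?S. norm (powr_remainder K (real n + a) (1 - y)) \<le> h n)"
    if z: "z \<in> ?S" for z
  proof -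
    \<comment> \<open>Half the distance from \<open>z\<close> to the boundary line: on the ball of
      this radius the exponent stays below -1 - \<open>e\<close>.\<close>
    define e where "e = (Re z - (1 - real K)) / 2"
    have e: "e > 0" using z by (auto simp: e_def)
    have "continuous_on (cball z e) (\<lambda>y. falling (Suc K) (1 - y))"
      by (intro holomorphic_on_imp_continuous_on holomorphic_intros)
    from compact_imp_bounded [OF compact_continuous_image [OF this compact_cball]]
    obtain B where B: "\<And>y. y \<in> cball z e \<Longrightarrow> norm (falling (Suc K) (1 - y)) \<le> B"
      by (fastforce simp: bounded_iff)
    have Bnn: "B \<ge> 0" using B [of z] e by (metis centre_in_cball less_eq_real_def norm_ge_zero order_trans)
    show ?thesis
    proof (intro exI conjI)
      show "summable (\<lambda>n. B * real n powr (- 1 - e))"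
        using e by (intro summable_mult) (simp add: summable_real_powr_iff)
      show "\<forall>\<^sub>F n in sequentially. \<forall>y\<in>ball z e \<inter> ?S. norm (powr_remainder K (real n + a) (1 - y)) \<le> B * real n powr (- 1 - e)"
        using eventually_ge_at_top [of 1]
      proof eventually_elim
        case (elim n)
        show ?case
        proof
          fix y assume y: "y \<in> ball z e \<inter> ?S"
          have "\<bar>Re (z - y)\<bar> \<le> norm (z - y)" by (rule abs_Re_le_cmod)
          also have "\<dots> < e" using y by (simp add: dist_norm)
          finally have "Re z - Re y < e" by simp
          hence ry: "Re y > 1 - real K + e" unfolding e_def by argo
          have "norm (powr_remainder K (real n + a) (1 - y))
              \<le> norm (falling (Suc K) (1 - y)) * (real n + a) powr (Re (1 - y) - real K - 1)"
            by (rule norm_powr_remainder_le) (use a ry e in auto)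
          also have "\<dots> \<le> B * (real n + a) powr (Re (1 - y) - real K - 1)"
            using B y by (intro mult_right_mono) auto
          also have "(real n + a) powr (Re (1 - y) - real K - 1) \<le> (real n + a) powr (- 1 - e)"
            using ry a elim by (intro powr_mono) auto
          also have "\<dots> \<le> real n powr (- 1 - e)"
            using elim a e by (intro powr_mono2') auto
          finally show "norm (powr_remainder K (real n + a) (1 - y)) \<le> B * real n powr (- 1 - e)"
            using Bnn by (simp add: mult_left_mono)
        qed
      qed
    qed (use e in auto)
  qed
  show "(\<lambda>s. \<Sum>n. powr_remainder K (real n + a) (1 - s)) holomorphic_on ?S"
    by (rule holomorphic_series [OF op hol bd])
  show "Re s > 1 - real K \<Longrightarrow> summable (\<lambda>n. powr_remainder K (real n + a) (1 - s))"
    by (rule holomorphic_series(2) [OF op hol bd]) auto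
qed

definition hurwitz_series :: "real \<Rightarrow> complex \<Rightarrow> complex" where
  "hurwitz_series a s = (\<Sum>n. of_real (real n + a) powr (- s))"

lemma summable_hurwitz:
  assumes a: "a > 0" and s: "Re s > 1"
  shows "summable (\<lambda>n. norm (complex_of_real (real n + a) powr (- s)))"
proof (rule summable_comparison_test_ev)
  show "\<forall>\<^sub>F n in sequentially. norm (norm (complex_of_real (real n + a) powr (- s))) \<le> real n powr (- Re s)"
    using eventually_ge_at_top [of 1]
  proof eventually_elim
    case (elim n)
    have "norm (complex_of_real (real n + a) powr (- s)) = (real n + a) powr (- Re s)"
      using a by (subst norm_powr_real_powr) auto
    also have "\<dots> \<le> real n powr (- Re s)"
      using a s elim by (intro powr_mono2') auto
    finally show ?case by simp
  qed
  show "summable (\<lambda>n. real n powr (- Re s))"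
    using s by (simp add: summable_real_powr_iff)
qed

text \<open>Sum the Taylor expansions of (x + 1)^(1 - s) over x = n + a: order 0 telescopes against
  the left side, order 1 produces (s - 1) zeta(s, a), and order k >= 2 produces zeta(s + k - 1, a),
  which converges further to the left.\<close>

lemma hurwitz_recursion:
  assumes a: "a > 0" and s: "Re s > 1" and K: "K \<ge> 1"
  shows "(s - 1) * hurwitz_series a s = of_real a powr (1 - s)
     + (\<Sum>n. powr_remainder K (real n + a) (1 - s))
     + (\<Sum>k=2..K. falling k (1 - s) / fact k * hurwitz_series a (s + of_nat k - 1))"
proof -
  have sums: "(\<lambda>n. complex_of_real (real n + a) powr (- u)) sums hurwitz_series a u" if "Re u > 1" for u
    unfolding hurwitz_series_def
    by (rule summable_sums [OF summable_norm_cancel [OF summable_hurwitz [OF a that]]])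
  have lim: "(\<lambda>n. complex_of_real (real n + a) powr (1 - s)) \<longlonglongrightarrow> 0"
  proof (rule tendsto_norm_zero_cancel, rule Lim_transform_eventually)
    show "\<forall>\<^sub>F n in sequentially. (real n + a) powr (1 - Re s) = norm (complex_of_real (real n + a) powr (1 - s))"
      using a by (intro always_eventually allI) (simp add: norm_powr_real_powr del: of_real_add)
    have "filterlim (\<lambda>n. real n + a) at_top sequentially"
      by (subst add.commute) (rule filterlim_tendsto_add_at_top [OF tendsto_const filterlim_real_sequentially])
    thus "(\<lambda>n. (real n + a) powr (1 - Re s)) \<longlonglongrightarrow> 0"
      by (rule tendsto_neg_powr [rotated]) (use s in simp)
  qed
  have tel: "(\<lambda>n. of_real (real n + a) powr (1 - s) - of_real (real (Suc n) + a) powr (1 - s)) sums (of_real a powr (1 - s) - 0)"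
    using telescope_sums' [OF lim] by simp
  have "(\<lambda>n. (s - 1) * (of_real (real n + a) powr (- s))
      - (of_real (real n + a) powr (1 - s) - of_real (real (Suc n) + a) powr (1 - s))
      - (\<Sum>k=2..K. falling k (1 - s) / fact k * of_real (real n + a) powr (- (s + of_nat k - 1)))) sums
     ((s - 1) * hurwitz_series a s - (of_real a powr (1 - s) - 0)
      - (\<Sum>k=2..K. falling k (1 - s) / fact k * hurwitz_series a (s + of_nat k - 1)))"
    using s by (intro sums_diff sums_mult sums_sum tel sums) auto
  also have "(\<lambda>n. (s - 1) * (of_real (real n + a) powr (- s))
      - (of_real (real n + a) powr (1 - s) - of_real (real (Suc n) + a) powr (1 - s))
      - (\<Sum>k=2..K. falling k (1 - s) / fact k * of_real (real n + a) powr (- (s + of_nat k - 1))))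
      = (\<lambda>n. powr_remainder K (real n + a) (1 - s))"
  proof
    fix n
    have "{..K} = insert 0 (insert 1 {2..K})" using K by auto
    hence "(\<Sum>i\<le>K. falling i (1 - s) / fact i * of_real (real n + a) powr (1 - s - of_nat i))
       = of_real (real n + a) powr (1 - s) + (1 - s) * of_real (real n + a) powr (- s)
        + (\<Sum>k=2..K. falling k (1 - s) / fact k * of_real (real n + a) powr (1 - s - of_nat k))"
      by (simp add: falling_def)
    moreover have "1 - s - of_nat k = - (s + of_nat k - 1)" for k by simp
    ultimately show "(s - 1) * (of_real (real n + a) powr (- s))
      - (of_real (real n + a) powr (1 - s) - of_real (real (Suc n) + a) powr (1 - s))
      - (\<Sum>k=2..K. falling k (1 - s) / fact k * of_real (real n + a) powr (- (s + of_nat k - 1)))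
      = powr_remainder K (real n + a) (1 - s)"
      unfolding powr_remainder_def by (simp add: algebra_simps)
  qed
  finally show ?thesis
    by (simp add: sums_iff)
qed

text \<open>By \<open>hurwitz_recursion\<close> the value at s is determined by those at s + 1, ...,
  s + K, so each step of the induction gains one strip. The guard \<open>K > 0\<close> makes the
  base case vacuous; the step to K = 1 uses no earlier value.\<close>

lemma hurwitz_continuation:
  assumes a: "a > 0"
  shows "\<exists>G. K > 0 \<longrightarrow> G holomorphic_on {s. Re s > 1 - real K} \<and>
           (\<forall>s. Re s > 1 \<longrightarrow> G s = (s - 1) * hurwitz_series a s)"
proof (induction K)
  case (Suc K)
  then obtain G where G: "K > 0 \<Longrightarrow> G holomorphic_on {s. Re s > 1 - real K}"
      "\<And>s. K > 0 \<Longrightarrow> Re s > 1 \<Longrightarrow> G s = (s - 1) * hurwitz_series a s"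
    by blast
  \<comment> \<open>The last factor of \<open>falling k (1 - s)\<close> is -(s + k - 2), which up to
    sign is just the factor that turns zeta(s + k - 1, a) into \<open>G (s + of_nat k - 1)\<close>.
    Hence no pole arises at s = 2 - k.\<close>
  define H where "H = (\<lambda>s. of_real a powr (1 - s)
     + (\<Sum>n. powr_remainder (Suc K) (real n + a) (1 - s))
     + (\<Sum>k=2..Suc K. - falling (k - 1) (1 - s) / fact k * G (s + of_nat k - 1)))"
  have "(\<lambda>s. G (s + of_nat k - 1)) holomorphic_on {s. Re s > 1 - real (Suc K)}"
    if k: "k \<in> {2..Suc K}" for k
    by (rule holomorphic_on_compose_gen [OF _ G(1), unfolded o_def])
       (use k in \<open>auto intro!: holomorphic_intros\<close>)
  hence "H holomorphic_on {s. Re s > 1 - real (Suc K)}"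
    unfolding H_def by (intro holomorphic_intros powr_remainder_series a) (use a in auto)
  moreover have "H s = (s - 1) * hurwitz_series a s" if s: "Re s > 1" for s
  proof -
    have "- falling (k - 1) (1 - s) / fact k * G (s + of_nat k - 1)
        = falling k (1 - s) / fact k * hurwitz_series a (s + of_nat k - 1)"
      if k: "k \<in> {2..Suc K}" for k
    proof -
      obtain j where j: "k = Suc j" using k by (cases k) auto
      have "falling k (1 - s) = falling (k - 1) (1 - s) * (1 - s - of_nat j)"
        unfolding j falling_def by simp
      moreover have "G (s + of_nat k - 1) = (s + of_nat j - 1) * hurwitz_series a (s + of_nat k - 1)"
        using k s j by (subst G(2)) auto
      moreover have "1 - s - of_nat j = - (s + of_nat j - 1)" by simp
      ultimately show ?thesis
        by (simp only: mult_minus_left mult_minus_right divide_minus_left mult.assoc times_divide_eq_left)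
    qed
    hence "(\<Sum>k=2..Suc K. - falling (k - 1) (1 - s) / fact k * G (s + of_nat k - 1))
        = (\<Sum>k=2..Suc K. falling k (1 - s) / fact k * hurwitz_series a (s + of_nat k - 1))"
      by (intro sum.cong) auto
    thus ?thesis
      using hurwitz_recursion [OF a s, of "Suc K"] unfolding H_def by (simp only:)
  qed
  ultimately show ?case by blast
qed auto

lemma holomorphic_eq_half_plane:
  assumes "f holomorphic_on {s. Re s > c}" "g holomorphic_on {s. Re s > c}"
    and "\<And>s. Re s > d \<Longrightarrow> f s = g s" and "Re z > c"
  shows "f z = g z"
proof (rule analytic_continuation_open [of "{s. Re s > max c d}" "{s. Re s > c}" f g])
  show "open {s. Re s > max c d}" by (rule open_halfspace_Re_gt)
  have "complex_of_real (max c d + 1) \<in> {s. Re s > max c d}" unfolding mem_Collect_eq Re_complex_of_real by linarith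
  thus "{s. Re s > max c d} \<noteq> {}" by blast
qed (use assms in \<open>auto simp: open_halfspace_Re_gt convex_halfspace_Re_gt intro!: convex_connected\<close>)

text \<open>The continuations to different half-planes agree where both are available, so using at
  each s the one with a \<open>K\<close> large enough for Re s gives a single entire
  function.\<close>

lemma hurwitz_entire_exists:
  assumes a: "a > 0"
  shows "\<exists>G. G holomorphic_on UNIV \<and> (\<forall>s. Re s > 1 \<longrightarrow> G s = (s - 1) * hurwitz_series a s)"
proof -
  obtain G where G: "\<And>K. K > 0 \<Longrightarrow> G K holomorphic_on {s. Re s > 1 - real K}"
      "\<And>K s. K > 0 \<Longrightarrow> Re s > 1 \<Longrightarrow> G K s = (s - 1) * hurwitz_series a s"
    using hurwitz_continuation [OF a] by metis
  have eq: "G K s = G L s" if "K > 0" "L > 0" "Re s > 1 - real K" "Re s > 1 - real L" for K L s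
    by (rule holomorphic_eq_half_plane [of _ "max (1 - real K) (1 - real L)" _ 1])
       (use that in \<open>auto intro: holomorphic_on_subset [OF G(1)] simp: G(2)\<close>)
  define k where "k = (\<lambda>s. nat \<lceil>1 - Re s\<rceil> + 1)"
  have k: "k s > 0" "Re s > 1 - real (k s)" for s
    unfolding k_def using of_nat_ceiling [of "1 - Re s"] by simp_all
  have "(\<lambda>s. G (k s) s) holomorphic_on UNIV"
  proof -
    have "(\<lambda>s. G (k s) s) field_differentiable (at z)" for z
    proof -
      have "(\<lambda>s. G (k s) s) holomorphic_on {s. Re s > 1 - real (k z)}"
        by (rule holomorphic_transform [OF G(1) [of "k z"]]) (auto intro!: eq k)
      thus ?thesis
        by (rule holomorphic_on_imp_differentiable_at) (use k in \<open>auto simp: open_halfspace_Re_gt\<close>)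
    qed
    thus ?thesis by (simp add: holomorphic_on_def field_differentiable_at_within)
  qed
  thus ?thesis using G(2) k(1) by (intro exI [of _ "\<lambda>s. G (k s) s"]) auto
qed

text \<open>The entire function (s - 1) zeta(s, a). The factor s - 1 removes the pole, and the
  identity theorem leaves only one candidate for \<open>SOME\<close>.\<close>

definition hurwitz_entire :: "real \<Rightarrow> complex \<Rightarrow> complex" where
  "hurwitz_entire a = (SOME G. G holomorphic_on UNIV \<and>
     (\<forall>s. Re s > 1 \<longrightarrow> G s = (s - 1) * hurwitz_series a s))"

lemma hurwitz_entire:
  assumes "a > 0"
  shows "hurwitz_entire a holomorphic_on UNIV"
    and "Re s > 1 \<Longrightarrow> hurwitz_entire a s = (s - 1) * hurwitz_series a s"
  using someI_ex [OF hurwitz_entire_exists [OF assms]] unfolding hurwitz_entire_def by auto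

lemma hurwitz_entire_eq:
  assumes a: "a > 0" and s: "Re s > 0"
  shows "hurwitz_entire a s = of_real a powr (1 - s) + (\<Sum>n. powr_remainder 1 (real n + a) (1 - s))"
proof (rule holomorphic_eq_half_plane [where c = 0 and d = 1 and f = "hurwitz_entire a" and
      g = "\<lambda>s. of_real a powr (1 - s) + (\<Sum>n. powr_remainder 1 (real n + a) (1 - s))"])
  show "hurwitz_entire a holomorphic_on {s. Re s > 0}"
    using hurwitz_entire(1) [OF a] by (rule holomorphic_on_subset) auto
  show "(\<lambda>s. of_real a powr (1 - s) + (\<Sum>n. powr_remainder 1 (real n + a) (1 - s))) holomorphic_on {s. Re s > 0}"
    using powr_remainder_series(1) [OF a, of 1] a by (intro holomorphic_intros) auto
  show "hurwitz_entire a s = of_real a powr (1 - s) + (\<Sum>n. powr_remainder 1 (real n + a) (1 - s))"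
    if "Re s > 1" for s
    using hurwitz_recursion [OF a that, of 1] hurwitz_entire(2) [OF a that] by simp
qed fact

text \<open>The residue of zeta(s, a): at s = 1 the expanded power is constant and every remainder
  vanishes.\<close>

lemma hurwitz_entire_at_1: "a > 0 \<Longrightarrow> hurwitz_entire a 1 = 1"
proof -
  assume a: "a > 0"
  have "powr_remainder 1 (real n + a) (1 - 1) = 0" for n
  proof -
    \<comment> \<open>Nonzero bases matter here, since \<open>0 powr 0 = 0\<close>.\<close>
    have "complex_of_real (real n + a) \<noteq> 0" "complex_of_real (real n + a + 1) \<noteq> 0"
      unfolding of_real_eq_0_iff using a by linarith+
    thus ?thesis by (simp add: powr_remainder_def falling_def)
  qed
  thus ?thesis using a by (simp add: hurwitz_entire_eq)
qed

text \<open>Only the power of \<open>a\<close> itself and the remainder at n = 0 feel a small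
  \<open>a\<close>; the other remainders are dominated by one fixed convergent series. The exponent
  3 is a rounding up of 5/2.\<close>

lemma hurwitz_entire_bound:
  "\<exists>C>0. \<forall>a s. 0 < a \<and> a \<le> 1 \<and> norm (s - 1) \<le> 1 / 2 \<longrightarrow> norm (hurwitz_entire a s) \<le> C / a ^ 3"
proof -
  define Z where "Z = (\<Sum>n. real (Suc n) powr (- 3 / 2))"
  have smZ: "summable (\<lambda>n. real (Suc n) powr (- 3 / 2))"
    using summable_real_powr_iff [of "-3/2"] by (subst summable_Suc_iff [where f = "\<lambda>n. real n powr (-3/2)"]) simp
  have Z: "Z \<ge> 0" unfolding Z_def by (intro suminf_nonneg smZ) auto
  show ?thesis
  proof (intro exI conjI allI impI)
    \<comment> \<open>7 = 1 + 6 collects a^(1 - s) and the remainder at n = 0, and 6 Z bounds the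
      tail. The 6 is a generous bound for |s (1 - s)|, which is at most 3/4 here.\<close>
    show "7 + 6 * Z > 0" using Z by simp
    fix a :: real and s :: complex
    assume "0 < a \<and> a \<le> 1 \<and> norm (s - 1) \<le> 1 / 2"
    hence a: "0 < a" "a \<le> 1" and ns: "norm (s - 1) \<le> 1 / 2" by auto
    have "\<bar>Re (s - 1)\<bar> \<le> 1 / 2" using abs_Re_le_cmod ns order_trans by blast
    hence s: "Re s \<ge> 1 / 2" "Re s \<le> 3 / 2" by (simp_all only: minus_complex.sel one_complex.sel)
    have "norm s \<le> norm (s - 1) + norm (1 :: complex)" by (metis diff_add_cancel norm_triangle_ineq)
    hence "norm s \<le> 3 / 2" using ns by simp
    hence "norm (1 - s) * norm s \<le> 6 * 1"
      using ns mult_mono [of "norm (1 - s)" "1/2" "norm s" "3/2"] by (simp add: norm_minus_commute)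
    hence fall: "norm (falling (Suc 1) (1 - s)) \<le> 6"
      by (simp add: falling_def norm_mult numeral_2_eq_2)
    let ?h = "\<lambda>n. 6 * (real n + a) powr (- Re s - 1)"
    have rem: "norm (powr_remainder 1 (real n + a) (1 - s)) \<le> ?h n" for n
    proof -
      have "norm (powr_remainder 1 (real n + a) (1 - s))
          \<le> norm (falling (Suc 1) (1 - s)) * (real n + a) powr (Re (1 - s) - real 1 - 1)"
        by (rule norm_powr_remainder_le) (use a s in auto)
      also have "\<dots> \<le> 6 * (real n + a) powr (Re (1 - s) - real 1 - 1)"
        using fall by (rule mult_right_mono) auto
      finally show ?thesis by (simp add: algebra_simps)
    qed
    have tail: "?h (Suc n) \<le> 6 * real (Suc n) powr (- 3 / 2)" for n
    proof -
      have "(real (Suc n) + a) powr (- Re s - 1) \<le> (real (Suc n) + a) powr (- 3 / 2)"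
        using a s by (intro powr_mono) auto
      also have "\<dots> \<le> real (Suc n) powr (- 3 / 2)"
        using a by (intro powr_mono2') auto
      finally show ?thesis by simp
    qed
    have smh': "summable (\<lambda>n. ?h (Suc n))"
      by (rule summable_comparison_test' [OF summable_mult [OF smZ, of 6], of 0])
         (use tail in auto)
    hence smh: "summable ?h" by (rule summable_Suc_iff [THEN iffD1])
    have ap: "a powr e \<le> 1 / a ^ 3" if "e \<ge> - 3" for e
    proof -
      have "a powr e \<le> a powr (- 3)"
        using a that by (intro powr_mono') auto
      also have "\<dots> = 1 / a ^ 3" using a by (simp add: powr_minus_divide powr_numeral)
      finally show ?thesis .
    qed
    have "norm (\<Sum>n. powr_remainder 1 (real n + a) (1 - s)) \<le> (\<Sum>n. ?h n)"
      by (rule norm_suminf_le [OF rem smh])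
    also have "\<dots> = ?h 0 + (\<Sum>n. ?h (Suc n))"
      using suminf_split_head [OF smh] by simp
    also have "(\<Sum>n. ?h (Suc n)) \<le> (\<Sum>n. 6 * real (Suc n) powr (- 3 / 2))"
      using tail smh' smZ by (intro suminf_le summable_mult) auto
    also have "\<dots> = 6 * Z" unfolding Z_def by (rule suminf_mult [OF smZ])
    also have "?h 0 \<le> 6 * (1 / a ^ 3)"
      using ap [of "- Re s - 1"] s by simp
    finally have R: "norm (\<Sum>n. powr_remainder 1 (real n + a) (1 - s)) \<le> 6 * (1 / a ^ 3) + 6 * Z" by simp
    have "norm (hurwitz_entire a s) \<le> norm (complex_of_real a powr (1 - s))
         + norm (\<Sum>n. powr_remainder 1 (real n + a) (1 - s))"
      using s a by (subst hurwitz_entire_eq) (auto intro: norm_triangle_ineq)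
    also have "norm (complex_of_real a powr (1 - s)) = a powr (1 - Re s)"
      using a by (simp add: norm_powr_real_powr)
    also have "\<dots> \<le> 1 / a ^ 3" using s by (intro ap) auto
    finally have "norm (hurwitz_entire a s) \<le> 1 / a ^ 3
         + norm (\<Sum>n. powr_remainder 1 (real n + a) (1 - s))" by simp
    moreover have "6 * Z \<le> 6 * Z / a ^ 3"
      using Z a power_le_one [of a 3] by (simp add: field_simps mult_left_mono)
    ultimately show "norm (hurwitz_entire a s) \<le> (7 + 6 * Z) / a ^ 3"
      using R by (simp add: add_divide_distrib)
  qed
qed

subsection \<open>Dirichlet series with periodic coefficients\<close>

text \<open>Write n = q m + r, so that n^-s = q^-s (m + r/q)^-s. The residues run through 1..q
  instead of 0..q-1 to keep the Hurwitz parameter r/q positive.\<close>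

lemma sums_periodic_dirichlet:
  fixes f :: "nat \<Rightarrow> complex"
  assumes q: "q > 0" and per: "\<And>n. f (n + q) = f n" and s: "Re s > 1"
  shows "(\<lambda>n. f n * of_nat n powr (- s)) sums
           (of_nat q powr (- s) * (\<Sum>r=1..q. f r * hurwitz_series (real r / real q) s))"
proof -
  have per': "f (q * m + r) = f r" for m r
    by (induction m) (use per in \<open>auto simp: algebra_simps\<close>, metis add.assoc add.commute per)
  have one: "(\<lambda>n. if n > 0 \<and> n mod q = r mod q then f n * of_nat n powr (- s) else 0) sums
        (of_nat q powr (- s) * (f r * hurwitz_series (real r / real q) s))"
    (is "?F sums ?L") if r: "r \<in> {1..q}" for r
  proof -
    have "(\<lambda>m. of_nat q powr (- s) * (f r * of_real (real m + real r / real q) powr (- s))) sums ?L"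
      unfolding hurwitz_series_def
      by (intro sums_mult summable_sums summable_norm_cancel [OF summable_hurwitz] s) (use r q in auto)
    also have "(\<lambda>m. of_nat q powr (- s) * (f r * of_real (real m + real r / real q) powr (- s)))
        = (\<lambda>m. ?F (q * m + r))"
    proof
      fix m
      have "complex_of_nat (q * m + r) = of_real (real q) * of_real (real m + real r / real q)"
        using q by (simp add: field_simps)
      also have "\<dots> powr (- s) = of_real (real q) powr (- s) * of_real (real m + real r / real q) powr (- s)"
        by (rule powr_times_real) auto
      finally show "of_nat q powr (- s) * (f r * of_real (real m + real r / real q) powr (- s)) = ?F (q * m + r)"
        using r by (simp add: per' del: of_nat_add of_nat_mult)
    qed
    also have "\<dots> sums ?L \<longleftrightarrow> ?F sums ?L"
    proof (rule sums_mono_reindex)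
      show "strict_mono (\<lambda>m. q * m + r)" using q by (auto simp: strict_mono_def)
      fix n assume n: "n \<notin> range (\<lambda>m. q * m + r)"
      have "\<exists>m. n = q * m + r" if "n > 0" "n mod q = r mod q"
      proof -
        have "n \<ge> r"
        proof (cases "r = q")
          case True
          with that show ?thesis by (simp add: mod_eq_0_iff_dvd dvd_imp_le)
        next
          case False
          with that r have "n mod q = r" by simp
          thus ?thesis by (metis mod_less_eq_dividend)
        qed
        moreover have "q dvd n - r" using that mod_eq_dvd_iff_nat calculation by metis
        ultimately show ?thesis by (metis dvd_def le_add_diff_inverse2)
      qed
      thus "?F n = 0" using n by auto
    qed
    finally show ?thesis .
  qed
  have "(\<lambda>n. \<Sum>r=1..q. if n > 0 \<and> n mod q = r mod q then f n * of_nat n powr (- s) else 0) sums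
        (\<Sum>r=1..q. of_nat q powr (- s) * (f r * hurwitz_series (real r / real q) s))"
    by (intro sums_sum one)
  also have "(\<lambda>n. \<Sum>r=1..q. if n > 0 \<and> n mod q = r mod q then f n * of_nat n powr (- s) else 0)
     = (\<lambda>n. f n * of_nat n powr (- s))"
  proof
    fix n
    show "(\<Sum>r=1..q. if n > 0 \<and> n mod q = r mod q then f n * of_nat n powr (- s) else 0) = f n * of_nat n powr (- s)"
    proof (cases "n = 0")
      case False
      define r where "r = (if n mod q = 0 then q else n mod q)"
      have "{r' \<in> {1..q}. n mod q = r' mod q} = {r}"
      proof (intro equalityI subsetI)
        fix r' assume "r' \<in> {r' \<in> {1..q}. n mod q = r' mod q}"
        thus "r' \<in> {r}" by (cases "r' = q") (auto simp: r_def)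
      qed (use q in \<open>auto simp: r_def intro: less_imp_le\<close>)
      thus ?thesis using False by (simp add: sum.If_cases Int_def Collect_conj_eq [symmetric] cong: conj_cong)
    qed auto
  qed
  finally show ?thesis by (simp add: sum_distrib_left)
qed

text \<open>The continuation of (s - 1) times the series of f(n) n^-s, assembled from the residue
  classes.\<close>

definition periodic_entire :: "nat \<Rightarrow> (nat \<Rightarrow> complex) \<Rightarrow> complex \<Rightarrow> complex" where
  "periodic_entire q f s = of_nat q powr (- s) * (\<Sum>r=1..q. f r * hurwitz_entire (real r / real q) s)"

lemma holomorphic_periodic_entire: "q > 0 \<Longrightarrow> periodic_entire q f holomorphic_on UNIV"
  unfolding periodic_entire_def by (intro holomorphic_intros hurwitz_entire(1)) auto

lemma periodic_entire_at_1: "q > 0 \<Longrightarrow> periodic_entire q f 1 = (\<Sum>r=1..q. f r) / of_nat q"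
  by (simp add: periodic_entire_def hurwitz_entire_at_1 powr_minus_divide)

lemma sums_periodic_entire:
  assumes q: "q > 0" and per: "\<And>n. f (n + q) = f n" and s: "Re s > 1"
  shows "(\<lambda>n. f n * of_nat n powr (- s)) sums (periodic_entire q f s / (s - 1))"
proof -
  have s1: "s \<noteq> 1" using s by auto
  have "hurwitz_entire (real r / real q) s = (s - 1) * hurwitz_series (real r / real q) s" if "r \<in> {1..q}" for r
    using that q by (intro hurwitz_entire(2) s) auto
  hence "periodic_entire q f s / (s - 1)
      = of_nat q powr (- s) * (\<Sum>r=1..q. f r * hurwitz_series (real r / real q) s)"
    using s1 by (simp add: periodic_entire_def sum_distrib_left sum_divide_distrib)
  with sums_periodic_dirichlet [of q f, OF assms] show ?thesis by simp
qed

text \<open>Each Hurwitz value costs (q/r)^3, at most q^3, and there are q of them. Any fixed power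
  of q would do.\<close>

lemma periodic_entire_bound:
  "\<exists>C>0. \<forall>q f s. q > 0 \<and> (\<forall>n. norm (f n) \<le> 1) \<and> norm (s - 1) \<le> 1 / 2 \<longrightarrow>
      norm (periodic_entire q f s) \<le> C * real q ^ 4"
proof -
  obtain C where C: "C > 0" "\<And>a s. 0 < a \<Longrightarrow> a \<le> 1 \<Longrightarrow> norm (s - 1) \<le> 1 / 2 \<Longrightarrow> norm (hurwitz_entire a s) \<le> C / a ^ 3"
    using hurwitz_entire_bound by blast
  have "norm (periodic_entire q f s) \<le> C * real q ^ 4"
    if q: "q > 0" and f: "\<forall>n. norm (f n) \<le> 1" and s: "norm (s - 1) \<le> 1 / 2" for q f s
  proof -
    have "\<bar>Re (s - 1)\<bar> \<le> 1 / 2" using abs_Re_le_cmod s order_trans by blast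
    hence Re: "Re s \<ge> 0" by (simp only: minus_complex.sel one_complex.sel)
    have "norm (\<Sum>r=1..q. f r * hurwitz_entire (real r / real q) s) \<le> (\<Sum>r=1..q. C * real q ^ 3)"
    proof (rule sum_norm_le)
      fix r assume r: "r \<in> {1..q}"
      have "norm (f r * hurwitz_entire (real r / real q) s) \<le> 1 * (C / (real r / real q) ^ 3)"
        unfolding norm_mult using f C r q s by (intro mult_mono) auto
      also have "\<dots> = C * real q ^ 3 / real r ^ 3" by (simp add: power_divide)
      also have "\<dots> \<le> C * real q ^ 3 / 1"
        using r C q by (intro divide_left_mono) (auto intro!: mult_nonneg_nonneg)
      finally show "norm (f r * hurwitz_entire (real r / real q) s) \<le> C * real q ^ 3" by simp
    qed
    also have "\<dots> = C * real q ^ 4" by (simp add: eval_nat_numeral)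
    finally have *: "norm (\<Sum>r=1..q. f r * hurwitz_entire (real r / real q) s) \<le> C * real q ^ 4" .
    have "norm (of_nat q powr (- s)) = real q powr (- Re s)"
      using q norm_powr_real_powr [of "of_nat q" "- s"] by simp
    also have "\<dots> \<le> real q powr 0" using q Re by (intro powr_mono) auto
    finally have "norm (of_nat q powr (- s)) \<le> 1" using q by simp
    hence "norm (periodic_entire q f s) \<le> 1 * (C * real q ^ 4)"
      unfolding periodic_entire_def norm_mult using * C by (intro mult_mono) auto
    thus ?thesis by simp
  qed
  with C(1) show ?thesis by blast
qed

text \<open>The value at s = 1 is the one that fills the removable singularity when f sums to zero
  over a period.\<close>

definition periodic_L :: "nat \<Rightarrow> (nat \<Rightarrow> complex) \<Rightarrow> complex \<Rightarrow> complex" where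
  "periodic_L q f s = (if s = 1 then deriv (periodic_entire q f) 1 else periodic_entire q f s / (s - 1))"

lemma holomorphic_periodic_L:
  assumes q: "q > 0" and z: "(\<Sum>r=1..q. f r) = 0"
  shows "periodic_L q f holomorphic_on UNIV"
proof -
  have "(\<lambda>z. if z = 1 then deriv (periodic_entire q f) 1
           else periodic_entire q f z / (z - 1) - periodic_entire q f 1 / (z - 1)) holomorphic_on UNIV"
    by (rule pole_theorem [OF holomorphic_periodic_entire [OF q]]) auto
  moreover have "periodic_entire q f 1 = 0" using q z by (simp add: periodic_entire_at_1)
  hence "periodic_L q f = (\<lambda>z. if z = 1 then deriv (periodic_entire q f) 1
           else periodic_entire q f z / (z - 1) - periodic_entire q f 1 / (z - 1))"
    by (intro ext) (simp add: periodic_L_def)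
  ultimately show ?thesis by simp
qed

lemma sums_periodic_L:
  assumes "q > 0" "\<And>n. f (n + q) = f n" "Re s > 1"
  shows "(\<lambda>n. f n * of_nat n powr (- s)) sums periodic_L q f s"
  using sums_periodic_entire [of q f s] assms by (auto simp: periodic_L_def)

section \<open>Uniqueness of the meromorphic continuation\<close>

text \<open>The difference with its singularities removed vanishes near a point of \<open>S\<close>,
  hence everywhere, so f and g agree in a punctured neighbourhood of each point. The convention at
  poles and continuity elsewhere then fix the value at the point. This justifies the
  \<open>THE\<close> in \<open>Dirichlet_L\<close>.\<close>

lemma nicely_meromorphic_eqI:
  assumes f: "f nicely_meromorphic_on UNIV" and g: "g nicely_meromorphic_on UNIV"
    and S: "open S" "S \<noteq> {}" and eq: "\<And>z. z \<in> S \<Longrightarrow> f z = g z"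
  shows "f = g"
proof
  fix z
  define h where "h = (\<lambda>z. f z - g z)"
  have mero: "h meromorphic_on UNIV"
    using f g unfolding h_def nicely_meromorphic_on_def by (auto intro!: meromorphic_intros)
  have iso: "isolated_singularity_at h w" for w
    using mero by (simp add: meromorphic_on_isolated_singularity meromorphic_on_subset)
  obtain w where w: "w \<in> S" using S by blast
  have ev0: "eventually (\<lambda>z. z \<in> S) (at w)"
    using S w by (metis eventually_at_topological)
  have "eventually (\<lambda>z. remove_sings h z = 0) (at w)"
    using eventually_remove_sings_eq_at [OF iso [of w]] ev0
    by eventually_elim (simp add: h_def eq)
  hence "frequently (\<lambda>z. remove_sings h z = 0) (at w)"
    by (rule eventually_frequently [rotated]) simp
  hence zero: "remove_sings h x = 0" for x
    by (rule frequently_eq_meromorphic_imp_constant [OF _ remove_sings_nicely_meromorphic [OF mero]]) auto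
  have ev: "eventually (\<lambda>w. f w = g w) (at z)"
    using eventually_remove_sings_eq_at [OF iso [of z]]
    by eventually_elim (use zero in \<open>simp add: h_def\<close>)
  have pole: "is_pole f z \<longleftrightarrow> is_pole g z" by (rule is_pole_cong [OF ev refl])
  show "f z = g z"
  proof (cases "is_pole f z")
    case True
    \<comment> \<open>A nicely meromorphic function either tends to its value or has a pole with
      value 0. At a pole the first alternative is impossible, so both values are 0.\<close>
    have np: "\<not> (k \<midarrow>z\<rightarrow> k z)" if "is_pole k z" for k :: "complex \<Rightarrow> complex"
      using that unfolding is_pole_def by (meson at_neq_bot not_tendsto_and_filterlim_at_infinity)
    from True pole np [of f] np [of g] f g show ?thesis
      unfolding nicely_meromorphic_on_def by (metis UNIV_I)
  next
    case False
    hence "f \<midarrow>z\<rightarrow> f z" "g \<midarrow>z\<rightarrow> g z"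
      using f g pole unfolding nicely_meromorphic_on_def by auto
    moreover from this(2) have "f \<midarrow>z\<rightarrow> g z" using tendsto_cong [OF ev] by auto
    ultimately show ?thesis by (metis LIM_unique)
  qed
qed

lemma sums_shift_dirichlet:
  "(\<lambda>n. f (Suc n) * of_nat (Suc n) powr (- s)) sums c \<longleftrightarrow> (\<lambda>n. f n * of_nat n powr (- s)) sums (c :: complex)"
  using sums_Suc_iff [of "\<lambda>n. f n * of_nat n powr (- s)" c] by simp

lemma Dirichlet_L_eqI:
  assumes F: "F nicely_meromorphic_on UNIV"
    and s: "\<And>s. Re s > 1 \<Longrightarrow> (\<lambda>n. chi (int n) * of_nat n powr (- s)) sums F s"
  shows "Dirichlet_L chi = F"
  unfolding Dirichlet_L_def
proof (rule the_equality)
  have *: "(\<lambda>n. chi (int (Suc n)) * of_nat (Suc n) powr (- s)) sums c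
      \<longleftrightarrow> (\<lambda>n. chi (int n) * of_nat n powr (- s)) sums c" for c s
    by (rule sums_shift_dirichlet)
  show "F nicely_meromorphic_on UNIV \<and>
    (\<forall>s. Re s > 1 \<longrightarrow> (\<lambda>n. chi (int (Suc n)) * of_nat (Suc n) powr (- s)) sums F s)"
    using F s unfolding * by blast
  fix G assume G: "G nicely_meromorphic_on UNIV \<and>
    (\<forall>s. Re s > 1 \<longrightarrow> (\<lambda>n. chi (int (Suc n)) * of_nat (Suc n) powr (- s)) sums G s)"
  show "G = F"
  proof (rule nicely_meromorphic_eqI [of _ _ "{s. Re s > 1}"])
    have "(2 :: complex) \<in> {s. Re s > 1}" by simp
    thus "{s. Re s > 1} \<noteq> {}" by blast
    show "G z = F z" if "z \<in> {s. Re s > 1}" for z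
      using that G s [of z] unfolding * by (auto intro: sums_unique2)
  qed (use F G in \<open>auto simp: open_halfspace_Re_gt\<close>)
qed

lemma Dirichlet_L_periodic:
  assumes "q > 0" "\<And>n. chi (n + int q) = chi n" "(\<Sum>r=1..q. chi (int r)) = 0"
  shows "Dirichlet_L chi = periodic_L q (\<lambda>n. chi (int n))"
proof (rule Dirichlet_L_eqI)
  show "periodic_L q (\<lambda>n. chi (int n)) nicely_meromorphic_on UNIV"
    using holomorphic_periodic_L [of q "\<lambda>n. chi (int n)"] assms
    by (intro analytic_on_imp_nicely_meromorphic_on) (auto simp: analytic_on_open)
qed (use assms in \<open>auto intro!: sums_periodic_L\<close>)

text \<open>At the pole \<open>s = 1\<close> the right-hand side is \<open>1 / 0 = 0\<close>, the value that the continuation takes there.\<close>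

lemma Dirichlet_L_trivial:
  assumes "\<And>n. chi n = 1"
  shows "Dirichlet_L chi = (\<lambda>s. periodic_entire 1 (\<lambda>_. 1) s / (s - 1))"
proof (rule Dirichlet_L_eqI)
  define P where "P = periodic_entire 1 (\<lambda>_. 1)"
  have P: "P holomorphic_on UNIV" "P 1 = 1"
    using holomorphic_periodic_entire [of 1] periodic_entire_at_1 [of 1 "\<lambda>_. 1"] by (auto simp: P_def)
  have hol: "(\<lambda>s. P s / (s - 1)) holomorphic_on (UNIV - {1})"
    by (intro holomorphic_intros holomorphic_on_subset [OF P(1)]) auto
  show "(\<lambda>s. periodic_entire 1 (\<lambda>_. 1) s / (s - 1)) nicely_meromorphic_on UNIV"
    unfolding P_def [symmetric]
  proof (rule nicely_meromorphic_onI_open [where pts = "{1}"])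
    show ana: "(\<lambda>s. P s / (s - 1)) analytic_on UNIV - {1}"
      using hol by (subst analytic_on_open) auto
    show "is_pole (\<lambda>s. P s / (s - 1)) x \<and> P x / (x - 1) = 0" if "x \<in> {1}" for x
      using that is_pole_basic [OF P(1), of 1 1] P(2) by auto
    show "isolated_singularity_at (\<lambda>s. P s / (s - 1)) x" for x
    proof (cases "x = 1")
      case True
      show ?thesis
        by (rule isolated_singularity_at_holomorphic [of _ UNIV]) (use hol True in auto)
    next
      case False
      thus ?thesis using analytic_on_subset [OF ana, of "{x}"] by (intro isolated_singularity_at_analytic) auto
    qed
  qed auto
  show "(\<lambda>n. chi (int n) * of_nat n powr (- s)) sums (periodic_entire 1 (\<lambda>_. 1) s / (s - 1))"
    if "Re s > 1" for s
    using sums_periodic_entire [of 1 "\<lambda>_. 1" s] that assms by simp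
qed

subsection \<open>Absolutely convergent Dirichlet series\<close>

text \<open>The index \<open>n = 0\<close> contributes nothing to the series below, since \<open>0 powr z = 0\<close>.\<close>

definition dirichlet_series :: "(nat \<Rightarrow> complex) \<Rightarrow> complex \<Rightarrow> complex" where
  "dirichlet_series a s = (\<Sum>n. a n * of_nat n powr (- s))"

definition abs_conv_dirichlet :: "(nat \<Rightarrow> complex) \<Rightarrow> bool" where
  "abs_conv_dirichlet a \<longleftrightarrow> (\<forall>\<sigma>>1. summable (\<lambda>n. norm (a n) * real n powr (- \<sigma>)))"

lemma norm_nat_powr: "norm (of_nat n powr (- s) :: complex) = real n powr (- Re s)"
  using norm_powr_real_powr [of "of_nat n" "- s"] by (cases "n = 0") simp_all

lemma abs_conv_dirichlet_bounded:
  assumes "\<And>n. norm (a n) \<le> C"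
  shows "abs_conv_dirichlet a"
  unfolding abs_conv_dirichlet_def
proof (intro allI impI)
  fix \<sigma> :: real assume "\<sigma> > 1"
  hence "summable (\<lambda>n. C * real n powr (- \<sigma>))"
    by (intro summable_mult) (simp add: summable_real_powr_iff)
  thus "summable (\<lambda>n. norm (a n) * real n powr (- \<sigma>))"
    by (rule summable_comparison_test' [where N = 0]) (use assms in \<open>simp add: mult_right_mono\<close>)
qed

lemma abs_conv_dirichlet_mult_ln:
  assumes "abs_conv_dirichlet a"
  shows "abs_conv_dirichlet (\<lambda>n. a n * of_real (ln (real n)))"
  unfolding abs_conv_dirichlet_def
proof (intro allI impI)
  fix \<sigma> :: real assume \<sigma>: "\<sigma> > 1"
  \<comment> \<open>Half of the room between 1 and \<sigma> is spent on absorbing the logarithm, by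
    ln n \<le> n^e / e.\<close>
  define e where "e = (\<sigma> - 1) / 2"
  have e: "e > 0" "\<sigma> - e > 1" using \<sigma> by (auto simp: e_def field_simps)
  have "summable (\<lambda>n. 1 / e * (norm (a n) * real n powr (- (\<sigma> - e))))"
    using assms e(2) unfolding abs_conv_dirichlet_def by (intro summable_mult) auto
  thus "summable (\<lambda>n. norm (a n * complex_of_real (ln (real n))) * real n powr (- \<sigma>))"
  proof (rule summable_comparison_test' [where N = 1])
    fix n :: nat assume n: "n \<ge> 1"
    have "\<bar>ln (real n)\<bar> * real n powr (- \<sigma>) \<le> real n powr e / e * real n powr (- \<sigma>)"
      using ln_powr_bound [of "real n" e] n e by (intro mult_right_mono) auto
    also have "\<dots> = 1 / e * real n powr (- (\<sigma> - e))"
      using powr_add [of "real n" e "- \<sigma>"] by simp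
    finally have "norm (a n) * (\<bar>ln (real n)\<bar> * real n powr (- \<sigma>)) \<le> norm (a n) * (1 / e * real n powr (- (\<sigma> - e)))"
      by (rule mult_left_mono) auto
    thus "norm (norm (a n * complex_of_real (ln (real n))) * real n powr (- \<sigma>)) \<le> 1 / e * (norm (a n) * real n powr (- (\<sigma> - e)))"
      by (simp add: norm_mult mult_ac)
  qed
qed

lemma summable_norm_dirichlet:
  assumes "abs_conv_dirichlet a" "Re s > 1"
  shows "summable (\<lambda>n. norm (a n * of_nat n powr (- s)))"
  using assms by (simp add: abs_conv_dirichlet_def norm_mult norm_nat_powr)

lemma sums_dirichlet_series:
  assumes "abs_conv_dirichlet a" "Re s > 1"
  shows "(\<lambda>n. a n * of_nat n powr (- s)) sums dirichlet_series a s"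
  unfolding dirichlet_series_def
  using summable_norm_cancel [OF summable_norm_dirichlet [OF assms]] by (rule summable_sums)

lemma has_sum_dirichlet_series:
  assumes "abs_conv_dirichlet a" "Re s > 1"
  shows "((\<lambda>n. a n * of_nat n powr (- s)) has_sum dirichlet_series a s) {0<..}"
proof -
  have "((\<lambda>n. a n * of_nat n powr (- s)) has_sum dirichlet_series a s) UNIV"
    by (rule norm_summable_imp_has_sum [OF summable_norm_dirichlet sums_dirichlet_series]) (use assms in auto)
  also have "?this \<longleftrightarrow> ?thesis"
    by (rule has_sum_cong_neutral) auto
  finally show ?thesis .
qed

lemma
  assumes a: "abs_conv_dirichlet a"
  shows holomorphic_dirichlet_series: "dirichlet_series a holomorphic_on {s. Re s > 1}"
    and deriv_dirichlet_series: "Re z > 1 \<Longrightarrow> deriv (dirichlet_series a) z = dirichlet_series (\<lambda>n. - a n * of_real (ln (real n))) z"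
proof -
  let ?S = "{s. Re s > 1}"
  let ?f = "\<lambda>n s. a n * of_nat n powr (- s)"
  have op: "open ?S" by (simp add: open_halfspace_Re_gt)
  have hol: "?f n holomorphic_on ?S" for n
    by (cases "n = 0") (auto intro!: holomorphic_intros)
  have bd: "\<exists>d h. d > 0 \<and> summable h \<and>
          (\<forall>\<^sub>F n in sequentially. \<forall>y\<in>ball z d \<inter> ?S. norm (?f n y) \<le> h n)"
    if z: "z \<in> ?S" for z
  proof -
    define e where "e = (Re z - 1) / 2"
    have e: "e > 0" "1 + e > 1" using z by (auto simp: e_def)
    show ?thesis
    proof (intro exI conjI)
      show "summable (\<lambda>n. norm (a n) * real n powr (- (1 + e)))"
        using a e(2) unfolding abs_conv_dirichlet_def by blast
      show "\<forall>\<^sub>F n in sequentially. \<forall>y\<in>ball z e \<inter> ?S. norm (?f n y) \<le> norm (a n) * real n powr (- (1 + e))"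
        using eventually_ge_at_top [of 1]
      proof eventually_elim
        case (elim n)
        show ?case
        proof
          fix y assume y: "y \<in> ball z e \<inter> ?S"
          have "\<bar>Re (z - y)\<bar> \<le> norm (z - y)" by (rule abs_Re_le_cmod)
          also have "\<dots> < e" using y by (simp add: dist_norm)
          finally have "Re z - Re y < e" by simp
          hence "Re y > 1 + e" unfolding e_def by argo
          hence "real n powr (- Re y) \<le> real n powr (- (1 + e))"
            using elim by (intro powr_mono) auto
          thus "norm (?f n y) \<le> norm (a n) * real n powr (- (1 + e))"
            by (simp add: norm_mult norm_nat_powr mult_left_mono)
        qed
      qed
    qed (use e in auto)
  qed
  show "dirichlet_series a holomorphic_on ?S"
    using holomorphic_series(1) [OF op hol bd] by (simp add: dirichlet_series_def [abs_def])
  assume z: "Re z > 1"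
  have d: "deriv (?f n) z = - a n * of_real (ln (real n)) * of_nat n powr (- z)" for n
  proof (cases "n = 0")
    case False
    have "((\<lambda>s. of_nat n powr (- s)) has_field_derivative (Ln (of_nat n) * of_nat n powr (- z)) * (-1)) (at z)"
      by (rule DERIV_chain2 [OF has_field_derivative_powr_right])
         (use False in \<open>auto intro!: derivative_eq_intros\<close>)
    from DERIV_cmult [OF this, of "a n"]
    have "(?f n has_field_derivative - a n * of_real (ln (real n)) * of_nat n powr (- z)) (at z)"
      using False by (simp add: Ln_of_nat algebra_simps)
    thus ?thesis by (rule DERIV_imp_deriv)
  qed auto
  have "(\<lambda>n. deriv (?f n) z) sums deriv (\<lambda>z. \<Sum>n. ?f n z) z"
    by (rule holomorphic_series(3) [OF op hol bd]) (use z in auto)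
  thus "deriv (dirichlet_series a) z = dirichlet_series (\<lambda>n. - a n * of_real (ln (real n))) z"
    unfolding d by (simp add: dirichlet_series_def [abs_def] sums_iff)
qed

lemma higher_deriv_dirichlet_series:
  assumes "abs_conv_dirichlet a" "Re z > 1"
  shows "(deriv ^^ k) (dirichlet_series a) z = dirichlet_series (\<lambda>n. a n * of_real (- ln (real n)) ^ k) z"
    and "abs_conv_dirichlet (\<lambda>n. a n * of_real (- ln (real n)) ^ k)"
proof -
  have "abs_conv_dirichlet (\<lambda>n. a n * of_real (- ln (real n)) ^ k) \<and>
    (\<forall>z. Re z > 1 \<longrightarrow> (deriv ^^ k) (dirichlet_series a) z = dirichlet_series (\<lambda>n. a n * of_real (- ln (real n)) ^ k) z)"
  proof (induction k)
    case (Suc k)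
    let ?b = "\<lambda>n. a n * of_real (- ln (real n)) ^ k"
    have eq: "(\<lambda>n. - ?b n * of_real (ln (real n))) = (\<lambda>n. a n * of_real (- ln (real n)) ^ Suc k)"
      by (simp add: mult_ac)
    have "abs_conv_dirichlet (\<lambda>n. - ?b n)" using Suc by (simp add: abs_conv_dirichlet_def)
    hence "abs_conv_dirichlet (\<lambda>n. a n * of_real (- ln (real n)) ^ Suc k)"
      using abs_conv_dirichlet_mult_ln [of "\<lambda>n. - ?b n"] unfolding eq by simp
    moreover have "(deriv ^^ Suc k) (dirichlet_series a) z = dirichlet_series (\<lambda>n. a n * of_real (- ln (real n)) ^ Suc k) z"
      if z: "Re z > 1" for z
    proof -
      have "eventually (\<lambda>w. w \<in> {s. Re s > 1}) (nhds z)"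
        using z by (intro eventually_nhds_in_open open_halfspace_Re_gt) auto
      hence "eventually (\<lambda>w. (deriv ^^ k) (dirichlet_series a) w = dirichlet_series ?b w) (nhds z)"
        by eventually_elim (use Suc in auto)
      hence "(deriv ^^ Suc k) (dirichlet_series a) z = deriv (dirichlet_series ?b) z"
        by (simp add: deriv_cong_ev)
      also have "\<dots> = dirichlet_series (\<lambda>n. a n * of_real (- ln (real n)) ^ Suc k) z"
        using deriv_dirichlet_series [of ?b z] Suc z unfolding eq by simp
      finally show ?thesis .
    qed
    ultimately show ?case by blast
  qed (use assms in auto)
  with assms show "(deriv ^^ k) (dirichlet_series a) z = dirichlet_series (\<lambda>n. a n * of_real (- ln (real n)) ^ k) z"
    and "abs_conv_dirichlet (\<lambda>n. a n * of_real (- ln (real n)) ^ k)" by auto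
qed

section \<open>Dirichlet convolution and the von Mangoldt function\<close>

definition dirichlet_conv :: "(nat \<Rightarrow> complex) \<Rightarrow> (nat \<Rightarrow> complex) \<Rightarrow> nat \<Rightarrow> complex" where
  "dirichlet_conv a b n = (\<Sum>d | d dvd n. a d * b (n div d))"

text \<open>Reindexes the pairs (m, k) by (m k, m). The value type is general because the lemma
  serves both the complex terms (product formula) and their norms (absolute convergence).\<close>

lemma dirichlet_conv_has_sum:
  fixes F :: "nat \<times> nat \<Rightarrow> 'a :: {topological_comm_monoid_add, t3_space}"
  assumes "(F has_sum S) ({0<..} \<times> {0<..})"
  shows "((\<lambda>n. \<Sum>d | d dvd n. F (d, n div d)) has_sum S) {0<..}"
proof -
  have "(F has_sum S) ({0<..} \<times> {0<..}) \<longleftrightarrow>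
     ((\<lambda>(n, d). F (d, n div d)) has_sum S) (Sigma {0<..} (\<lambda>n. {d. d dvd n}))"
  proof (rule has_sum_reindex_bij_witness [where j = "\<lambda>(m, k). (m * k, m)" and i = "\<lambda>(n, d). (d, n div d)"])
  qed (auto simp: dvd_div_eq_0_iff intro: dvd_pos_nat)
  with assms have *: "((\<lambda>(n, d). F (d, n div d)) has_sum S) (Sigma {0<..} (\<lambda>n. {d. d dvd n}))" by simp
  show ?thesis
    by (rule has_sum_SigmaD [OF *]) (auto intro!: has_sum_finite)
qed

lemma dirichlet_conv:
  assumes a: "abs_conv_dirichlet a" and b: "abs_conv_dirichlet b"
  shows "abs_conv_dirichlet (dirichlet_conv a b)"
    and "Re s > 1 \<Longrightarrow> dirichlet_series (dirichlet_conv a b) s = dirichlet_series a s * dirichlet_series b s"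
proof -
  have absum: "(\<lambda>n. norm (c n * of_nat n powr (- s))) summable_on {0<..}"
    if "abs_conv_dirichlet c" "Re s > 1" for c s
    using norm_summable_imp_summable_on [of "\<lambda>n. norm (c n * of_nat n powr (- s))"] that summable_norm_dirichlet
    by (auto intro: summable_on_subset_banach)
  define F where "F = (\<lambda>s (m, k). (a m * of_nat m powr (- s)) * (b k * of_nat k powr (- s)))"
  have abs2: "(\<lambda>x. norm (F s x)) summable_on ({0<..} \<times> {0<..})" if s: "Re s > 1" for s
  proof (rule iffD2 [OF Infinite_Sum.abs_summable_on_Sigma_iff], intro conjI ballI)
    show "(\<lambda>k. norm (F s (m, k))) summable_on {0<..}" for m
      unfolding F_def norm_mult prod.case using absum [OF b s] unfolding norm_mult
      by (intro summable_on_cmult_right)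
    have "norm (\<Sum>\<^sub>\<infinity>k\<in>{0<..}. norm (F s (m, k)))
      = norm (a m * of_nat m powr (- s)) * (\<Sum>\<^sub>\<infinity>k\<in>{0<..}. norm (b k * of_nat k powr (- s)))" for m
      unfolding F_def prod.case norm_mult [of "a m * of_nat m powr (- s)"]
      by (subst infsum_cmult_right') (simp add: norm_mult infsum_nonneg)
    thus "(\<lambda>m. norm (\<Sum>\<^sub>\<infinity>k\<in>{0<..}. norm (F s (m, k)))) summable_on {0<..}"
      using absum [OF a s] by (simp add: summable_on_cmult_left)
  qed
  have eq: "(\<Sum>d | d dvd n. F s (d, n div d)) = dirichlet_conv a b n * of_nat n powr (- s)" if "n > 0" for s n
    unfolding dirichlet_conv_def sum_distrib_right
  proof (rule sum.cong)
    fix d assume "d \<in> {d. d dvd n}"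
    then obtain k where n: "n = d * k" by (auto simp: dvd_def)
    have "complex_of_nat n powr (- s) = of_nat d powr (- s) * of_nat k powr (- s)"
      unfolding n using powr_times_real [of "of_nat d" "of_nat k" "- s"] by simp
    thus "F s (d, n div d) = a d * b (n div d) * of_nat n powr (- s)"
      using n that by (simp add: F_def)
  qed simp
  have hs: "((\<lambda>n. dirichlet_conv a b n * of_nat n powr (- s)) has_sum (dirichlet_series a s * dirichlet_series b s)) {0<..}"
    if s: "Re s > 1" for s
  proof -
    have "(F s has_sum (dirichlet_series a s * dirichlet_series b s)) ({0<..} \<times> {0<..})"
    proof (rule has_sum_SigmaI [where g = "\<lambda>m. a m * of_nat m powr (- s) * dirichlet_series b s"])
      show "F s summable_on {0<..} \<times> {0<..}"
        using abs2 [OF s] by (rule abs_summable_summable)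
    qed (use has_sum_dirichlet_series [OF a s] has_sum_dirichlet_series [OF b s]
         in \<open>auto simp: F_def intro!: has_sum_cmult_right has_sum_cmult_left\<close>)
    from dirichlet_conv_has_sum [OF this] show ?thesis
      by (subst (asm) has_sum_cong [OF eq]) auto
  qed
  show ac: "abs_conv_dirichlet (dirichlet_conv a b)"
    unfolding abs_conv_dirichlet_def
  proof (intro allI impI)
    fix \<sigma> :: real assume \<sigma>: "\<sigma> > 1"
    have "(\<lambda>x. norm (F (of_real \<sigma>) x)) summable_on ({0<..} \<times> {0<..})" by (rule abs2) (use \<sigma> in simp)
    then obtain S where "((\<lambda>x. norm (F (of_real \<sigma>) x)) has_sum S) ({0<..} \<times> {0<..})"
      by (auto simp: summable_on_def)
    from dirichlet_conv_has_sum [OF this]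
    have "(\<lambda>n. \<Sum>d | d dvd n. norm (F (of_real \<sigma>) (d, n div d))) summable_on {0<..}"
      by (auto simp: summable_on_def)
    hence "(\<lambda>n. norm (norm (dirichlet_conv a b n) * real n powr (- \<sigma>))) summable_on {0<..}"
    proof (rule Infinite_Sum.abs_summable_on_comparison_test')
      fix n :: nat assume n: "n \<in> {0<..}"
      have "norm (dirichlet_conv a b n) * real n powr (- \<sigma>) = norm (dirichlet_conv a b n * of_nat n powr (- of_real \<sigma>))"
        by (simp add: norm_mult norm_nat_powr)
      also have "\<dots> \<le> (\<Sum>d | d dvd n. norm (F (of_real \<sigma>) (d, n div d)))"
        using eq [of n "of_real \<sigma>"] n by (metis greaterThan_iff norm_sum)
      finally show "norm (norm (dirichlet_conv a b n) * real n powr (- \<sigma>)) \<le> (\<Sum>d | d dvd n. norm (F (of_real \<sigma>) (d, n div d)))"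
        by simp
    qed
    hence "(\<lambda>n. norm (dirichlet_conv a b n) * real n powr (- \<sigma>)) summable_on UNIV"
      by (subst (asm) summable_on_cong_neutral [where T = UNIV and g = "\<lambda>n. norm (dirichlet_conv a b n) * real n powr (- \<sigma>)"]) auto
    thus "summable (\<lambda>n. norm (dirichlet_conv a b n) * real n powr (- \<sigma>))"
      by (rule summable_on_imp_summable)
  qed
  assume s: "Re s > 1"
  show "dirichlet_series (dirichlet_conv a b) s = dirichlet_series a s * dirichlet_series b s"
    using has_sum_unique [OF has_sum_dirichlet_series [OF ac s] hs [OF s]] .
qed

text \<open>Since log n is the sum of Lambda(d) over d | n and f is completely multiplicative, f log
  is the convolution of f with f Lambda. No Euler product enters.\<close>

lemma deriv_completely_multiplicative_series:
  assumes f: "\<And>n. norm (f n) \<le> 1" "\<And>m n. f (m * n) = f m * f n" and s: "Re s > 1"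
  shows "deriv (dirichlet_series f) s = - dirichlet_series f s * dirichlet_series (\<lambda>n. f n * mangoldt n) s"
    and "abs_conv_dirichlet (\<lambda>n. f n * mangoldt n)"
proof -
  have f': "abs_conv_dirichlet f" using f(1) by (rule abs_conv_dirichlet_bounded)
  show m: "abs_conv_dirichlet (\<lambda>n. f n * mangoldt n)"
    unfolding abs_conv_dirichlet_def
  proof (intro allI impI)
    fix \<sigma> :: real assume \<sigma>: "\<sigma> > 1"
    have "summable (\<lambda>n. norm (f n * of_real (ln (real n))) * real n powr (- \<sigma>))"
      using abs_conv_dirichlet_mult_ln [OF f'] \<sigma> by (auto simp: abs_conv_dirichlet_def)
    thus "summable (\<lambda>n. norm (f n * mangoldt n) * real n powr (- \<sigma>))"
      by (rule summable_comparison_test' [where N = 1])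
         (auto simp: norm_mult mangoldt_nonneg intro!: mult_mono mangoldt_le)
  qed
  have conv: "dirichlet_conv f (\<lambda>n. f n * mangoldt n) n = f n * of_real (ln (real n))" if n: "n > 0" for n
  proof -
    have "dirichlet_conv f (\<lambda>n. f n * mangoldt n) n = (\<Sum>d | d dvd n. f n * mangoldt (n div d))"
      unfolding dirichlet_conv_def
      by (intro sum.cong refl) (metis dvd_mult_div_cancel f(2) mem_Collect_eq mult.assoc)
    also have "\<dots> = f n * (\<Sum>d | d dvd n. mangoldt (n div d))" by (simp add: sum_distrib_left)
    also have "(\<Sum>d | d dvd n. mangoldt (n div d) :: complex) = (\<Sum>d | d dvd n. mangoldt d)"
      by (rule sum.reindex_bij_witness [where i = "\<lambda>d. n div d" and j = "\<lambda>d. n div d"])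
         (use n in \<open>auto simp: div_div_eq_right\<close>)
    also have "\<dots> = of_real (ln (real n))" using n by (intro mangoldt_sum) auto
    finally show ?thesis .
  qed
  have "deriv (dirichlet_series f) s = dirichlet_series (\<lambda>n. - f n * of_real (ln (real n))) s"
    by (rule deriv_dirichlet_series [OF f' s])
  also have "\<dots> = - dirichlet_series (dirichlet_conv f (\<lambda>n. f n * mangoldt n)) s"
    unfolding dirichlet_series_def
  proof (subst suminf_minus [symmetric])
    show "summable (\<lambda>n. dirichlet_conv f (\<lambda>n. f n * mangoldt n) n * of_nat n powr (- s))"
      using sums_dirichlet_series [OF dirichlet_conv(1) [OF f' m] s] by (rule sums_summable)
    show "(\<Sum>n. - f n * of_real (ln (real n)) * of_nat n powr (- s))
        = (\<Sum>n. - (dirichlet_conv f (\<lambda>n. f n * mangoldt n) n * of_nat n powr (- s)))"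
    proof (rule suminf_cong)
      show "- f n * of_real (ln (real n)) * of_nat n powr (- s)
        = - (dirichlet_conv f (\<lambda>n. f n * mangoldt n) n * of_nat n powr (- s))" for n
        by (cases "n = 0") (simp_all add: conv)
    qed
  qed
  also have "\<dots> = - dirichlet_series f s * dirichlet_series (\<lambda>n. f n * mangoldt n) s"
    using dirichlet_conv(2) [OF f' m s] by simp
  finally show "deriv (dirichlet_series f) s = - dirichlet_series f s * dirichlet_series (\<lambda>n. f n * mangoldt n) s" .
qed

subsection \<open>Local factorisation and the Borel--Caratheodory inequality\<close>

lemma holomorphic_split_zero:
  assumes f: "f holomorphic_on S" and S: "open S" "connected S"
    and \<rho>: "\<rho> \<in> S" "f \<rho> = 0" and nz: "z0 \<in> S" "f z0 \<noteq> 0"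
  shows "\<exists>n h. n > 0 \<and> h holomorphic_on S \<and> h \<rho> \<noteq> 0 \<and> (\<forall>z\<in>S. f z = (z - \<rho>) ^ n * h z)"
proof -
  have "\<not> f constant_on S" using \<rho> nz unfolding constant_on_def by metis
  then obtain g r n where g: "0 < n" "0 < r" "ball \<rho> r \<subseteq> S" "g holomorphic_on ball \<rho> r"
      "\<And>w. w \<in> ball \<rho> r \<Longrightarrow> f w = (w - \<rho>) ^ n * g w" "\<And>w. w \<in> ball \<rho> r \<Longrightarrow> g w \<noteq> 0"
    using holomorphic_factor_zero_nonconstant [OF f S \<rho>] by metis
  define h where "h = (\<lambda>z. if z = \<rho> then g \<rho> else f z / (z - \<rho>) ^ n)"
  have hg: "h w = g w" if "w \<in> ball \<rho> r" for w
    using g(5) [OF that] by (auto simp: h_def)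
  have "h holomorphic_on ball \<rho> r"
    by (rule holomorphic_transform [OF g(4)]) (simp add: hg)
  moreover have "h holomorphic_on (S - {\<rho>})"
    by (rule holomorphic_transform [where f = "\<lambda>z. f z / (z - \<rho>) ^ n"])
       (auto simp: h_def intro!: holomorphic_intros holomorphic_on_subset [OF f])
  ultimately have "h holomorphic_on (ball \<rho> r \<union> (S - {\<rho>}))"
    using S by (intro holomorphic_on_Un) (auto simp: open_delete)
  moreover have "ball \<rho> r \<union> (S - {\<rho>}) = S" using g(2,3) \<rho>(1) by auto
  ultimately have "h holomorphic_on S" by simp
  moreover have "f z = (z - \<rho>) ^ n * h z" if "z \<in> S" for z
    using g(1) \<rho>(2) by (auto simp: h_def)
  moreover have "h \<rho> \<noteq> 0" using hg g(2,6) by simp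
  ultimately show ?thesis using g(1) by blast
qed

text \<open>Induction on the number of distinct zeros in \<open>K\<close>, each divided out to its
  full order, so \<open>zs\<close> lists them with multiplicity. The point \<open>z0\<close> keeps f
  from vanishing identically, which makes that number finite.\<close>

lemma holomorphic_split_zeros:
  assumes "f holomorphic_on S" and S: "open S" "connected S" and K: "compact K" "K \<subseteq> S"
    and nz: "z0 \<in> S" "f z0 \<noteq> 0"
  shows "\<exists>zs g. g holomorphic_on S \<and> (\<forall>z\<in>S. f z = g z * (\<Prod>\<rho>\<leftarrow>zs. z - \<rho>)) \<and>
           set zs = {z\<in>K. f z = 0} \<and> (\<forall>z\<in>K. g z \<noteq> 0)"
proof -
  have fin: "finite {z\<in>K. h z = 0}" if "h holomorphic_on S" "h z0 \<noteq> 0" for h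
  proof (cases "h constant_on S")
    case True
    hence "{z\<in>K. h z = 0} = {}" using K nz(1) that unfolding constant_on_def by (auto simp: subset_iff)
    thus ?thesis by (simp only: finite.emptyI)
  next
    case False
    thus ?thesis using holomorphic_compact_finite_zeros that S K by blast
  qed
  define n where "n = card {z\<in>K. f z = 0}"
  show ?thesis using n_def assms(1) nz(2)
  proof (induction n arbitrary: f rule: less_induct)
    case (less n)
    show ?case
    proof (cases "{z\<in>K. f z = 0} = {}")
      case True
      thus ?thesis using less.prems by (intro exI [of _ "[]"] exI [of _ f]) auto
    next
      case False
      then obtain \<rho> where \<rho>: "\<rho> \<in> K" "f \<rho> = 0" by blast
      then obtain m h where h: "m > 0" "h holomorphic_on S" "h \<rho> \<noteq> 0" "\<And>z. z \<in> S \<Longrightarrow> f z = (z - \<rho>) ^ m * h z"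
        using holomorphic_split_zero [of f S \<rho> z0] less.prems S K nz by blast
      have eq: "{z\<in>K. f z = 0} = insert \<rho> {z\<in>K. h z = 0}"
        using h K \<rho> by (auto simp: subset_iff)
      have h0: "h z0 \<noteq> 0" using h(4) [OF nz(1)] less.prems by auto
      have "card {z\<in>K. h z = 0} < n"
        unfolding less.prems eq using fin [OF h(2) h0] h(3) by simp
      then obtain zs g where g: "g holomorphic_on S" "\<And>z. z \<in> S \<Longrightarrow> h z = g z * (\<Prod>\<rho>\<leftarrow>zs. z - \<rho>)"
           "set zs = {z\<in>K. h z = 0}" "\<And>z. z \<in> K \<Longrightarrow> g z \<noteq> 0"
        using less.IH [OF _ refl h(2) h0] by blast
      show ?thesis
      proof (intro exI conjI)
        show "\<forall>z\<in>S. f z = g z * (\<Prod>\<rho>\<leftarrow>replicate m \<rho> @ zs. z - \<rho>)"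
          using g(2) h(4) by (simp add: prod_list_replicate mult_ac)
        show "set (replicate m \<rho> @ zs) = {z\<in>K. f z = 0}"
          using g(3) h(1) eq by auto
      qed (use g in auto)
    qed
  qed
qed

lemma higher_deriv_inverse_linear:
  assumes "z \<noteq> (\<rho> :: complex)"
  shows "(deriv ^^ m) (\<lambda>z. 1 / (z - \<rho>)) z = (- 1) ^ m * fact m / (z - \<rho>) ^ Suc m"
  using assms
proof (induction m arbitrary: z)
  case (Suc m)
  have "eventually (\<lambda>w. w \<in> - {\<rho>}) (nhds z)"
    using Suc.prems by (intro eventually_nhds_in_open) auto
  hence ev: "eventually (\<lambda>w. (deriv ^^ m) (\<lambda>z. 1 / (z - \<rho>)) w = (- 1) ^ m * fact m / (w - \<rho>) ^ Suc m) (nhds z)"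
    by eventually_elim (use Suc.IH in auto)
  have "((\<lambda>w. (- 1) ^ m * fact m / (w - \<rho>) ^ Suc m) has_field_derivative
      (- 1) ^ Suc m * fact (Suc m) / (z - \<rho>) ^ Suc (Suc m)) (at z)"
    using Suc.prems
    by (auto intro!: derivative_eq_intros simp del: power_Suc simp: divide_simps)
       (simp add: algebra_simps)
  thus ?case using deriv_cong_ev [OF ev refl] DERIV_imp_deriv by simp
qed auto

text \<open>Partial fractions for the logarithmic derivative, one root at a time. Besides the zeros
  of L-functions it handles the pole of zeta, through (s - 1) zeta(s) with
  \<open>zs = [1]\<close>.\<close>

lemma higher_deriv_logderiv_split:
  assumes "open S" "s \<in> S" and g: "g holomorphic_on S" and nz: "g s \<noteq> 0" "\<And>\<rho>. \<rho> \<in> set zs \<Longrightarrow> s \<noteq> \<rho>"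
    and f: "\<And>z. z \<in> S \<Longrightarrow> f z = g z * (\<Prod>\<rho>\<leftarrow>zs. z - \<rho>)"
  shows "(deriv ^^ m) (\<lambda>z. deriv f z / f z) s = (deriv ^^ m) (\<lambda>z. deriv g z / g z) s
           + (\<Sum>\<rho>\<leftarrow>zs. (- 1) ^ m * fact m / (s - \<rho>) ^ Suc m)"
  using nz(2) f
proof (induction zs arbitrary: f)
  case Nil
  have ev: "eventually (\<lambda>z. f z = g z) (nhds z)" if "z \<in> S" for z
    using eventually_nhds_in_open [OF \<open>open S\<close> that] by eventually_elim (use Nil in auto)
  have "eventually (\<lambda>z. deriv f z / f z = deriv g z / g z) (nhds s)"
    using eventually_nhds_in_open [OF \<open>open S\<close> \<open>s \<in> S\<close>]
    by eventually_elim (use ev Nil in \<open>auto intro!: arg_cong2 [where f = "(/)"] deriv_cong_ev\<close>)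
  thus ?case by (simp add: higher_deriv_cong_ev)
next
  case (Cons \<rho> zs)
  define h where "h = (\<lambda>z. g z * (\<Prod>\<rho>\<leftarrow>zs. z - \<rho>))"
  have hol_h: "h holomorphic_on S" unfolding h_def
  proof (intro holomorphic_intros g)
    show "(\<lambda>z. \<Prod>\<rho>\<leftarrow>zs. z - \<rho>) holomorphic_on S" for zs :: "complex list"
      by (induction zs) (auto intro!: holomorphic_intros)
  qed
  have hs: "h s \<noteq> 0" using nz(1) Cons.prems(1) by (auto simp: h_def prod_list_zero_iff)
  have "isCont h s"
    using hol_h \<open>open S\<close> \<open>s \<in> S\<close> by (meson continuous_on_eq_continuous_at holomorphic_on_imp_continuous_on)
  then obtain U where U: "open U" "s \<in> U" "\<And>z. z \<in> U \<Longrightarrow> h z \<noteq> 0"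
    using continuous_at_avoid [of s h 0] hs by (metis centre_in_ball dist_commute mem_ball open_ball)
  define V where "V = S \<inter> U - {\<rho>}"
  have V: "open V" "s \<in> V" "V \<subseteq> S" "\<And>z. z \<in> V \<Longrightarrow> h z \<noteq> 0" "\<rho> \<notin> V"
    using U \<open>open S\<close> \<open>s \<in> S\<close> Cons.prems(1) by (auto simp: V_def)
  have fh: "f z = (z - \<rho>) * h z" if "z \<in> S" for z
    using Cons.prems(2) [OF that] by (simp add: h_def mult_ac)
  have eq: "deriv f z / f z = 1 / (z - \<rho>) + deriv h z / h z" if z: "z \<in> V" for z
  proof -
    have "eventually (\<lambda>z. f z = (z - \<rho>) * h z) (nhds z)"
      using eventually_nhds_in_open [OF \<open>open S\<close> subsetD [OF V(3) z]] by eventually_elim (rule fh)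
    hence "deriv f z = deriv (\<lambda>z. (z - \<rho>) * h z) z" by (rule deriv_cong_ev) simp
    also have "\<dots> = h z + (z - \<rho>) * deriv h z"
    proof (rule DERIV_imp_deriv)
      have "(h has_field_derivative deriv h z) (at z)"
        by (rule holomorphic_derivI [OF hol_h \<open>open S\<close> subsetD [OF V(3) z]])
      thus "((\<lambda>z. (z - \<rho>) * h z) has_field_derivative h z + (z - \<rho>) * deriv h z) (at z)"
        by (auto intro!: derivative_eq_intros)
    qed
    finally have "deriv f z = h z + (z - \<rho>) * deriv h z" .
    moreover have "f z = (z - \<rho>) * h z" "z - \<rho> \<noteq> 0" "h z \<noteq> 0"
      using fh [OF subsetD [OF V(3) z]] V(4) [OF z] V(5) z by auto
    moreover have "(c + b * d) / (b * c) = 1 / b + d / c" if "b \<noteq> 0" "c \<noteq> 0" for b c d :: complex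
      using that by (simp add: field_simps)
    ultimately show ?thesis by simp
  qed
  have hol2: "(\<lambda>z. deriv h z / h z) holomorphic_on V"
    using V hol_h \<open>open S\<close> by (intro holomorphic_intros holomorphic_deriv holomorphic_on_subset [OF hol_h]
       holomorphic_on_subset [OF holomorphic_deriv [OF hol_h]]) auto
  have hol1: "(\<lambda>z. 1 / (z - \<rho>)) holomorphic_on V"
    using V(5) by (intro holomorphic_intros) auto
  have "eventually (\<lambda>z. deriv f z / f z = 1 / (z - \<rho>) + deriv h z / h z) (nhds s)"
    using eventually_nhds_in_open [OF V(1,2)] by eventually_elim (rule eq)
  hence "(deriv ^^ m) (\<lambda>z. deriv f z / f z) s = (deriv ^^ m) (\<lambda>z. 1 / (z - \<rho>) + deriv h z / h z) s"
    by (rule higher_deriv_cong_ev) simp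
  also have "\<dots> = (deriv ^^ m) (\<lambda>z. 1 / (z - \<rho>)) s + (deriv ^^ m) (\<lambda>z. deriv h z / h z) s"
    by (rule higher_deriv_add [OF hol1 hol2 V(1,2)])
  also have "(deriv ^^ m) (\<lambda>z. 1 / (z - \<rho>)) s = (- 1) ^ m * fact m / (s - \<rho>) ^ Suc m"
    using Cons.prems(1) by (intro higher_deriv_inverse_linear) auto
  also have "(deriv ^^ m) (\<lambda>z. deriv h z / h z) s = (deriv ^^ m) (\<lambda>z. deriv g z / g z) s
           + (\<Sum>\<rho>\<leftarrow>zs. (- 1) ^ m * fact m / (s - \<rho>) ^ Suc m)"
    by (rule Cons.IH) (use Cons.prems(1) in \<open>auto simp: h_def\<close>)
  finally show ?case by simp
qed

text \<open>The map u -> u / (2 M - u) sends the half-plane Re u < M into the unit disk and fixes 0.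
  The Schwarz lemma then bounds h on the disk of half the radius, and Cauchy's inequality on its
  boundary bounds the derivatives.\<close>

lemma Borel_Caratheodory_coeff:
  assumes h: "h holomorphic_on ball s \<rho>" and \<rho>: "\<rho> > 0" and M: "M > 0"
    and Re: "\<And>z. z \<in> ball s \<rho> \<Longrightarrow> Re (h z) < M" and h0: "h s = 0"
  shows "norm ((deriv ^^ k) h s) \<le> fact k * (2 * M) / (\<rho> / 2) ^ k"
proof -
  define \<phi> where "\<phi> = (\<lambda>w. h (s + of_real \<rho> * w) / (2 * of_real M - h (s + of_real \<rho> * w)))"
  have inb: "s + of_real \<rho> * w \<in> ball s \<rho>" if "norm w < 1" for w
    using that \<rho> by (simp add: dist_norm norm_mult)
  have ne: "2 * of_real M - u \<noteq> 0" if "Re u < M" for u :: complex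
    using that M by (auto simp: complex_eq_iff)
  have hol: "\<phi> holomorphic_on ball 0 1"
    unfolding \<phi>_def
  proof (intro holomorphic_intros)
    show "(\<lambda>w. h (s + of_real \<rho> * w)) holomorphic_on ball 0 1"
      by (rule holomorphic_on_compose_gen [OF _ h, unfolded o_def])
         (use inb in \<open>auto intro!: holomorphic_intros simp del: dist_add_cancel\<close>)
    thus "(\<lambda>w. h (s + of_real \<rho> * w)) holomorphic_on ball 0 1" .
    show "\<And>w. w \<in> ball 0 1 \<Longrightarrow> 2 * of_real M - h (s + of_real \<rho> * w) \<noteq> 0"
      using inb by (intro ne Re) auto
  qed
  have lt: "norm u < norm (2 * of_real M - u)" if "Re u < M" for u :: complex
  proof (rule power2_less_imp_less)
    have "M * Re u < M * M" using that M by simp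
    thus "(norm u)\<^sup>2 < (norm (2 * of_real M - u))\<^sup>2"
      unfolding cmod_power2 by (simp add: power2_eq_square algebra_simps)
  qed auto
  have bd: "norm (\<phi> w) < 1" if "norm w < 1" for w
    using lt [OF Re [OF inb [OF that]]] ne [OF Re [OF inb [OF that]]]
    by (simp add: \<phi>_def norm_divide)
  \<comment> \<open>The Schwarz lemma gives |h| \<le> |2 M - h| / 2 \<le> M + |h| / 2, hence |h|
    \<le> 2 M.\<close>
  have half: "norm (h z) \<le> 2 * M" if z: "norm (z - s) \<le> \<rho> / 2" for z
  proof -
    define w where "w = (z - s) / of_real \<rho>"
    have w: "norm w \<le> 1 / 2" "z = s + of_real \<rho> * w"
      using z \<rho> by (auto simp: w_def norm_divide field_simps)
    have "norm (\<phi> w) \<le> norm w"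
      by (rule Schwarz_Lemma(1) [OF hol _ bd]) (use w h0 in \<open>auto simp: \<phi>_def\<close>)
    hence "norm (h z) / norm (2 * of_real M - h z) \<le> 1 / 2"
      using w(1) order_trans unfolding \<phi>_def w(2) [symmetric] norm_divide by blast
    hence "norm (h z) \<le> 1 / 2 * norm (2 * of_real M - h z)"
      using ne [OF Re [of z]] inb [of w] w by (simp add: divide_le_eq)
    also have "norm (2 * of_real M - h z) \<le> 2 * M + norm (h z)"
      using norm_triangle_ineq4 [of "2 * of_real M" "h z"] M by simp
    finally show ?thesis by simp
  qed
  have sub: "cball s (\<rho> / 2) \<subseteq> ball s \<rho>" using \<rho> by auto
  show ?thesis
  proof (rule Cauchy_inequality)
    show "h holomorphic_on ball s (\<rho> / 2)"
      using holomorphic_on_subset [OF h] sub by (meson ball_subset_cball order_trans)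
    show "continuous_on (cball s (\<rho> / 2)) h"
      using holomorphic_on_imp_continuous_on [OF holomorphic_on_subset [OF h sub]] .
    show "norm (h x) \<le> 2 * M" if "norm (s - x) = \<rho> / 2" for x
      using that by (intro half) (simp add: norm_minus_commute)
  qed (use \<rho> in auto)
qed

text \<open>After division by the zeros in the disk of radius r/2, the quotient has a logarithm
  there whose real part exceeds its value at the centre by at most M, so
  \<open>Borel_Caratheodory_coeff\<close> controls its derivatives. Every zero is real and left of x
  and thus contributes a positive term; all are dropped except one for the point in
  \<open>B\<close>. An empty \<open>B\<close> covers the functions of which no zero is singled
  out.\<close>

lemma logderiv_coeff_lower_bound:
  assumes f: "f holomorphic_on UNIV" and r: "r > 0" and M: "M \<ge> 0"
    and f0: "f (of_real x) \<noteq> 0"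
    and bd: "\<And>z. norm (z - of_real x) = r \<Longrightarrow> norm (f z) \<le> exp M * norm (f (of_real x))"
    and zeros: "\<And>z. norm (z - of_real x) \<le> r / 2 \<Longrightarrow> f z = 0 \<Longrightarrow> z \<in> \<real> \<and> Re z < x"
    and B: "B = {} \<or> (B = {\<beta>} \<and> f (of_real \<beta>) = 0 \<and> \<bar>\<beta> - x\<bar> \<le> r / 2)"
  shows "Re ((- 1) ^ m / fact m * (deriv ^^ m) (\<lambda>z. deriv f z / f z) (of_real x))
     \<ge> (\<Sum>\<beta>\<in>B. 1 / (x - \<beta>) ^ Suc m) - real (Suc m) * (2 * (M + 1)) * (4 / r) ^ Suc m"
proof -
  define s where "s = complex_of_real x"
  obtain zs g where g: "g holomorphic_on UNIV" "\<And>z. f z = g z * (\<Prod>\<rho>\<leftarrow>zs. z - \<rho>)"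
      "set zs = {z\<in>cball s (r / 2). f z = 0}" "\<And>z. z \<in> cball s (r / 2) \<Longrightarrow> g z \<noteq> 0"
    using holomorphic_split_zeros [OF f open_UNIV convex_connected [OF convex_UNIV] compact_cball subset_UNIV UNIV_I f0, of s "r / 2"]
    by (metis UNIV_I)
  have zs: "s \<noteq> \<rho>" "norm (s - \<rho>) \<le> r / 2" "\<rho> \<in> \<real>" "Re \<rho> < x" if "\<rho> \<in> set zs" for \<rho>
    using that f0 zeros [of \<rho>] unfolding g(3) by (auto simp: s_def dist_norm norm_minus_commute)
  have gs: "g s \<noteq> 0" using g(4) r by simp
  \<comment> \<open>Division preserves the growth bound: a zero lies within r/2 of the centre, hence
    at least r/2 from any point of the circle, so each linear factor is no smaller on the circle
    than at the centre.\<close>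
  have sphere: "norm (g z) \<le> exp M * norm (g s)" if z: "norm (z - s) = r" for z
  proof -
    have P: "norm (\<Prod>\<rho>\<leftarrow>ys. s - \<rho>) \<le> norm (\<Prod>\<rho>\<leftarrow>ys. z - \<rho>) \<and> norm (\<Prod>\<rho>\<leftarrow>ys. s - \<rho>) > 0"
      if "set ys \<subseteq> set zs" for ys
      using that
    proof (induction ys)
      case (Cons \<rho> ys)
      have "norm (z - s) \<le> norm (z - \<rho>) + norm (s - \<rho>)"
        using norm_triangle_ineq4 [of "z - \<rho>" "s - \<rho>"] by simp
      hence "norm (s - \<rho>) \<le> norm (z - \<rho>)" using z zs(2) [of \<rho>] Cons.prems by simp
      moreover have "norm (s - \<rho>) > 0" using zs(1) [of \<rho>] Cons.prems by simp
      ultimately show ?case using Cons by (auto simp: norm_mult intro!: mult_mono)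
    qed auto
    have "norm (g z) * norm (\<Prod>\<rho>\<leftarrow>zs. s - \<rho>) \<le> norm (g z) * norm (\<Prod>\<rho>\<leftarrow>zs. z - \<rho>)"
      using P [of zs] by (intro mult_left_mono) auto
    also have "\<dots> = norm (f z)" by (simp add: g(2) norm_mult)
    also have "\<dots> \<le> exp M * norm (f s)" using bd z by (simp add: s_def)
    also have "\<dots> = exp M * norm (g s) * norm (\<Prod>\<rho>\<leftarrow>zs. s - \<rho>)" by (simp add: g(2) norm_mult)
    finally show ?thesis using P [of zs] by simp
  qed
  have disc: "norm (g z) \<le> exp M * norm (g s)" if z: "z \<in> ball s r" for z
  proof (rule maximum_modulus_frontier [of g "cball s r"])
    show "g holomorphic_on interior (cball s r)" using g(1) by (rule holomorphic_on_subset) auto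
    show "continuous_on (closure (cball s r)) g"
      by (rule holomorphic_on_imp_continuous_on [OF holomorphic_on_subset [OF g(1)]]) auto
    show "norm (g z) \<le> exp M * norm (g s)" if "z \<in> frontier (cball s r)" for z
      using that r by (intro sphere) (auto simp: frontier_cball dist_norm norm_minus_commute)
  qed (use z in auto)
  have gh: "g holomorphic_on ball s (r / 2)" "\<And>z. z \<in> ball s (r / 2) \<Longrightarrow> g z \<noteq> 0"
    using g by (auto intro: holomorphic_on_subset)
  obtain H where H: "H holomorphic_on ball s (r / 2)" "\<And>z. z \<in> ball s (r / 2) \<Longrightarrow> g z = exp (H z)"
    using contractible_imp_holomorphic_log [OF gh(1) convex_imp_contractible [OF convex_ball] gh(2)] by metis
  define h where "h = (\<lambda>z. H z - H s)"
  have hh: "h holomorphic_on ball s (r / 2)" unfolding h_def by (intro holomorphic_intros H)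
  \<comment> \<open>Two halvings of r, one for the zeros and one for the Schwarz lemma, produce 4 /
    r. The real part is at most M; M + 1 makes the bound strict and positive.\<close>
  have "norm ((deriv ^^ Suc m) h s) \<le> fact (Suc m) * (2 * (M + 1)) / ((r / 2) / 2) ^ Suc m"
  proof (rule Borel_Caratheodory_coeff [OF hh])
    fix z assume z: "z \<in> ball s (r / 2)"
    have "exp (Re (h z)) = norm (g z) / norm (g s)"
      using H(2) [OF z] H(2) [of s] r by (simp add: h_def exp_diff norm_exp_eq_Re)
    also have "\<dots> \<le> exp M" using disc [of z] z r gs by (simp add: field_simps)
    finally show "Re (h z) < M + 1" by simp
  qed (use r M in \<open>auto simp: h_def\<close>)
  also have "\<dots> = fact m * (real (Suc m) * (2 * (M + 1)) * (4 / r) ^ Suc m)"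
  proof -
    have "((r / 2) / 2) ^ Suc m = inverse ((4 / r) ^ Suc m)"
      unfolding power_inverse [symmetric] by simp
    thus ?thesis by (simp only: divide_inverse inverse_inverse_eq fact_Suc of_nat_mult mult_ac)
  qed
  finally have hb: "norm ((deriv ^^ Suc m) h s) \<le> fact m * (real (Suc m) * (2 * (M + 1)) * (4 / r) ^ Suc m)" .
  have "eventually (\<lambda>z. deriv g z / g z = deriv h z) (nhds s)"
    using eventually_nhds_in_open [of "ball s (r / 2)" s, OF open_ball]
  proof (rule eventually_mono)
    show "s \<in> ball s (r / 2)" using r by simp
    fix z assume z: "z \<in> ball s (r / 2)"
    have "(H has_field_derivative deriv H z) (at z)"
      using H(1) z by (intro holomorphic_derivI) auto
    hence "((\<lambda>z. exp (H z)) has_field_derivative exp (H z) * deriv H z) (at z)"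
      by (auto intro!: derivative_eq_intros)
    hence "(g has_field_derivative exp (H z) * deriv H z) (at z)"
      by (rule has_field_derivative_transform_within_open [of _ _ _ "ball s (r / 2)"]) (use z H(2) in auto)
    moreover have "(h has_field_derivative deriv H z) (at z)"
      unfolding h_def using \<open>(H has_field_derivative deriv H z) (at z)\<close> by (auto intro!: derivative_eq_intros)
    ultimately show "deriv g z / g z = deriv h z" using H(2) [OF z] by (simp add: DERIV_imp_deriv)
  qed
  hence hd: "(deriv ^^ m) (\<lambda>z. deriv g z / g z) s = (deriv ^^ Suc m) h s"
    by (simp add: higher_deriv_cong_ev funpow_swap1 [of deriv] funpow_Suc_right del: funpow.simps)
  have "(deriv ^^ m) (\<lambda>z. deriv f z / f z) s = (deriv ^^ Suc m) h s
           + (\<Sum>\<rho>\<leftarrow>zs. (- 1) ^ m * fact m / (s - \<rho>) ^ Suc m)"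
    unfolding hd [symmetric]
    by (rule higher_deriv_logderiv_split [of UNIV]) (use g gs zs in auto)
  hence "(- 1) ^ m / fact m * (deriv ^^ m) (\<lambda>z. deriv f z / f z) s
     = (- 1) ^ m / fact m * (deriv ^^ Suc m) h s + (\<Sum>\<rho>\<leftarrow>zs. 1 / (s - \<rho>) ^ Suc m)"
    by (simp add: sum_list_const_mult [symmetric] algebra_simps power_mult_distrib [symmetric] del: funpow.simps)
  hence "Re ((- 1) ^ m / fact m * (deriv ^^ m) (\<lambda>z. deriv f z / f z) s)
     = Re ((- 1) ^ m / fact m * (deriv ^^ Suc m) h s) + Re (\<Sum>\<rho>\<leftarrow>zs. 1 / (s - \<rho>) ^ Suc m)"
    by simp
  moreover have "\<bar>Re ((- 1) ^ m / fact m * (deriv ^^ Suc m) h s)\<bar> \<le> real (Suc m) * (2 * (M + 1)) * (4 / r) ^ Suc m"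
  proof -
    have "\<bar>Re ((- 1) ^ m / fact m * (deriv ^^ Suc m) h s)\<bar> \<le> norm ((- 1) ^ m / fact m * (deriv ^^ Suc m) h s)"
      by (rule abs_Re_le_cmod)
    also have "\<dots> = norm ((deriv ^^ Suc m) h s) / fact m"
      by (simp add: norm_mult norm_divide norm_power del: funpow.simps)
    also have "\<dots> \<le> real (Suc m) * (2 * (M + 1)) * (4 / r) ^ Suc m"
      using hb by (simp add: field_simps del: funpow.simps)
    finally show ?thesis .
  qed
  moreover have "Re (\<Sum>\<rho>\<leftarrow>zs. 1 / (s - \<rho>) ^ Suc m) \<ge> (\<Sum>\<beta>\<in>B. 1 / (x - \<beta>) ^ Suc m)"
  proof -
    have summand: "1 / (s - \<rho>) ^ Suc m = of_real (1 / (x - Re \<rho>) ^ Suc m)" if "\<rho> \<in> set zs" for \<rho>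
    proof -
      have "\<rho> = of_real (Re \<rho>)" using zs(3) [OF that] by (simp add: of_real_Re)
      hence "s - \<rho> = of_real (x - Re \<rho>)" by (simp add: s_def)
      thus ?thesis by simp
    qed
    have "(\<Sum>\<rho>\<leftarrow>zs. 1 / (s - \<rho>) ^ Suc m) = (\<Sum>\<rho>\<leftarrow>zs. of_real (1 / (x - Re \<rho>) ^ Suc m))"
      using summand by (intro arg_cong [where f = sum_list] map_cong) auto
    also have "\<dots> = of_real (\<Sum>\<rho>\<leftarrow>zs. 1 / (x - Re \<rho>) ^ Suc m)"
      by (induction zs) auto
    finally have eq: "Re (\<Sum>\<rho>\<leftarrow>zs. 1 / (s - \<rho>) ^ Suc m) = (\<Sum>\<rho>\<leftarrow>zs. 1 / (x - Re \<rho>) ^ Suc m)" by simp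
    have nn: "1 / (x - Re \<rho>) ^ Suc m \<ge> 0" if "\<rho> \<in> set zs" for \<rho>
      using zs(4) [OF that] by simp
    show ?thesis
    proof (cases "B = {}")
      case True
      thus ?thesis unfolding eq using nn by (auto intro!: sum_list_nonneg)
    next
      case False
      hence B': "B = {\<beta>}" "f (of_real \<beta>) = 0" "\<bar>\<beta> - x\<bar> \<le> r / 2" using B by auto
      hence "of_real \<beta> \<in> set zs"
        unfolding g(3) s_def by (simp add: dist_norm abs_minus_commute flip: of_real_diff)
      hence "1 / (x - Re (of_real \<beta>)) ^ Suc m \<le> (\<Sum>\<rho>\<leftarrow>zs. 1 / (x - Re \<rho>) ^ Suc m)"
        by (intro member_le_sum_list) (use nn in \<open>auto simp del: power_Suc Re_complex_of_real\<close>)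
      thus ?thesis unfolding eq using B' by simp
    qed
  qed
  ultimately show ?thesis unfolding s_def [symmetric] by linarith
qed

subsection \<open>Logarithmic derivatives\<close>

lemma higher_deriv_logderiv_dirichlet:
  assumes f: "\<And>n. norm (f n) \<le> 1" "\<And>m n. f (m * n) = f m * f n" and s: "Re s > 1"
    and nz: "dirichlet_series f s \<noteq> 0"
  shows "(deriv ^^ m) (\<lambda>z. deriv (dirichlet_series f) z / dirichlet_series f z) s
       = - dirichlet_series (\<lambda>n. f n * mangoldt n * of_real (- ln (real n)) ^ m) s"
proof -
  let ?D = "dirichlet_series f" and ?S = "{s. Re s > 1}"
  have op: "open ?S" by (simp add: open_halfspace_Re_gt)
  have hol: "?D holomorphic_on ?S"
    by (rule holomorphic_dirichlet_series [OF abs_conv_dirichlet_bounded [OF f(1)]])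
  have ac: "abs_conv_dirichlet (\<lambda>n. f n * mangoldt n)"
    by (rule deriv_completely_multiplicative_series [OF f s])
  have "isCont ?D s"
    using hol op s by (metis continuous_on_eq_continuous_at holomorphic_on_imp_continuous_on mem_Collect_eq)
  hence "eventually (\<lambda>z. ?D z \<noteq> 0) (nhds s)"
    using nz by (auto intro: tendsto_imp_eventually_ne simp: isCont_def eventually_nhds_conv_at)
  moreover have "eventually (\<lambda>z. z \<in> ?S) (nhds s)"
    using s by (intro eventually_nhds_in_open op) auto
  ultimately have "eventually (\<lambda>z. deriv ?D z / ?D z = - dirichlet_series (\<lambda>n. f n * mangoldt n) z) (nhds s)"
    by eventually_elim (simp add: deriv_completely_multiplicative_series(1) [OF f])
  hence "(deriv ^^ m) (\<lambda>z. deriv ?D z / ?D z) s = (deriv ^^ m) (\<lambda>z. - dirichlet_series (\<lambda>n. f n * mangoldt n) z) s"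
    by (rule higher_deriv_cong_ev) simp
  also have "\<dots> = - (deriv ^^ m) (dirichlet_series (\<lambda>n. f n * mangoldt n)) s"
    by (rule higher_deriv_uminus [OF holomorphic_dirichlet_series [OF ac] op]) (use s in auto)
  also have "(deriv ^^ m) (dirichlet_series (\<lambda>n. f n * mangoldt n)) s
     = dirichlet_series (\<lambda>n. f n * mangoldt n * of_real (- ln (real n)) ^ m) s"
    by (rule higher_deriv_dirichlet_series [OF ac s])
  finally show ?thesis .
qed

text \<open>Up to the sign (-1)^m, the real part of the m-th Taylor coefficient at x of the series
  of f(n) Lambda(n) n^-s. As a real series with weights independent of f it can be added termwise
  over several f.\<close>

definition mangoldt_sum_coeff :: "(nat \<Rightarrow> complex) \<Rightarrow> nat \<Rightarrow> real \<Rightarrow> real" where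
  "mangoldt_sum_coeff f m x = (\<Sum>n. Re (f n) * (mangoldt n * ln (real n) ^ m * real n powr (- x) / fact m))"

lemma mangoldt_sum_coeff:
  assumes f: "\<And>n. norm (f n) \<le> 1" "\<And>m n. f (m * n) = f m * f n" and x: "x > 1"
  shows "(\<lambda>n. Re (f n) * (mangoldt n * ln (real n) ^ m * real n powr (- x) / fact m)) sums mangoldt_sum_coeff f m x"
    and "Re ((- 1) ^ m / fact m * dirichlet_series (\<lambda>n. f n * mangoldt n * of_real (- ln (real n)) ^ m) (of_real x))
      = mangoldt_sum_coeff f m x"
proof -
  let ?b = "\<lambda>n. f n * mangoldt n * of_real (- ln (real n)) ^ m"
  have ac: "abs_conv_dirichlet ?b"
    by (rule higher_deriv_dirichlet_series(2) [of _ "of_real x"])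
       (use deriv_completely_multiplicative_series(2) [OF f, of "of_real x"] x in auto)
  have "(\<lambda>n. ?b n * of_nat n powr (- of_real x)) sums dirichlet_series ?b (of_real x)"
    by (rule sums_dirichlet_series [OF ac]) (use x in auto)
  hence "(\<lambda>n. Re ((- 1) ^ m / fact m * (?b n * of_nat n powr (- of_real x)))) sums
     Re ((- 1) ^ m / fact m * dirichlet_series ?b (of_real x))"
    by (intro sums_Re sums_mult)
  also have "(\<lambda>n. Re ((- 1) ^ m / fact m * (?b n * of_nat n powr (- of_real x))))
     = (\<lambda>n. Re (f n) * (mangoldt n * ln (real n) ^ m * real n powr (- x) / fact m))"
  proof
    fix n
    have "complex_of_nat n powr (- of_real x) = of_real (real n powr (- x))"
      using powr_of_real [of "real n" "- x"] by simp
    hence "(- 1 :: complex) ^ m / fact m * (?b n * of_nat n powr (- of_real x))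
       = f n * of_real (mangoldt n * ((-1) ^ m * (- ln (real n)) ^ m) * real n powr (- x) / fact m)"
      by simp
    also have "(-1) ^ m * (- ln (real n)) ^ m = ln (real n) ^ m"
      by (subst power_mult_distrib [symmetric]) simp
    finally show "Re ((- 1) ^ m / fact m * (?b n * of_nat n powr (- of_real x)))
      = Re (f n) * (mangoldt n * ln (real n) ^ m * real n powr (- x) / fact m)"
      by (simp only: times_complex.sel Re_complex_of_real Im_complex_of_real mult_zero_right diff_zero)
  qed
  finally have *: "(\<lambda>n. Re (f n) * (mangoldt n * ln (real n) ^ m * real n powr (- x) / fact m)) sums
     Re ((- 1) ^ m / fact m * dirichlet_series ?b (of_real x))" .
  show "Re ((- 1) ^ m / fact m * dirichlet_series ?b (of_real x)) = mangoldt_sum_coeff f m x"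
    using * by (simp add: mangoldt_sum_coeff_def sums_iff)
  with * show "(\<lambda>n. Re (f n) * (mangoldt n * ln (real n) ^ m * real n powr (- x) / fact m)) sums mangoldt_sum_coeff f m x"
    by simp
qed

subsection \<open>Removing Euler factors\<close>

definition euler_factors :: "nat set \<Rightarrow> (nat \<Rightarrow> complex) \<Rightarrow> complex \<Rightarrow> complex" where
  "euler_factors P f s = (\<Prod>p\<in>P. 1 - f p * of_nat p powr (- s))"

text \<open>One prime at a time: the terms whose index is a multiple of p, reindexed by p n, give
  f(p) p^-s times the series left so far.\<close>

lemma dirichlet_series_remove_primes:
  assumes f: "\<And>n. norm (f n) \<le> 1" "\<And>m n. f (m * n) = f m * f n" and s: "Re s > 1"
    and P: "finite P" "\<And>p. p \<in> P \<Longrightarrow> prime p"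
  shows "dirichlet_series (\<lambda>n. if \<exists>p\<in>P. p dvd n then 0 else f n) s = euler_factors P f s * dirichlet_series f s"
  using P
proof (induction P rule: finite_induct)
  case (insert p P)
  define g where "g = (\<lambda>n. if \<exists>p\<in>P. p dvd n then 0 else f n)"
  have p: "prime p" "\<And>q. q \<in> P \<Longrightarrow> prime q" using insert.prems by auto
  have ac: "abs_conv_dirichlet g"
    by (rule abs_conv_dirichlet_bounded [where C = 1]) (use f(1) in \<open>auto simp: g_def\<close>)
  have sg: "(\<lambda>n. g n * of_nat n powr (- s)) sums dirichlet_series g s"
    by (rule sums_dirichlet_series [OF ac s])
  have gp: "g (p * n) = f p * g n" for n
  proof -
    have "q dvd p * n \<longleftrightarrow> q dvd n" if "q \<in> P" for q
      using that insert.hyps p by (metis prime_dvd_mult_iff primes_dvd_imp_eq)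
    thus ?thesis by (auto simp: g_def f(2))
  qed
  have "(\<lambda>n. f p * of_nat p powr (- s) * (g n * of_nat n powr (- s))) sums
      (f p * of_nat p powr (- s) * dirichlet_series g s)"
    by (intro sums_mult sg)
  also have "(\<lambda>n. f p * of_nat p powr (- s) * (g n * of_nat n powr (- s)))
     = (\<lambda>n. if p dvd p * n then g (p * n) * of_nat (p * n) powr (- s) else 0)"
  proof
    fix n
    have "complex_of_nat (p * n) powr (- s) = of_nat p powr (- s) * of_nat n powr (- s)"
      using powr_times_real [of "of_nat p" "of_nat n" "- s"] by simp
    thus "f p * of_nat p powr (- s) * (g n * of_nat n powr (- s))
       = (if p dvd p * n then g (p * n) * of_nat (p * n) powr (- s) else 0)"
      by (simp add: gp)
  qed
  also have "\<dots> sums (f p * of_nat p powr (- s) * dirichlet_series g s)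
     \<longleftrightarrow> (\<lambda>n. if p dvd n then g n * of_nat n powr (- s) else 0) sums (f p * of_nat p powr (- s) * dirichlet_series g s)"
    by (rule sums_mono_reindex [where f = "\<lambda>n. if p dvd n then g n * of_nat n powr (- s) else 0"])
       (use prime_gt_0_nat [OF p(1)] in \<open>auto simp: strict_mono_def dvd_def\<close>)
  finally have "(\<lambda>n. g n * of_nat n powr (- s) - (if p dvd n then g n * of_nat n powr (- s) else 0)) sums
      (dirichlet_series g s - f p * of_nat p powr (- s) * dirichlet_series g s)"
    by (intro sums_diff sg)
  also have "(\<lambda>n. g n * of_nat n powr (- s) - (if p dvd n then g n * of_nat n powr (- s) else 0))
     = (\<lambda>n. (if \<exists>p\<in>insert p P. p dvd n then 0 else f n) * of_nat n powr (- s))"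
    by (auto simp: g_def)
  finally have "dirichlet_series (\<lambda>n. if \<exists>p\<in>insert p P. p dvd n then 0 else f n) s
     = (1 - f p * of_nat p powr (- s)) * dirichlet_series g s"
    unfolding dirichlet_series_def [of "\<lambda>n. if \<exists>p\<in>insert p P. p dvd n then 0 else f n"]
    by (simp add: sums_iff algebra_simps)
  also have "dirichlet_series g s = euler_factors P f s * dirichlet_series f s"
    unfolding g_def by (rule insert.IH) (use p in auto)
  finally show ?case using insert.hyps by (simp add: euler_factors_def mult_ac)
qed (simp add: euler_factors_def)

lemma coprimeI_primes:
  fixes a b :: "'a :: factorial_semiring"
  assumes "b \<noteq> 0" "\<And>p. prime p \<Longrightarrow> p dvd a \<Longrightarrow> \<not> p dvd b"
  shows "coprime a b"
proof (rule coprimeI)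
  fix c assume c: "c dvd a" "c dvd b"
  show "is_unit c"
  proof (rule ccontr)
    assume "\<not> is_unit c"
    moreover have "c \<noteq> 0" using c(2) assms(1) by auto
    ultimately obtain p where "p dvd c" "prime p" using prime_divisor_exists by blast
    thus False using c assms(2) dvd_trans by blast
  qed
qed

lemma coprime_iff_no_prime_factor:
  assumes "Q > 0"
  shows "coprime n (Q :: nat) \<longleftrightarrow> \<not> (\<exists>p\<in>prime_factors Q. p dvd n)"
proof
  assume "\<not> (\<exists>p\<in>prime_factors Q. p dvd n)"
  thus "coprime n Q"
    using assms by (intro coprimeI_primes) (auto simp: in_prime_factors_iff)
next
  assume c: "coprime n Q"
  show "\<not> (\<exists>p\<in>prime_factors Q. p dvd n)"
  proof
    assume "\<exists>p\<in>prime_factors Q. p dvd n"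
    then obtain p where "prime p" "p dvd Q" "p dvd n" by (auto simp: in_prime_factors_iff)
    thus False using c by (metis coprime_common_divisor not_prime_unit)
  qed
qed

lemma dirichlet_series_coprime:
  assumes f: "\<And>n. norm (f n) \<le> 1" "\<And>m n. f (m * n) = f m * f n" and s: "Re s > 1" and Q: "Q > 0"
  shows "dirichlet_series (\<lambda>n. if coprime n Q then f n else 0) s
     = euler_factors (prime_factors Q) f s * dirichlet_series f s"
proof -
  have "(\<lambda>n. if coprime n Q then f n else 0) = (\<lambda>n. if \<exists>p\<in>prime_factors Q. p dvd n then 0 else f n)"
    using coprime_iff_no_prime_factor [OF Q] by auto
  thus ?thesis using dirichlet_series_remove_primes [OF f s, of "prime_factors Q"] by (simp add: in_prime_factors_iff)
qed

lemma holomorphic_euler_factors: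
  assumes "\<And>p. p \<in> P \<Longrightarrow> p > 0"
  shows "euler_factors P f holomorphic_on S"
  unfolding euler_factors_def by (intro holomorphic_intros) (use assms in force)

text \<open>For Re s > 0 each |f(p) p^-s| is below 1; this is the half-plane in which removing Euler
  factors creates no zeros.\<close>

lemma euler_factors_nonzero:
  assumes f: "\<And>n. norm (f n) \<le> 1" and s: "Re s > 0" and P: "finite P" "\<And>p. p \<in> P \<Longrightarrow> prime p"
  shows "euler_factors P f s \<noteq> 0"
proof -
  have "1 - f p * of_nat p powr (- s) \<noteq> 0" if "p \<in> P" for p
  proof -
    have p: "p > 1" using P(2) [OF that] by (rule prime_gt_1_nat)
    have "norm (f p * of_nat p powr (- s)) \<le> 1 * real p powr (- Re s)"
      unfolding norm_mult norm_nat_powr by (intro mult_right_mono f) auto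
    also have "\<dots> < 1" using p s by (simp add: powr_less_one)
    finally show ?thesis by force
  qed
  thus ?thesis using P(1) by (simp add: euler_factors_def)
qed

subsection \<open>Characters\<close>

lemma dirichlet_character_shift:
  assumes "dirichlet_character q chi"
  shows "chi (n + int q * k) = chi n"
proof -
  have nat: "chi (m + int q * int j) = chi m" for m j
  proof (induction j)
    case (Suc j)
    have "chi (m + int q * int (Suc j)) = chi (m + int q * int j + int q)" by (simp add: algebra_simps)
    also have "\<dots> = chi (m + int q * int j)" using assms by (simp add: dirichlet_character_def)
    finally show ?case using Suc by simp
  qed simp
  show ?thesis
  proof (cases "k \<ge> 0")
    case True
    thus ?thesis using nat [of n "nat k"] by simp
  next
    case False
    thus ?thesis using nat [of "n + int q * k" "nat (- k)"] by simp
  qed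
qed

lemma dirichlet_character_one: "dirichlet_character q chi \<Longrightarrow> chi 1 = 1"
  unfolding dirichlet_character_def by (metis coprime_1_left mult_cancel_right1 mult_1)

text \<open>The witness for \<open>k\<close> is the product of the primes dividing q but not n. A
  prime factor of q that divides n divides neither d nor this product; one that does not divide n
  divides the product.\<close>

lemma coprime_representative:
  fixes n d q :: int
  assumes "q > 0" "coprime n d"
  shows "\<exists>k. coprime (n + d * k) q"
proof -
  define A where "A = {p. prime p \<and> p dvd q \<and> \<not> p dvd n}"
  have "A \<subseteq> prime_factors q" using assms by (auto simp: A_def in_prime_factors_iff)
  hence fin: "finite A" by (rule finite_subset) simp
  have "coprime (n + d * \<Prod>A) q"
  proof (rule coprimeI_primes)
    show "q \<noteq> 0" using assms by simp
    fix p assume p: "prime p" "p dvd n + d * \<Prod>A"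
    show "\<not> p dvd q"
    proof
      assume pq: "p dvd q"
      show False
      proof (cases "p dvd n")
        case True
        hence "p dvd d * \<Prod>A" using p by (simp add: dvd_add_right_iff)
        moreover have "\<not> p dvd d" using True assms(2) p(1) by (metis coprime_common_divisor not_prime_unit)
        ultimately have "p dvd \<Prod>A" using p(1) prime_dvd_mult_iff by blast
        then obtain p' where "p' \<in> A" "p dvd p'"
          using prime_dvd_prod_iff [OF fin p(1), of "\<lambda>x. x"] by auto
        thus False using True p(1) primes_dvd_imp_eq unfolding A_def by blast
      next
        case False
        hence "p dvd \<Prod>A" using p(1) pq fin by (intro dvd_prodI) (auto simp: A_def)
        thus False using p(2) False by (metis dvd_add_left_iff dvd_mult)
      qed
    qed
  qed
  thus ?thesis by blast
qed

text \<open>Needed because the hypothesis on zeros concerns primitive characters, while chi1 chi2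
  need not be primitive. Any modulus inducing \<psi> also induces chi, so minimality of the
  conductor makes \<psi> primitive.\<close>

lemma primitive_inducing_character:
  assumes chi: "dirichlet_character q chi" and real: "\<And>n. chi n \<in> \<real>"
  shows "\<exists>d \<psi>. (d, \<psi>) \<in> real_primitive_characters \<and> d dvd q \<and> d > 0 \<and>
           (\<forall>n. coprime n (int q) \<longrightarrow> chi n = \<psi> n)"
proof -
  define d where "d = conductor q chi"
  have q: "q > 0" using chi by (simp add: dirichlet_character_def)
  have "induced_from q chi q" using chi by (auto simp: induced_from_def)
  hence "induced_from q chi d" unfolding d_def conductor_def by (rule LeastI)
  then obtain \<psi> where d: "d dvd q" and \<psi>: "dirichlet_character d \<psi>"
     and eq: "\<And>n. coprime n (int q) \<Longrightarrow> chi n = \<psi> n"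
    by (auto simp: induced_from_def)
  have d0: "d > 0" using \<psi> by (simp add: dirichlet_character_def)
  have cop: "coprime n (int d)" if "coprime n (int q)" for n
    using that d by (meson coprime_divisors dvd_refl of_nat_dvd_iff)
  have "conductor d \<psi> = d"
    unfolding conductor_def
  proof (rule Least_equality)
    show "induced_from d \<psi> d" using \<psi> by (auto simp: induced_from_def)
    fix e assume "induced_from d \<psi> e"
    then obtain \<phi> where "e dvd d" "dirichlet_character e \<phi>" "\<And>n. coprime n (int d) \<Longrightarrow> \<psi> n = \<phi> n"
      by (auto simp: induced_from_def)
    hence "induced_from q chi e" using d eq cop unfolding induced_from_def by (metis dvd_trans)
    thus "d \<le> e" unfolding d_def conductor_def by (rule Least_le)
  qed
  \<comment> \<open>For n coprime to d but not to q, chi does not show \<psi>(n) directly; n is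
    first moved within its class mod d to a number coprime to q.\<close>
  moreover have "\<psi> n \<in> \<real>" for n
  proof (cases "coprime n (int d)")
    case True
    then obtain k where k: "coprime (n + int d * k) (int q)"
      using coprime_representative [of "int q" n "int d"] q by auto
    have "\<psi> n = chi (n + int d * k)"
      using eq [OF k] dirichlet_character_shift [OF \<psi>] by simp
    thus ?thesis using real by simp
  next
    case False
    thus ?thesis using \<psi> by (auto simp: dirichlet_character_def)
  qed
  ultimately have "(d, \<psi>) \<in> real_primitive_characters"
    using \<psi> by (simp add: real_primitive_characters_def primitive_character_def)
  thus ?thesis using d d0 eq by blast
qed

section \<open>Real nonprincipal characters of arbitrary modulus\<close>

text \<open>Primitivity is not demanded, so that the product of two primitive characters, taken to
  modulus q1 q2, can be an instance.\<close>

locale real_nonprincipal =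
  fixes q :: nat and chi :: "int \<Rightarrow> complex"
  assumes character: "dirichlet_character q chi"
    and real: "chi n \<in> \<real>"
    and nonprincipal: "\<exists>n. coprime n (int q) \<and> chi n \<noteq> 1"
begin

definition f :: "nat \<Rightarrow> complex" where "f n = chi (int n)"

definition L :: "complex \<Rightarrow> complex" where "L = periodic_L q f"

lemma q_pos: "q > 0" using character by (simp add: dirichlet_character_def)

lemma mult: "f (m * n) = f m * f n"
  using character by (simp add: dirichlet_character_def f_def)

lemma f_1: "f 1 = 1" using dirichlet_character_one [OF character] by (simp add: f_def)

lemma periodic: "f (n + q) = f n"
  using character by (simp add: dirichlet_character_def f_def)

lemma f_mod: "f n = f (n mod q)"
proof -
  have "chi (int (n mod q)) = chi (int (n mod q) + int q * int (n div q))"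
    using dirichlet_character_shift [OF character] by simp
  also have "int (n mod q) + int q * int (n div q) = int n"
    by (metis mod_mult_div_eq of_nat_add of_nat_mult)
  finally show ?thesis by (simp add: f_def)
qed

lemma f_eq_0_iff: "f n = 0 \<longleftrightarrow> \<not> coprime n q"
  using character unfolding dirichlet_character_def f_def by (metis coprime_int_iff)

lemma f_of_real: "f n = of_real (Re (f n))"
  using real [of "int n"] by (simp add: f_def of_real_Re)

lemma f_power: "f (n ^ k) = f n ^ k"
  by (induction k) (use f_1 mult in simp_all)

text \<open>A periodic function takes finitely many values, whereas a value of norm above 1 would
  have unbounded powers f(n^k).\<close>

lemma norm_f: "norm (f n) \<le> 1"
proof (rule ccontr)
  assume "\<not> norm (f n) \<le> 1"
  hence gt: "norm (f n) > 1" by simp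
  define B where "B = Max ((\<lambda>r. norm (f r)) ` {..<q})"
  have B: "norm (f m) \<le> B" for m
    unfolding B_def by (subst f_mod, rule Max_ge) (use q_pos in auto)
  obtain k where "B < norm (f n) ^ k" using real_arch_pow [OF gt] by blast
  thus False using B [of "n ^ k"] by (simp add: f_power norm_power)
qed

lemma norm_chi: "norm (chi n) \<le> 1"
proof -
  have "chi n = chi (n mod int q)"
    using dirichlet_character_shift [OF character, of "n mod int q" "n div int q"] by simp
  also have "\<dots> = f (nat (n mod int q))" using q_pos by (simp add: f_def)
  finally show ?thesis using norm_f by simp
qed

text \<open>Multiplication by a unit c with f(c) different from 1 permutes the residues, so the sum
  equals f(c) times itself. This is what makes L entire.\<close>

lemma sum_zero: "(\<Sum>r=1..q. f r) = 0"
proof -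
  obtain b where b: "coprime b (int q)" "chi b \<noteq> 1" using nonprincipal by blast
  define c where "c = nat (b mod int q)"
  have ic: "int c = b mod int q" using q_pos by (simp add: c_def)
  have "chi (int c) = chi (int c + int q * (b div int q))"
    using dirichlet_character_shift [OF character] by simp
  also have "int c + int q * (b div int q) = b" unfolding ic by (rule mod_mult_div_eq)
  finally have fc: "f c \<noteq> 1" using b(2) by (simp add: f_def)
  have "coprime (b mod int q) (int q)" using b(1) q_pos by simp
  hence cc: "coprime c q" unfolding ic [symmetric] by simp
  have inj: "inj_on (\<lambda>r. c * r mod q) {..<q}"
  proof (rule inj_onI)
    fix x y assume "x \<in> {..<q}" "y \<in> {..<q}" "c * x mod q = c * y mod q"
    thus "x = y" using cc by (metis cong_def cong_mult_lcancel_nat lessThan_iff mod_less)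
  qed
  hence bij: "bij_betw (\<lambda>r. c * r mod q) {..<q} {..<q}"
    unfolding bij_betw_def using inj q_pos by (intro conjI endo_inj_surj) auto
  have "f c * (\<Sum>r<q. f r) = (\<Sum>r<q. f (c * r mod q))"
    by (simp add: sum_distrib_left mult f_mod [symmetric])
  also have "\<dots> = (\<Sum>r<q. f r)" by (rule sum.reindex_bij_betw [OF bij])
  finally have "(\<Sum>r<q. f r) = 0" using fc by simp
  moreover have "(\<Sum>r=1..q. f r) = (\<Sum>r<q. f r)"
  proof -
    have "{1..q} = insert q {1..<q}" "{..<q} = insert 0 {1..<q}" using q_pos by auto
    thus ?thesis using periodic [of 0] by simp
  qed
  ultimately show ?thesis by simp
qed

lemma holomorphic_L: "L holomorphic_on UNIV"
  unfolding L_def by (rule holomorphic_periodic_L [OF q_pos sum_zero])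

lemma L_eq: "Re s > 1 \<Longrightarrow> L s = dirichlet_series f s"
  unfolding L_def dirichlet_series_def by (rule sums_unique [OF sums_periodic_L [of q f s, OF q_pos periodic]])

lemma Dirichlet_L_eq: "Dirichlet_L chi = L"
proof -
  have "Dirichlet_L chi = periodic_L q (\<lambda>n. chi (int n))"
  proof (rule Dirichlet_L_periodic [OF q_pos])
    show "chi (n + int q) = chi n" for n
      using character unfolding dirichlet_character_def by blast
    show "(\<Sum>r=1..q. chi (int r)) = 0" using sum_zero unfolding f_def .
  qed
  also have "(\<lambda>n. chi (int n)) = f" by (simp add: f_def fun_eq_iff)
  finally show ?thesis by (simp add: L_def)
qed

end

section \<open>The zeta function, and nonvanishing of L at and to the right of 1\<close>

abbreviation zeta :: "complex \<Rightarrow> complex" where "zeta \<equiv> dirichlet_series (\<lambda>_. 1)"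

definition zeta_entire :: "complex \<Rightarrow> complex" where "zeta_entire = periodic_entire 1 (\<lambda>_. 1)"

lemma holomorphic_zeta_entire: "zeta_entire holomorphic_on UNIV"
  unfolding zeta_entire_def by (rule holomorphic_periodic_entire) simp

lemma zeta_entire_eq:
  assumes "Re s > 1"
  shows "zeta_entire s = (s - 1) * zeta s"
proof -
  have "zeta s = zeta_entire s / (s - 1)"
    using sums_periodic_entire [of 1 "\<lambda>_. 1" s] assms
    unfolding zeta_entire_def dirichlet_series_def by (simp add: sums_iff)
  thus ?thesis using assms by auto
qed

lemma zeta_entire_at_1: "zeta_entire 1 = 1"
  unfolding zeta_entire_def by (simp add: periodic_entire_at_1)

lemma abs_conv_zeta: "abs_conv_dirichlet (\<lambda>_. 1)"
  by (rule abs_conv_dirichlet_bounded [where C = 1]) simp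

lemma dirichlet_series_ge_first:
  assumes a: "abs_conv_dirichlet a" and nn: "\<And>n. n > 0 \<Longrightarrow> Re (a n) \<ge> 0" and x: "x > 1"
  shows "Re (a 1) \<le> Re (dirichlet_series a (of_real x))"
proof -
  have "(\<lambda>n. a n * of_nat n powr (- of_real x)) sums dirichlet_series a (of_real x)"
    by (rule sums_dirichlet_series [OF a]) (use x in simp)
  hence *: "(\<lambda>n. Re (a n * of_nat n powr (- of_real x))) sums Re (dirichlet_series a (of_real x))"
    by (rule sums_Re)
  have term_eq: "Re (a n * of_nat n powr (- of_real x)) = Re (a n) * real n powr (- x)" for n
    using powr_of_real [of "real n" "- x"] by (simp add: cmod_def)
  have nn': "Re (a n * of_nat n powr (- of_real x)) \<ge> 0" for n
    unfolding term_eq using nn [of n] by (cases "n = 0") auto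
  have "sum (\<lambda>n. Re (a n * of_nat n powr (- of_real x))) {1} \<le> Re (dirichlet_series a (of_real x))"
    using * nn' by (subst sums_unique [OF *]) (intro sum_le_suminf sums_summable [OF *], auto)
  thus ?thesis by (simp add: term_eq)
qed

lemma zeta_ge_1: "x > 1 \<Longrightarrow> Re (zeta (of_real x)) \<ge> 1"
  using dirichlet_series_ge_first [OF abs_conv_zeta, of x] by simp

lemma divisors_coprime_mult:
  assumes "coprime a (b :: nat)"
  shows "bij_betw (\<lambda>(d, e). d * e) ({d. d dvd a} \<times> {e. e dvd b}) {d. d dvd a * b}"
  unfolding bij_betw_def
proof
  show "inj_on (\<lambda>(d, e). d * e) ({d. d dvd a} \<times> {e. e dvd b})"
  proof (rule inj_onI, clarify)
    fix d e d' e' assume d: "d dvd a" "d' dvd a" "e dvd b" "e' dvd b" "d * e = d' * e'"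
    have c: "coprime d e'" "coprime d' e" using assms d by (meson coprime_divisors)+
    have "d dvd d'" using c(1) d(5) by (metis coprime_dvd_mult_left_iff dvd_triv_left)
    moreover have "d' dvd d" using c(2) d(5) by (metis coprime_dvd_mult_left_iff dvd_triv_left)
    ultimately have dd: "d = d'" by (rule dvd_antisym)
    have c': "coprime e d'" "coprime e' d" using c by (simp_all add: coprime_commute)
    have "e dvd e'" using c'(1) d(5) by (metis coprime_dvd_mult_right_iff dvd_triv_right)
    moreover have "e' dvd e" using c'(2) d(5) by (metis coprime_dvd_mult_right_iff dvd_triv_right)
    ultimately show "d = d' \<and> e = e'" using dd dvd_antisym by blast
  qed
  show "(\<lambda>(d, e). d * e) ` ({d. d dvd a} \<times> {e. e dvd b}) = {d. d dvd a * b}"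
  proof (intro equalityI subsetI)
    fix x assume "x \<in> {d. d dvd a * b}"
    then obtain d e where "x = d * e" "d dvd a" "e dvd b" using division_decomp by blast
    thus "x \<in> (\<lambda>(d, e). d * e) ` ({d. d dvd a} \<times> {e. e dvd b})" by force
  qed (auto intro: mult_dvd_mono)
qed

lemma sum_powers_nonneg:
  assumes "\<bar>x\<bar> \<le> (1 :: real)"
  shows "(\<Sum>j\<le>k. x ^ j) \<ge> 0"
proof (cases "x = 1")
  case False
  have "(1 - x) * (\<Sum>j\<le>k. x ^ j) = 1 - x ^ Suc k"
    by (rule sum_gp_basic)
  moreover have "x ^ Suc k \<le> 1"
    using power_le_one [of "\<bar>x\<bar>" "Suc k"] assms by (metis abs_ge_zero abs_le_D1 power_abs)
  ultimately have "(1 - x) * (\<Sum>j\<le>k. x ^ j) \<ge> 0" by simp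
  moreover have "1 - x > 0" using assms False by auto
  ultimately show ?thesis by (simp add: zero_le_mult_iff)
qed simp

context real_nonprincipal
begin

lemma abs_Re_f: "\<bar>Re (f n)\<bar> \<le> 1"
  using abs_Re_le_cmod norm_f order_trans by blast

lemma divisor_sum_prime_power:
  assumes "prime p"
  shows "(\<Sum>d | d dvd p ^ k. Re (f d)) = (\<Sum>j\<le>k. Re (f p) ^ j)"
proof -
  have re: "Re (f (p ^ j)) = Re (f p) ^ j" for j
    unfolding f_power by (subst f_of_real) (simp flip: of_real_power)
  have "{d. d dvd p ^ k} = (\<lambda>j. p ^ j) ` {..k}"
    using assms by (auto simp: divides_primepow_nat)
  moreover have "inj_on (\<lambda>j. p ^ j) {..k}"
    using prime_gt_1_nat [OF assms] by (auto simp: inj_on_def)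
  ultimately show ?thesis by (simp add: sum.reindex re)
qed

text \<open>The divisor sum is multiplicative, and at a prime power it is a geometric sum with ratio
  in [-1, 1]. The induction splits off one full prime power.\<close>

lemma divisor_sum_nonneg: "n > 0 \<Longrightarrow> (\<Sum>d | d dvd n. Re (f d)) \<ge> 0"
proof (induction n rule: less_induct)
  case (less n)
  show ?case
  proof (cases "n = 1")
    case True
    thus ?thesis using f_1 by simp
  next
    case False
    then obtain p where p: "prime p" "p dvd n" using prime_factor_nat by blast
    define k where "k = multiplicity p n"
    have k: "k > 0" using p less.prems unfolding k_def by (simp add: prime_multiplicity_gt_zero_iff)
    obtain m where m: "n = p ^ k * m" "\<not> p dvd m"
      using multiplicity_decompose' [of n p] p(1) less.prems unfolding k_def
      by (metis not_prime_unit not_gr_zero)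
    have m0: "m > 0" using m less.prems by (cases "m = 0") auto
    have cop: "coprime (p ^ k) m" using p(1) m(2) by (simp add: prime_imp_coprime)
    have "1 < p ^ k" by (rule one_less_power [OF prime_gt_1_nat [OF p(1)] k])
    hence mn: "m < n" using m m0 by simp
    have mult_re: "Re (f (d * e)) = Re (f d) * Re (f e)" for d e
      unfolding mult by (subst (1 2) f_of_real) (simp flip: of_real_mult)
    have "(\<Sum>d | d dvd n. Re (f d)) = (\<Sum>(d, e)\<in>{d. d dvd p ^ k} \<times> {e. e dvd m}. Re (f d) * Re (f e))"
      unfolding m(1) by (subst sum.reindex_bij_betw [OF divisors_coprime_mult [OF cop], symmetric])
        (auto simp: mult_re intro!: sum.cong)
    also have "\<dots> = (\<Sum>d | d dvd p ^ k. Re (f d)) * (\<Sum>d | d dvd m. Re (f d))"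
      by (simp add: sum_product sum.cartesian_product)
    also have "\<dots> \<ge> 0"
      unfolding divisor_sum_prime_power [OF p(1)]
      by (intro mult_nonneg_nonneg sum_powers_nonneg abs_Re_f less.IH mn m0)
    finally show ?thesis .
  qed
qed

text \<open>The coefficients of zeta(s) L(s, chi).\<close>

definition r :: "nat \<Rightarrow> complex" where "r = dirichlet_conv f (\<lambda>_. 1)"

lemma Re_r: "Re (r n) = (\<Sum>d | d dvd n. Re (f d))"
  by (simp add: r_def dirichlet_conv_def)

lemma r_of_real: "r n = of_real (Re (r n))"
proof -
  have "r n = (\<Sum>d | d dvd n. f d)" by (simp add: r_def dirichlet_conv_def)
  also have "\<dots> = of_real (\<Sum>d | d dvd n. Re (f d))"
    unfolding of_real_sum by (intro sum.cong refl f_of_real)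
  finally show ?thesis by (simp add: Re_r)
qed

lemma abs_conv_f: "abs_conv_dirichlet f"
  by (rule abs_conv_dirichlet_bounded [OF norm_f])

lemma abs_conv_r: "abs_conv_dirichlet r"
  unfolding r_def by (rule dirichlet_conv(1) [OF abs_conv_f abs_conv_zeta])

lemma dirichlet_series_r: "Re s > 1 \<Longrightarrow> dirichlet_series r s = dirichlet_series f s * zeta s"
  unfolding r_def by (rule dirichlet_conv(2) [OF abs_conv_f abs_conv_zeta])

text \<open>The product zeta L has nonnegative coefficients and first coefficient 1. The bound is
  free of q, as needed when L on a circle is compared with L at its centre.\<close>

lemma L_lower_bound:
  assumes x: "x > 1"
  shows "norm (L (of_real x)) * norm (zeta (of_real x)) \<ge> 1" and "L (of_real x) \<noteq> 0"
proof -
  have "Re (r 1) \<le> Re (dirichlet_series r (of_real x))"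
    by (rule dirichlet_series_ge_first [OF abs_conv_r _ x]) (simp add: Re_r divisor_sum_nonneg)
  also have "\<dots> \<le> norm (dirichlet_series r (of_real x))" by (rule complex_Re_le_cmod)
  also have "dirichlet_series r (of_real x) = L (of_real x) * zeta (of_real x)"
    using x by (simp add: L_eq dirichlet_series_r)
  finally show *: "norm (L (of_real x)) * norm (zeta (of_real x)) \<ge> 1"
    using f_1 by (simp add: Re_r norm_mult)
  thus "L (of_real x) \<noteq> 0" by auto
qed

text \<open>If \<open>L(1) = 0\<close> then \<open>\<zeta> L\<close> is entire, so its Taylor series at \<open>2\<close> converges at \<open>0\<close>.
  The coefficients being nonnegative, the Dirichlet series of \<open>\<zeta> L\<close> would then converge at \<open>0\<close>,
  but infinitely many of its coefficients are \<open>1\<close>.\<close>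

lemma L_at_1: "L 1 \<noteq> 0"
proof
  assume L1: "L 1 = 0"
  define G where "G = (\<lambda>s. zeta_entire s * L s)"
  \<comment> \<open>This is zeta L itself: \<open>G\<close> is (s - 1) zeta L and vanishes at 1
    under the assumption, so the singularity at 1 is removable.\<close>
  define F where "F = (\<lambda>z. if z = 1 then deriv G 1 else G z / (z - 1) - G 1 / (z - 1))"
  have G: "G holomorphic_on UNIV"
    unfolding G_def by (intro holomorphic_intros holomorphic_zeta_entire holomorphic_L)
  have F: "F holomorphic_on UNIV"
    unfolding F_def by (rule pole_theorem [OF G]) auto
  have F_eq: "F s = dirichlet_series r s" if s: "Re s > 1" for s
  proof -
    have "s \<noteq> 1" using s by auto
    thus ?thesis using s L1 by (simp add: F_def G_def L_eq dirichlet_series_r zeta_entire_eq)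
  qed
  \<comment> \<open>The k-th Taylor term of \<open>F\<close> at 2, evaluated at 0. The sign of (0 -
    2)^k cancels that of (-ln n)^k, so every n contributes a nonnegative amount.\<close>
  define t where "t = (\<lambda>k. \<Sum>n. Re (r n) * real n powr (- 2) * ((2 * ln (real n)) ^ k / fact k))"
  have t_sums: "(\<lambda>n. Re (r n) * real n powr (- 2) * ((2 * ln (real n)) ^ k / fact k)) sums t k"
    and t_eq: "of_real (t k) = (deriv ^^ k) F 2 / fact k * (0 - 2) ^ k" for k
  proof -
    have "eventually (\<lambda>s. F s = dirichlet_series r s) (nhds 2)"
      by (rule eventually_mono [OF eventually_nhds_in_open [OF open_halfspace_Re_gt [of 1]]]) (auto simp: F_eq)
    hence "(deriv ^^ k) F 2 = (deriv ^^ k) (dirichlet_series r) 2"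
      by (rule higher_deriv_cong_ev) simp
    also have "\<dots> = dirichlet_series (\<lambda>n. r n * of_real (- ln (real n)) ^ k) 2"
      by (rule higher_deriv_dirichlet_series [OF abs_conv_r]) simp
    finally have d: "(deriv ^^ k) F 2 = dirichlet_series (\<lambda>n. r n * of_real (- ln (real n)) ^ k) 2" .
    have "(\<lambda>n. r n * of_real (- ln (real n)) ^ k * of_nat n powr (- 2)) sums (deriv ^^ k) F 2"
      unfolding d
      by (intro sums_dirichlet_series higher_deriv_dirichlet_series(2) [OF abs_conv_r, of 2]) auto
    hence "(\<lambda>n. r n * of_real (- ln (real n)) ^ k * of_nat n powr (- 2) * ((0 - 2) ^ k / fact k)) sums
         ((deriv ^^ k) F 2 * ((0 - 2) ^ k / fact k))"
      by (rule sums_mult2)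
    also have "(\<lambda>n. r n * of_real (- ln (real n)) ^ k * of_nat n powr (- 2) * ((0 - 2) ^ k / fact k))
       = (\<lambda>n. of_real (Re (r n) * real n powr (- 2) * ((2 * ln (real n)) ^ k / fact k)))"
    proof
      fix n
      have p: "complex_of_nat n powr (- 2) = of_real (real n powr (- 2))"
        using powr_of_real [of "real n" "- 2"] by simp
      have q: "of_real (- ln (real n)) ^ k * (0 - 2 :: complex) ^ k = of_real ((2 * ln (real n)) ^ k)"
        unfolding power_mult_distrib [symmetric] by (simp add: mult.commute)
      have "r n * of_real (- ln (real n)) ^ k * of_nat n powr (- 2) * ((0 - 2) ^ k / fact k)
         = of_real (Re (r n)) * of_real (real n powr (- 2)) * (of_real (- ln (real n)) ^ k * (0 - 2) ^ k) / fact k"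
        by (subst r_of_real, subst p) (simp add: mult_ac)
      thus "r n * of_real (- ln (real n)) ^ k * of_nat n powr (- 2) * ((0 - 2) ^ k / fact k)
       = of_real (Re (r n) * real n powr (- 2) * ((2 * ln (real n)) ^ k / fact k))"
        unfolding q by simp
    qed
    finally have *: "(\<lambda>n. complex_of_real (Re (r n) * real n powr (- 2) * ((2 * ln (real n)) ^ k / fact k))) sums
       ((deriv ^^ k) F 2 * ((0 - 2) ^ k / fact k))" .
    from summable_sums [OF sums_summable [OF sums_Re [OF this]]] show **: "(\<lambda>n. Re (r n) * real n powr (- 2) * ((2 * ln (real n)) ^ k / fact k)) sums t k"
      unfolding t_def Re_complex_of_real .
    from sums_unique2 [OF * sums_of_real [OF this]]
    show "of_real (t k) = (deriv ^^ k) F 2 / fact k * (0 - 2) ^ k" by simp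
  qed
  have "(\<lambda>k. (deriv ^^ k) F 2 / fact k * (0 - 2) ^ k) sums F 0"
    by (rule holomorphic_power_series [of F 2 3]) (use F in \<open>auto intro: holomorphic_on_subset\<close>)
  from sums_Re [OF this] have t: "t sums Re (F 0)"
    unfolding t_eq [symmetric] by simp
  \<comment> \<open>A prime dividing q is wanted, because f vanishes at it; modulus 1 admits no
    nonprincipal character.\<close>
  have "q \<noteq> 1"
  proof
    assume q1: "q = 1"
    obtain n where n: "chi n \<noteq> 1" using nonprincipal by blast
    have "chi 0 = 1" using dirichlet_character_shift [OF character, of 1 "- 1"] dirichlet_character_one [OF character] q1 by simp
    moreover have "chi n = chi 0" using dirichlet_character_shift [OF character, of 0 n] q1 by simp
    ultimately show False using n by simp
  qed
  then obtain p where p: "prime p" "p dvd q" using prime_factor_nat by blast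
  have fp: "f p = 0" using p by (metis coprime_absorb_left f_eq_0_iff not_prime_unit)
  have rp: "Re (r (p ^ j)) = 1" for j
    unfolding Re_r divisor_sum_prime_power [OF p(1)] fp
    by (simp add: power_0_left sum.delta)
  \<comment> \<open>Only J powers of p are kept, so the sums over n and k may be exchanged; each
    such n contributes n^-2 exp(2 ln n) = 1.\<close>
  have "real J \<le> Re (F 0)" for J
  proof -
    define N where "N = (\<lambda>j. p ^ j) ` {..<J}"
    have inj: "inj_on (\<lambda>j. p ^ j) {..<J}" using prime_gt_1_nat [OF p(1)] by (auto simp: inj_on_def)
    have N: "finite N" "card N = J" using inj by (auto simp: N_def card_image)
    have pos: "n > 0" if "n \<in> N" for n using that prime_gt_0_nat [OF p(1)] by (auto simp: N_def)
    have "(\<lambda>k. \<Sum>n\<in>N. Re (r n) * real n powr (- 2) * ((2 * ln (real n)) ^ k / fact k)) sums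
       (\<Sum>n\<in>N. Re (r n) * real n powr (- 2) * exp (2 * ln (real n)))"
    proof (intro sums_sum sums_mult)
      show "(\<lambda>k. y ^ k / fact k) sums exp y" for y :: real
        using exp_converges [of y] by (simp add: divide_inverse mult.commute)
    qed
    moreover have "(\<Sum>n\<in>N. Re (r n) * real n powr (- 2) * exp (2 * ln (real n))) = (\<Sum>n\<in>N. 1)"
    proof (rule sum.cong)
      fix n assume n: "n \<in> N"
      have "real n powr (- 2) * exp (2 * ln (real n)) = 1"
        using pos [OF n] by (simp add: powr_def flip: exp_add)
      moreover have "Re (r n) = 1" using n rp by (auto simp: N_def)
      ultimately show "Re (r n) * real n powr (- 2) * exp (2 * ln (real n)) = 1" by simp
    qed simp
    ultimately have S: "(\<lambda>k. \<Sum>n\<in>N. Re (r n) * real n powr (- 2) * ((2 * ln (real n)) ^ k / fact k)) sums real J"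
      using N by simp
    show "real J \<le> Re (F 0)"
    proof (rule sums_le [OF _ S t])
      fix k
      show "(\<Sum>n\<in>N. Re (r n) * real n powr (- 2) * ((2 * ln (real n)) ^ k / fact k)) \<le> t k"
        unfolding sums_unique [OF t_sums]
      proof (rule sum_le_suminf [OF sums_summable [OF t_sums] N(1)])
        fix n
        show "Re (r n) * real n powr (- 2) * ((2 * ln (real n)) ^ k / fact k) \<ge> 0"
          by (cases "n = 0") (auto simp: Re_r intro!: mult_nonneg_nonneg divide_nonneg_nonneg divisor_sum_nonneg)
      qed
    qed
  qed
  thus False by (metis linorder_not_less reals_Archimedean2)
qed

lemma L_nonzero: "x \<ge> 1 \<Longrightarrow> L (of_real x) \<noteq> 0"
  using L_at_1 L_lower_bound(2) [of x] by (cases "x = 1") auto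

text \<open>Serves the one fixed character that repels the others; \<open>e\<close> depends on it.
  Continuity suffices because L(1) is nonzero.\<close>

lemma L_zero_free_near_1: "\<exists>e>0. \<forall>x. x > 1 - e \<longrightarrow> L (of_real x) \<noteq> 0"
proof -
  have "isCont L 1"
    using holomorphic_on_imp_continuous_on [OF holomorphic_L] continuous_on_eq_continuous_at [OF open_UNIV]
    by blast
  then obtain e where e: "e > 0" "\<And>z. dist 1 z < e \<Longrightarrow> L z \<noteq> 0"
    using continuous_at_avoid [of 1 L 0, OF _ L_at_1] by blast
  have "L (of_real x) \<noteq> 0" if "x > 1 - e" for x
  proof (cases "x \<ge> 1")
    case False
    have "dist 1 (complex_of_real x) = \<bar>1 - x\<bar>"
      by (metis dist_norm norm_of_real of_real_1 of_real_diff)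
    thus ?thesis using that False by (intro e(2)) simp
  qed (rule L_nonzero)
  thus ?thesis using e(1) by blast
qed

end

subsection \<open>Transfer of zeros between characters\<close>

text \<open>For Re s > 1 both sides are the same series over n coprime to Q; being entire, they
  agree everywhere.\<close>

lemma euler_factors_L_transfer:
  assumes A: "real_nonprincipal q1 chi1" and B: "real_nonprincipal q2 chi2" and Q: "Q > 0"
    and eq: "\<And>n. coprime n (int Q) \<Longrightarrow> chi1 n = chi2 n"
  shows "euler_factors (prime_factors Q) (\<lambda>n. chi1 (int n)) s * Dirichlet_L chi1 s
       = euler_factors (prime_factors Q) (\<lambda>n. chi2 (int n)) s * Dirichlet_L chi2 s"
proof -
  interpret A: real_nonprincipal q1 chi1 by (rule A)
  interpret B: real_nonprincipal q2 chi2 by (rule B)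
  let ?E = "euler_factors (prime_factors Q)"
  have f: "(\<lambda>n. chi1 (int n)) = A.f" "(\<lambda>n. chi2 (int n)) = B.f"
    by (simp_all add: fun_eq_iff A.f_def B.f_def)
  have pos: "p > 0" if "p \<in> prime_factors Q" for p
    using that by (auto simp: in_prime_factors_iff prime_gt_0_nat)
  have "?E A.f s * A.L s = ?E B.f s * B.L s"
  proof (rule holomorphic_eq_half_plane [where c = "Re s - 1" and d = 1 and
        f = "\<lambda>s. ?E A.f s * A.L s" and g = "\<lambda>s. ?E B.f s * B.L s"])
    show "(\<lambda>s. ?E A.f s * A.L s) holomorphic_on {z. Re z > Re s - 1}"
      by (intro holomorphic_intros holomorphic_euler_factors pos holomorphic_on_subset [OF A.holomorphic_L]) auto
    show "(\<lambda>s. ?E B.f s * B.L s) holomorphic_on {z. Re z > Re s - 1}"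
      by (intro holomorphic_intros holomorphic_euler_factors pos holomorphic_on_subset [OF B.holomorphic_L]) auto
    show "?E A.f z * A.L z = ?E B.f z * B.L z" if z: "Re z > 1" for z
    proof -
      have "(\<lambda>n. if coprime n Q then A.f n else 0) = (\<lambda>n. if coprime n Q then B.f n else 0)"
        using eq by (auto simp: fun_eq_iff A.f_def B.f_def)
      thus ?thesis
        using dirichlet_series_coprime [OF A.norm_f A.mult z Q] dirichlet_series_coprime [OF B.norm_f B.mult z Q] z
        by (simp add: A.L_eq B.L_eq)
    qed
  qed auto
  thus ?thesis unfolding f A.Dirichlet_L_eq B.Dirichlet_L_eq .
qed

lemma Dirichlet_L_zero_transfer:
  assumes A: "real_nonprincipal q1 chi1" and B: "real_nonprincipal q2 chi2" and Q: "Q > 0"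
    and eq: "\<And>n. coprime n (int Q) \<Longrightarrow> chi1 n = chi2 n"
    and s: "Re s > 0" and zero: "Dirichlet_L chi1 s = 0"
  shows "Dirichlet_L chi2 s = 0"
proof -
  interpret B: real_nonprincipal q2 chi2 by (rule B)
  have "euler_factors (prime_factors Q) (\<lambda>n. chi2 (int n)) s \<noteq> 0"
    using B.norm_f s by (intro euler_factors_nonzero) (auto simp: B.f_def in_prime_factors_iff)
  thus ?thesis using euler_factors_L_transfer [OF A B Q eq, of s] zero by simp
qed

text \<open>A principal character to modulus q > 1 is induced from modulus 1, so its conductor is
  not q.\<close>

lemma real_primitive_nonprincipal:
  assumes "(q, chi) \<in> real_primitive_characters" "q > 1"
  shows "real_nonprincipal q chi"
proof
  show chi: "dirichlet_character q chi" "chi n \<in> \<real>" for n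
    using assms by (auto simp: real_primitive_characters_def primitive_character_def)
  show "\<exists>n. coprime n (int q) \<and> chi n \<noteq> 1"
  proof (rule ccontr)
    assume "\<not> (\<exists>n. coprime n (int q) \<and> chi n \<noteq> 1)"
    moreover have "dirichlet_character 1 (\<lambda>_. 1)" by (simp add: dirichlet_character_def)
    ultimately have "induced_from q chi 1"
      unfolding induced_from_def by (intro conjI exI [of _ "\<lambda>_. 1"]) auto
    hence "conductor q chi \<le> 1" unfolding conductor_def by (rule Least_le)
    thus False using assms by (simp add: real_primitive_characters_def primitive_character_def)
  qed
qed

lemma dirichlet_character_mult:
  assumes "dirichlet_character q1 chi1" "dirichlet_character q2 chi2"
  shows "dirichlet_character (q1 * q2) (\<lambda>n. chi1 n * chi2 n)"
  unfolding dirichlet_character_def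
proof (intro conjI allI)
  show "q1 * q2 > 0" using assms by (simp add: dirichlet_character_def)
  show "chi1 (m * n) * chi2 (m * n) = chi1 m * chi2 m * (chi1 n * chi2 n)" for m n
    using assms by (simp add: dirichlet_character_def)
  show "chi1 (n + int (q1 * q2)) * chi2 (n + int (q1 * q2)) = chi1 n * chi2 n" for n
    using dirichlet_character_shift [OF assms(1), of n "int q2"]
      dirichlet_character_shift [OF assms(2), of n "int q1"] by (simp add: mult.commute)
  show "(chi1 n * chi2 n \<noteq> 0) = coprime n (int (q1 * q2))" for n
    using assms by (simp add: dirichlet_character_def)
qed

text \<open>Carries the hypothesis from primitive to arbitrary real nonprincipal characters;
  \<open>\<delta> \<le> 1\<close> puts the disk into Re z > 0, where zeros transfer.\<close>

lemma zeros_real_nonprincipal: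
  assumes H: "\<forall>(q, chi) \<in> real_primitive_characters.
           \<forall>z::complex. cmod (z - 1) < \<delta> \<and> Dirichlet_L chi z = 0 \<longrightarrow> z \<in> \<real>"
    and A: "real_nonprincipal q chi" and \<delta>: "\<delta> \<le> 1"
    and z: "cmod (z - 1) < \<delta>" "Dirichlet_L chi z = 0"
  shows "z \<in> \<real>"
proof -
  interpret A: real_nonprincipal q chi by (rule A)
  obtain d \<psi> where d: "(d, \<psi>) \<in> real_primitive_characters" "d dvd q" "d > 0"
      "\<And>n. coprime n (int q) \<Longrightarrow> chi n = \<psi> n"
    using primitive_inducing_character [OF A.character A.real] by blast
  have B: "real_nonprincipal d \<psi>"
  proof
    show "dirichlet_character d \<psi>" "\<psi> n \<in> \<real>" for n
      using d by (auto simp: real_primitive_characters_def primitive_character_def)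
    obtain n where n: "coprime n (int q)" "chi n \<noteq> 1" using A.nonprincipal by blast
    moreover have "coprime n (int d)" using n d(2) by (meson coprime_divisors dvd_refl of_nat_dvd_iff)
    ultimately show "\<exists>n. coprime n (int d) \<and> \<psi> n \<noteq> 1" using d(4) by metis
  qed
  have "\<bar>Re (z - 1)\<bar> < 1" using abs_Re_le_cmod [of "z - 1"] z \<delta> by linarith
  hence "Re z > 0" by simp
  hence "Dirichlet_L \<psi> z = 0"
    using Dirichlet_L_zero_transfer [OF A B A.q_pos d(4)] z by blast
  thus ?thesis using H d(1) z by blast
qed

lemma trivial_character_primitive: "(1, \<lambda>_. 1) \<in> real_primitive_characters"
proof -
  have chi: "dirichlet_character 1 (\<lambda>_. 1)" by (simp add: dirichlet_character_def)
  have "conductor 1 (\<lambda>_. 1) = 1"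
    unfolding conductor_def
    by (rule Least_equality) (use chi in \<open>auto simp: induced_from_def\<close>)
  thus ?thesis using chi by (simp add: real_primitive_characters_def primitive_character_def)
qed

lemma zeta_entire_zeros_real:
  assumes H: "\<forall>(q, chi) \<in> real_primitive_characters.
           \<forall>z::complex. cmod (z - 1) < \<delta> \<and> Dirichlet_L chi z = 0 \<longrightarrow> z \<in> \<real>"
    and z: "cmod (z - 1) < \<delta>" "zeta_entire z = 0"
  shows "z \<in> \<real>"
proof -
  have "Dirichlet_L (\<lambda>_. 1) z = zeta_entire z / (z - 1)"
    using Dirichlet_L_trivial [of "\<lambda>_. 1"] by (simp add: zeta_entire_def)
  thus ?thesis using H trivial_character_primitive z by fastforce
qed

lemma zeta_entire_nonzero:
  assumes "x \<ge> 1"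
  shows "zeta_entire (of_real x) \<noteq> 0"
proof (cases "x = 1")
  case False
  hence "x > 1" using assms by simp
  thus ?thesis using zeta_ge_1 [of x] by (auto simp: zeta_entire_eq)
qed (simp add: zeta_entire_at_1)

subsection \<open>Repulsion of real zeros\<close>

context real_nonprincipal
begin

lemma logderiv_L_coeff:
  assumes x: "x > 1"
  shows "Re ((- 1) ^ m / fact m * (deriv ^^ m) (\<lambda>z. deriv L z / L z) (of_real x)) = - mangoldt_sum_coeff f m x"
proof -
  have ev: "eventually (\<lambda>z. L z = dirichlet_series f z) (nhds z)" if "Re z > 1" for z
    by (rule eventually_mono [OF eventually_nhds_in_open [OF open_halfspace_Re_gt [of 1]]])
       (use that L_eq in auto)
  have nz: "dirichlet_series f (of_real x) \<noteq> 0"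
    using L_lower_bound(2) [OF x] x by (simp add: L_eq)
  have "eventually (\<lambda>z. z \<in> {z. Re z > 1}) (nhds (complex_of_real x))"
    using x by (intro eventually_nhds_in_open open_halfspace_Re_gt) auto
  hence "eventually (\<lambda>z. deriv L z / L z = deriv (dirichlet_series f) z / dirichlet_series f z) (nhds (of_real x))"
  proof eventually_elim
    case (elim z)
    thus ?case using ev [of z] L_eq [of z] deriv_cong_ev [OF ev [of z] refl] by simp
  qed
  hence "(deriv ^^ m) (\<lambda>z. deriv L z / L z) (of_real x)
     = (deriv ^^ m) (\<lambda>z. deriv (dirichlet_series f) z / dirichlet_series f z) (of_real x)"
    by (rule higher_deriv_cong_ev) simp
  also have "\<dots> = - dirichlet_series (\<lambda>n. f n * mangoldt n * of_real (- ln (real n)) ^ m) (of_real x)"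
    by (rule higher_deriv_logderiv_dirichlet [OF norm_f mult _ nz]) (use x in simp)
  finally show ?thesis using mangoldt_sum_coeff(2) [OF norm_f mult x, of m] by simp
qed

text \<open>On the circle |z - 1| lies between \<delta>/2 and 1/2, so
  \<open>periodic_entire_bound\<close> applies and the division by z - 1 is harmless. The factor
  |L(x)| enters by multiplying with |L(x)| |zeta(x)| \<ge> 1.\<close>

lemma L_sphere_bound:
  assumes C: "\<And>q f s. q > 0 \<Longrightarrow> \<forall>n. norm (f n) \<le> 1 \<Longrightarrow> norm (s - 1) \<le> 1 / 2 \<Longrightarrow>
      norm (periodic_entire q f s) \<le> C * real q ^ 4" and C0: "C > 0"
    and \<delta>: "0 < \<delta>" "\<delta> < 1 / 10" and x: "1 < x" "x - 1 \<le> \<delta> / 4"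
    and z: "norm (z - of_real x) = \<delta>"
  shows "norm (L z) \<le> 2 * C / \<delta> * norm (zeta (of_real x)) * real q ^ 4 * norm (L (of_real x))"
proof -
  have x1: "norm (complex_of_real x - 1) = x - 1"
    using x by (metis abs_of_pos diff_gt_0_iff_gt norm_of_real of_real_1 of_real_diff)
  have "norm (z - 1) \<le> norm (z - of_real x) + norm (complex_of_real x - 1)"
    using norm_triangle_ineq [of "z - of_real x" "of_real x - 1"] by simp
  hence up: "norm (z - 1) \<le> 1 / 2" using z x1 x \<delta> by simp
  have "norm (z - of_real x) \<le> norm (z - 1) + norm (complex_of_real x - 1)"
    using norm_triangle_ineq4 [of "z - 1" "of_real x - 1"] by simp
  hence lo: "norm (z - 1) \<ge> \<delta> / 2" using z x1 x \<delta> by simp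
  hence "z \<noteq> 1" using \<delta> by auto
  hence "norm (L z) = norm (periodic_entire q f z) / norm (z - 1)"
    by (simp add: L_def periodic_L_def norm_divide)
  also have "\<dots> \<le> (C * real q ^ 4) / (\<delta> / 2)"
    using lo up \<delta> C0 norm_f q_pos by (intro frac_le C) auto
  also have "\<dots> = 2 * C / \<delta> * real q ^ 4 * 1" by simp
  also have "\<dots> \<le> 2 * C / \<delta> * real q ^ 4 * (norm (L (of_real x)) * norm (zeta (of_real x)))"
    using L_lower_bound(1) [OF x(1)] C0 \<delta> by (intro mult_left_mono) auto
  finally show ?thesis by (simp add: mult_ac)
qed

end

text \<open>The first term on the right is the pole of zeta, seen through the factor s - 1.\<close>

lemma logderiv_zeta_entire_coeff:
  assumes x: "x > 1"
  shows "Re ((- 1) ^ m / fact m * (deriv ^^ m) (\<lambda>z. deriv zeta_entire z / zeta_entire z) (of_real x))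
    = 1 / (x - 1) ^ Suc m - mangoldt_sum_coeff (\<lambda>_. 1) m x"
proof -
  have nz: "zeta (of_real x) \<noteq> 0" using zeta_ge_1 [OF x] by auto
  have "(deriv ^^ m) (\<lambda>z. deriv zeta_entire z / zeta_entire z) (of_real x)
     = (deriv ^^ m) (\<lambda>z. deriv zeta z / zeta z) (of_real x)
       + (\<Sum>\<rho>\<leftarrow>[1]. (- 1) ^ m * fact m / (of_real x - \<rho>) ^ Suc m)"
    by (rule higher_deriv_logderiv_split [of "{s. Re s > 1}"])
       (use x nz in \<open>auto simp: open_halfspace_Re_gt zeta_entire_eq mult.commute
          intro: holomorphic_dirichlet_series abs_conv_zeta\<close>)
  also have "(deriv ^^ m) (\<lambda>z. deriv zeta z / zeta z) (of_real x)
     = - dirichlet_series (\<lambda>n. 1 * mangoldt n * of_real (- ln (real n)) ^ m) (of_real x)"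
    by (rule higher_deriv_logderiv_dirichlet) (use x nz in auto)
  finally have X: "(deriv ^^ m) (\<lambda>z. deriv zeta_entire z / zeta_entire z) (of_real x)
     = - dirichlet_series (\<lambda>n. 1 * mangoldt n * of_real (- ln (real n)) ^ m) (of_real x)
       + (- 1) ^ m * fact m / (of_real x - 1) ^ Suc m" by (simp del: power_Suc)
  have alg: "s / F * (- D + s * F / Y) = 1 / Y - s / F * D" if "s * s = 1" "F \<noteq> 0" for s F D Y :: complex
  proof -
    have "s / F * (- D + s * F / Y) = (s * s) * (F / F) / Y - s / F * D"
      by (cases "Y = 0") (use that(2) in \<open>simp_all add: field_simps\<close>)
    thus ?thesis using that by simp
  qed
  have "(- 1) ^ m / fact m * (deriv ^^ m) (\<lambda>z. deriv zeta_entire z / zeta_entire z) (of_real x)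
     = 1 / (of_real x - 1) ^ Suc m
       - (- 1) ^ m / fact m * dirichlet_series (\<lambda>n. 1 * mangoldt n * of_real (- ln (real n)) ^ m) (of_real x)"
    unfolding X by (rule alg) (simp_all flip: power_mult_distrib)
  moreover have "1 / (complex_of_real x - 1) ^ Suc m = of_real (1 / (x - 1) ^ Suc m)" by simp
  ultimately show ?thesis
    using mangoldt_sum_coeff(2) [of "\<lambda>_. 1" x m] x
    by (simp only: minus_complex.sel Re_complex_of_real) simp
qed

lemma mangoldt_sum_coeff_nonneg:
  assumes A: "real_nonprincipal q1 chi1" and B: "real_nonprincipal q2 chi2"
    and P: "real_nonprincipal q3 (\<lambda>n. chi1 n * chi2 n)" and x: "x > 1"
  shows "mangoldt_sum_coeff (\<lambda>_. 1) m x + mangoldt_sum_coeff (\<lambda>n. chi1 (int n)) m x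
     + mangoldt_sum_coeff (\<lambda>n. chi2 (int n)) m x + mangoldt_sum_coeff (\<lambda>n. chi1 (int n) * chi2 (int n)) m x \<ge> 0"
proof -
  interpret A: real_nonprincipal q1 chi1 by (rule A)
  interpret B: real_nonprincipal q2 chi2 by (rule B)
  interpret P: real_nonprincipal q3 "\<lambda>n. chi1 n * chi2 n" by (rule P)
  define w where "w = (\<lambda>n. mangoldt n * ln (real n) ^ m * real n powr (- x) / fact m)"
  have w: "w n \<ge> 0" for n
    unfolding w_def by (cases "n = 0") (auto intro!: mult_nonneg_nonneg divide_nonneg_nonneg mangoldt_nonneg)
  have f: "A.f n = chi1 (int n)" "B.f n = chi2 (int n)" "P.f n = chi1 (int n) * chi2 (int n)" for n
    by (simp_all add: A.f_def B.f_def P.f_def)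
  have "(\<lambda>n. Re 1 * w n + Re (chi1 (int n)) * w n + Re (chi2 (int n)) * w n + Re (chi1 (int n) * chi2 (int n)) * w n) sums
     (mangoldt_sum_coeff (\<lambda>_. 1) m x + mangoldt_sum_coeff (\<lambda>n. chi1 (int n)) m x
     + mangoldt_sum_coeff (\<lambda>n. chi2 (int n)) m x + mangoldt_sum_coeff (\<lambda>n. chi1 (int n) * chi2 (int n)) m x)"
    unfolding w_def
    by (intro sums_add mangoldt_sum_coeff(1) x)
       (use A.norm_f B.norm_f P.norm_f A.mult B.mult P.mult in \<open>simp_all add: f\<close>)
  moreover have "Re 1 * w n + Re (chi1 (int n)) * w n + Re (chi2 (int n)) * w n + Re (chi1 (int n) * chi2 (int n)) * w n \<ge> 0" for n
  proof -
    have "Re (chi1 (int n) * chi2 (int n)) = Re (chi1 (int n)) * Re (chi2 (int n))"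
      using A.f_of_real [of n] B.f_of_real [of n] unfolding f by (metis Re_complex_of_real of_real_mult)
    hence "Re 1 * w n + Re (chi1 (int n)) * w n + Re (chi2 (int n)) * w n + Re (chi1 (int n) * chi2 (int n)) * w n
       = (1 + Re (chi1 (int n))) * (1 + Re (chi2 (int n))) * w n" by (simp add: algebra_simps)
    also have "\<dots> \<ge> 0"
      using A.abs_Re_f [of n] B.abs_Re_f [of n] w [of n] unfolding f by (intro mult_nonneg_nonneg) auto
    finally show ?thesis .
  qed
  ultimately show ?thesis by (rule sums_le [OF _ sums_zero, rotated])
qed

text \<open>\<open>logderiv_coeff_lower_bound\<close> is applied to (s - 1) zeta and to three
  L-functions separately, and the results are added: the 8 is 4 functions times the 2 from
  Borel--Caratheodory. \<open>K\<close> depends on \<delta> and x, not on the characters.\<close>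

lemma real_zeros_inequality:
  fixes \<delta> :: real
  assumes H: "\<forall>(q, chi) \<in> real_primitive_characters.
           \<forall>z::complex. cmod (z - 1) < \<delta> \<and> Dirichlet_L chi z = 0 \<longrightarrow> z \<in> \<real>"
    and \<delta>: "0 < \<delta>" "\<delta> < 1 / 10" and x: "1 < x" "x - 1 \<le> \<delta> / 4"
  shows "\<exists>K\<ge>1. \<forall>q1 chi1 q2 chi2 \<beta>1 \<beta>2 m. real_nonprincipal q1 chi1 \<and> real_nonprincipal q2 chi2
      \<and> real_nonprincipal (q1 * q2) (\<lambda>n. chi1 n * chi2 n)
      \<and> Dirichlet_L chi1 (of_real \<beta>1) = 0 \<and> Dirichlet_L chi2 (of_real \<beta>2) = 0
      \<and> \<bar>\<beta>1 - x\<bar> \<le> \<delta> / 2 \<and> \<bar>\<beta>2 - x\<bar> \<le> \<delta> / 2 \<longrightarrow>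
      1 / (x - \<beta>1) ^ Suc m + 1 / (x - \<beta>2) ^ Suc m \<le> 1 / (x - 1) ^ Suc m
        + 8 * real (Suc m) * (ln (K * real (q1 * q2) ^ 4) + 1) * (4 / \<delta>) ^ Suc m"
proof -
  obtain C where C0: "C > 0" and C: "\<And>q f s. q > 0 \<Longrightarrow> \<forall>n. norm (f n) \<le> 1 \<Longrightarrow> norm (s - 1) \<le> 1 / 2 \<Longrightarrow>
      norm (periodic_entire q f s) \<le> C * real q ^ 4"
    using periodic_entire_bound by metis
  define Z where "Z = norm (zeta (of_real x))"
  have Z: "Z \<ge> 1" unfolding Z_def using zeta_ge_1 [OF x(1)] complex_Re_le_cmod order_trans by blast
  \<comment> \<open>The 1 keeps the logarithm nonnegative, C / (x - 1) serves (s - 1) zeta, and the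
    last summand serves the L-functions.\<close>
  define K where "K = 1 + C / (x - 1) + 2 * C / \<delta> * Z"
  have K: "K \<ge> 1" "C / (x - 1) \<le> K" "2 * C / \<delta> * Z \<le> K"
    using C0 Z \<delta> x by (auto simp: K_def intro!: add_nonneg_nonneg add_increasing mult_nonneg_nonneg divide_nonneg_nonneg)
  have near: "norm (z - 1) < \<delta>" if "norm (z - of_real x) \<le> \<delta> / 2" for z :: complex
  proof -
    have "norm (complex_of_real x - 1) = x - 1"
      using x by (metis abs_of_pos diff_gt_0_iff_gt norm_of_real of_real_1 of_real_diff)
    thus ?thesis using norm_triangle_ineq [of "z - of_real x" "of_real x - 1"] that x \<delta> by simp
  qed
  show ?thesis
  proof (intro exI [of _ K] conjI allI impI K(1), elim conjE)
    fix q1 chi1 q2 chi2 m and \<beta>1 \<beta>2 :: real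
    assume A: "real_nonprincipal q1 chi1" and B: "real_nonprincipal q2 chi2"
      and P: "real_nonprincipal (q1 * q2) (\<lambda>n. chi1 n * chi2 n)"
      and \<beta>: "Dirichlet_L chi1 (of_real \<beta>1) = 0" "Dirichlet_L chi2 (of_real \<beta>2) = 0"
        "\<bar>\<beta>1 - x\<bar> \<le> \<delta> / 2" "\<bar>\<beta>2 - x\<bar> \<le> \<delta> / 2"
    interpret A: real_nonprincipal q1 chi1 by (rule A)
    interpret B: real_nonprincipal q2 chi2 by (rule B)
    interpret P: real_nonprincipal "q1 * q2" "\<lambda>n. chi1 n * chi2 n" by (rule P)
    define M where "M = ln (K * real (q1 * q2) ^ 4)"
    have Q1: "real (q1 * q2) ^ 4 \<ge> 1" using P.q_pos by (intro one_le_power) linarith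
    have "K * real (q1 * q2) ^ 4 \<ge> 1 * 1" using K(1) Q1 by (intro mult_mono) auto
    hence M: "M \<ge> 0" "exp M = K * real (q1 * q2) ^ 4" unfolding M_def by auto
    define err where "err = real (Suc m) * (2 * (M + 1)) * (4 / \<delta>) ^ Suc m"
    \<comment> \<open>Used for chi1, chi2 and their product with \<open>S\<close> equal to
      {\<open>\<beta>1\<close>}, {\<open>\<beta>2\<close>} and the empty set. All three moduli
      divide q1 q2, so one \<open>M\<close> serves.\<close>
    have L_case: "- mangoldt_sum_coeff (real_nonprincipal.f chi) m x \<ge> (\<Sum>\<beta>\<in>S. 1 / (x - \<beta>) ^ Suc m) - err"
      if X: "real_nonprincipal q chi" and q: "q dvd q1 * q2"
        and S: "S = {} \<or> (\<exists>\<beta>. S = {\<beta>} \<and> Dirichlet_L chi (of_real \<beta>) = 0 \<and> \<bar>\<beta> - x\<bar> \<le> \<delta> / 2)" for q chi S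
    proof -
      interpret X: real_nonprincipal q chi by (rule X)
      have qle: "real q ^ 4 \<le> real (q1 * q2) ^ 4"
        using q P.q_pos by (intro power_mono) (auto simp flip: of_nat_mult intro: dvd_imp_le)
      have "Re ((- 1) ^ m / fact m * (deriv ^^ m) (\<lambda>z. deriv X.L z / X.L z) (of_real x))
         \<ge> (\<Sum>\<beta>\<in>S. 1 / (x - \<beta>) ^ Suc m) - err"
      proof -
        have bound: "norm (X.L z) \<le> exp M * norm (X.L (of_real x))" if z: "norm (z - of_real x) = \<delta>" for z
        proof -
          have "norm (X.L z) \<le> (2 * C / \<delta> * Z) * real q ^ 4 * norm (X.L (of_real x))"
            using X.L_sphere_bound [OF C C0 \<delta> x z] by (simp add: Z_def)
          also have "\<dots> \<le> K * real (q1 * q2) ^ 4 * norm (X.L (of_real x))"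
            using K qle by (intro mult_right_mono mult_mono) auto
          finally show ?thesis by (simp add: M)
        qed
        have zr: "z \<in> \<real> \<and> Re z < x" if z: "norm (z - of_real x) \<le> \<delta> / 2" "X.L z = 0" for z
        proof -
          have re: "z \<in> \<real>"
            using zeros_real_nonprincipal [OF H X _ near [OF z(1)]] z(2) \<delta> by (simp add: X.Dirichlet_L_eq)
          hence "z = of_real (Re z)" by (simp add: of_real_Re)
          hence "\<not> Re z \<ge> 1" using X.L_nonzero [of "Re z"] z(2) by auto
          thus ?thesis using re x by simp
        qed
        show ?thesis
        proof (cases "S = {}")
          case True
          thus ?thesis unfolding err_def
            by (intro logderiv_coeff_lower_bound [OF X.holomorphic_L \<delta>(1) M(1) X.L_lower_bound(2) [OF x(1)] bound zr]) auto
        next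
          case False
          then obtain \<beta> where "S = {\<beta>}" "X.L (of_real \<beta>) = 0" "\<bar>\<beta> - x\<bar> \<le> \<delta> / 2"
            using S by (auto simp: X.Dirichlet_L_eq)
          thus ?thesis unfolding err_def
            by (intro logderiv_coeff_lower_bound [OF X.holomorphic_L \<delta>(1) M(1) X.L_lower_bound(2) [OF x(1)] bound zr, where \<beta> = \<beta>]) auto
        qed
      qed
      thus ?thesis unfolding X.logderiv_L_coeff [OF x(1)] .
    qed
    have "Re ((- 1) ^ m / fact m * (deriv ^^ m) (\<lambda>z. deriv zeta_entire z / zeta_entire z) (of_real x))
         \<ge> (\<Sum>\<beta>\<in>{}. 1 / (x - \<beta>) ^ Suc m) - err"
      unfolding err_def
    proof (rule logderiv_coeff_lower_bound [OF holomorphic_zeta_entire \<delta>(1) M(1)])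
      show "zeta_entire (of_real x) \<noteq> 0" using x by (intro zeta_entire_nonzero) simp
      show "z \<in> \<real> \<and> Re z < x" if z: "norm (z - of_real x) \<le> \<delta> / 2" "zeta_entire z = 0" for z
      proof -
        have re: "z \<in> \<real>" by (rule zeta_entire_zeros_real [OF H near [OF z(1)] z(2)])
        hence "z = of_real (Re z)" by (simp add: of_real_Re)
        hence "\<not> Re z \<ge> 1" using zeta_entire_nonzero [of "Re z"] z(2) by auto
        thus ?thesis using re x by simp
      qed
      show "norm (zeta_entire z) \<le> exp M * norm (zeta_entire (of_real x))" if z: "norm (z - of_real x) = \<delta>" for z
      proof -
        have x1: "norm (complex_of_real x - 1) = x - 1"
          using x by (metis abs_of_pos diff_gt_0_iff_gt norm_of_real of_real_1 of_real_diff)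
        have "norm (z - 1) \<le> 1 / 2"
          using norm_triangle_ineq [of "z - of_real x" "of_real x - 1"] z x1 x \<delta> by simp
        hence "norm (zeta_entire z) \<le> C"
          using C [of 1 "\<lambda>_. 1" z] by (simp add: zeta_entire_def)
        also have "C = C / (x - 1) * (x - 1)" using x by simp
        also have "\<dots> \<le> K * (x - 1)" using K(2) x by (intro mult_right_mono) auto
        also have "\<dots> \<le> (K * real (q1 * q2) ^ 4) * ((x - 1) * Z)"
          using K(1) Q1 Z x by (intro mult_mono) (auto intro: mult_nonneg_nonneg)
        also have "(x - 1) * Z = norm (zeta_entire (of_real x))"
          using x x1 by (simp add: zeta_entire_eq norm_mult Z_def)
        finally show ?thesis by (simp add: M)
      qed
    qed auto
    hence z0: "1 / (x - 1) ^ Suc m - mangoldt_sum_coeff (\<lambda>_. 1) m x \<ge> - err"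
      unfolding logderiv_zeta_entire_coeff [OF x(1)] by simp
    have z1: "- mangoldt_sum_coeff A.f m x \<ge> 1 / (x - \<beta>1) ^ Suc m - err"
      using L_case [OF A, of "{\<beta>1}"] \<beta> by simp
    have z2: "- mangoldt_sum_coeff B.f m x \<ge> 1 / (x - \<beta>2) ^ Suc m - err"
      using L_case [OF B, of "{\<beta>2}"] \<beta> by simp
    have z3: "- mangoldt_sum_coeff P.f m x \<ge> - err"
      using L_case [OF P, of "{}"] by simp
    have f: "A.f = (\<lambda>n. chi1 (int n))" "B.f = (\<lambda>n. chi2 (int n))" "P.f = (\<lambda>n. chi1 (int n) * chi2 (int n))"
      by (simp_all add: fun_eq_iff A.f_def B.f_def P.f_def)
    have "1 / (x - \<beta>1) ^ Suc m + 1 / (x - \<beta>2) ^ Suc m \<le> 1 / (x - 1) ^ Suc m + 4 * err"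
      using mangoldt_sum_coeff_nonneg [OF A B P x(1), of m] z0 z1 z2 z3 unfolding f by linarith
    moreover have "4 * (a * (2 * b) * c) = 8 * a * b * c" for a b c :: real by simp
    ultimately show "1 / (x - \<beta>1) ^ Suc m + 1 / (x - \<beta>2) ^ Suc m \<le> 1 / (x - 1) ^ Suc m
        + 8 * real (Suc m) * (ln (K * real (q1 * q2) ^ 4) + 1) * (4 / \<delta>) ^ Suc m"
      unfolding err_def M_def by metis
  qed
qed

section \<open>The order of differentiation and the resulting repulsion\<close>

text \<open>\<open>Suc k\<close> is the ceiling of the y with 4^(N y) = T; rounding up costs at most
  a factor 4.\<close>

lemma exponent_choice:
  fixes T :: real
  assumes T: "T > 1" and N: "N > (0 :: nat)"
  shows "\<exists>k. T \<le> 4 ^ (N * Suc k) \<and> 4 ^ Suc k \<le> 4 * T powr (1 / real N)"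
proof -
  define y where "y = ln T / (real N * ln 4)"
  have y: "y > 0" using T N by (simp add: y_def)
  define k where "k = nat \<lceil>y\<rceil> - 1"
  have k: "real (Suc k) = of_int \<lceil>y\<rceil>" using y by (simp add: k_def)
  have "ln T = y * (real N * ln 4)" using N by (simp add: y_def)
  also have "\<dots> \<le> real (Suc k) * (real N * ln 4)"
    unfolding k by (intro mult_right_mono) auto
  also have "\<dots> = ln (4 ^ (N * Suc k))" by (simp add: ln_realpow algebra_simps)
  finally have 1: "T \<le> 4 ^ (N * Suc k)" using T by (subst (asm) ln_le_cancel_iff) auto
  have "real (Suc k) \<le> y + 1" unfolding k by linarith
  hence "(4 :: real) powr real (Suc k) \<le> 4 powr (y + 1)" by (intro powr_mono) auto
  hence "(4 :: real) ^ Suc k \<le> 4 powr (y + 1)" by (subst (asm) powr_realpow) auto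
  also have "4 powr (y + 1) = 4 * 4 powr y" by (simp add: powr_add)
  also have "4 powr y = T powr (1 / real N)"
    using T N by (simp add: powr_def y_def)
  finally show ?thesis using 1 by blast
qed

text \<open>Choosing the order \<open>k = Suc m\<close> of the derivative so that \<open>4 ^ (N * k)\<close> is about the size of \<open>M\<close>
  makes the error term negligible; Bernoulli's inequality then bounds \<open>\<mu>\<close> from below.\<close>

lemma repulsion_arithmetic:
  fixes \<eta> \<mu> M \<delta> :: real
  assumes \<eta>: "\<eta> > 0" and \<delta>: "\<delta> > 0" "4 * \<eta> / \<delta> \<le> 1 / 4 ^ (N + 1)" and N: "N > 0" and M: "M \<ge> 0" and \<mu>: "\<mu> \<ge> 0"
    and ineq: "\<And>m. 1 / (2 * \<eta>) ^ Suc m + 1 / (\<eta> + \<mu>) ^ Suc m \<le> 1 / \<eta> ^ Suc m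
        + 8 * real (Suc m) * (M + 1) * (4 / \<delta>) ^ Suc m"
  shows "\<mu> \<ge> \<eta> / 8 * (16 * (M + 1)) powr (- 1 / real N)"
proof -
  \<comment> \<open>The factor 16 is what brings the error down to half of the gain 1 / 2^k.\<close>
  define T where "T = 16 * (M + 1)"
  have T: "T > 1" using M by (simp add: T_def)
  obtain m where m: "T \<le> 4 ^ (N * Suc m)" "4 ^ Suc m \<le> 4 * T powr (1 / real N)"
    using exponent_choice [OF T N] by blast
  define k where "k = Suc m"
  define y where "y = \<mu> / \<eta>"
  have y: "y \<ge> 0" using \<eta> \<mu> by (simp add: y_def)
  have "\<eta> ^ k * (1 / (2 * \<eta>) ^ k + 1 / (\<eta> + \<mu>) ^ k) \<le> \<eta> ^ k * (1 / \<eta> ^ k + 8 * real k * (M + 1) * (4 / \<delta>) ^ k)"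
    using ineq [of m] \<eta> unfolding k_def by (intro mult_left_mono) auto
  also have "\<eta> ^ k * (1 / (2 * \<eta>) ^ k + 1 / (\<eta> + \<mu>) ^ k) = 1 / 2 ^ k + (\<eta> / (\<eta> + \<mu>)) ^ k"
    using \<eta> by (simp add: power_mult_distrib power_divide distrib_left)
  also have "\<eta> ^ k * (1 / \<eta> ^ k + 8 * real k * (M + 1) * (4 / \<delta>) ^ k) = 1 + 8 * real k * (M + 1) * (4 * \<eta> / \<delta>) ^ k"
    using \<eta> by (simp add: power_mult_distrib power_divide distrib_left)
  finally have main: "1 / 2 ^ k + (\<eta> / (\<eta> + \<mu>)) ^ k \<le> 1 + 8 * real k * (M + 1) * (4 * \<eta> / \<delta>) ^ k" .
  have bern: "(\<eta> / (\<eta> + \<mu>)) ^ k \<ge> 1 - real k * y"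
  proof -
    have "\<eta> / (\<eta> + \<mu>) - 1 \<ge> - 1" using \<eta> \<mu> by simp
    from Bernoulli_inequality [OF this, of k]
    have "1 + real k * (\<eta> / (\<eta> + \<mu>) - 1) \<le> (\<eta> / (\<eta> + \<mu>)) ^ k" by simp
    moreover have "\<eta> / (\<eta> + \<mu>) - 1 \<ge> - y"
    proof -
      have "\<eta> / (\<eta> + \<mu>) - 1 = - (\<mu> / (\<eta> + \<mu>))" using \<eta> \<mu> by (simp add: field_simps)
      moreover have "\<mu> / (\<eta> + \<mu>) \<le> \<mu> / \<eta>" using \<eta> \<mu> by (intro divide_left_mono) auto
      ultimately show ?thesis by (simp add: y_def)
    qed
    hence "real k * (\<eta> / (\<eta> + \<mu>) - 1) \<ge> real k * (- y)" by (intro mult_left_mono) auto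
    ultimately show ?thesis by simp
  qed
  have k2: "real k \<le> 2 ^ k" by (rule of_nat_less_two_power [THEN less_imp_le])
  \<comment> \<open>Of 4^(-(N + 1) k) = 4^(-N k) 2^-k 2^-k, the first factor absorbs
    \<open>T\<close>, the second absorbs k, and the third is left for comparison with the
    gain.\<close>
  have err: "8 * real k * (M + 1) * (4 * \<eta> / \<delta>) ^ k \<le> 1 / 2 * (1 / 2 ^ k)"
  proof -
    have "(4 * \<eta> / \<delta>) ^ k \<le> (1 / 4 ^ (N + 1)) ^ k" using \<eta> \<delta> by (intro power_mono) auto
    also have "\<dots> = 1 / 4 ^ (N * k) * (1 / 2 ^ k) * (1 / 2 ^ k)"
    proof -
      have "(4 :: real) ^ k = 2 ^ k * 2 ^ k" by (simp flip: power_mult_distrib)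
      thus ?thesis by (simp add: power_divide power_mult [symmetric] distrib_right power_add)
    qed
    finally have "8 * real k * (M + 1) * (4 * \<eta> / \<delta>) ^ k
        \<le> 8 * 2 ^ k * (M + 1) * (1 / 4 ^ (N * k) * (1 / 2 ^ k) * (1 / 2 ^ k))"
      using M k2 \<eta> \<delta> by (intro mult_mono) auto
    also have "\<dots> = 1 / 2 * (T / 4 ^ (N * k)) * (1 / 2 ^ k)"
      by (simp add: T_def field_simps)
    also have "\<dots> \<le> 1 / 2 * 1 * (1 / 2 ^ k)"
      using m(1) unfolding k_def by (intro mult_right_mono mult_left_mono) auto
    finally show ?thesis by simp
  qed
  \<comment> \<open>Gain minus error is at most k y. Replacing k by 2^k gives 1/2 \<le> y 4^k, and
    4^k is at most 4 T^(1/N); hence the 8 in the conclusion.\<close>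
  have "1 / 2 * (1 / 2 ^ k) \<le> real k * y" using main bern err by linarith
  also have "\<dots> \<le> 2 ^ k * y" using k2 y by (intro mult_right_mono) auto
  finally have "1 / 2 \<le> 2 ^ k * y * 2 ^ k" by (simp add: divide_le_eq)
  also have "2 ^ k * y * 2 ^ k = y * 4 ^ k"
    by (simp add: mult_ac flip: power_mult_distrib)
  also have "\<dots> \<le> y * (4 * T powr (1 / real N))" using m(2) y unfolding k_def by (intro mult_left_mono)
  finally have "1 / 8 \<le> y * T powr (1 / real N)" by simp
  hence "1 / 8 * T powr (- 1 / real N) \<le> y * T powr (1 / real N) * T powr (- 1 / real N)"
    by (rule mult_right_mono) simp
  also have "\<dots> = y" using T by (simp add: mult.assoc powr_add [symmetric])
  finally have "\<eta> * (1 / 8 * T powr (- 1 / real N)) \<le> \<mu>"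
    using \<eta> by (simp add: y_def pos_le_divide_eq mult.commute)
  thus ?thesis by (simp add: T_def)
qed

text \<open>A zero extremely close to 1 keeps away the real zeros of every character whose product
  with chi1 is not principal. \<open>c\<close> depends on chi1 and \<open>\<beta>1\<close>.\<close>

lemma repulsion:
  fixes \<delta> \<epsilon> \<beta>1 :: real
  assumes H: "\<forall>(q, chi) \<in> real_primitive_characters.
           \<forall>z::complex. cmod (z - 1) < \<delta> \<and> Dirichlet_L chi z = 0 \<longrightarrow> z \<in> \<real>"
    and \<delta>: "0 < \<delta>" "\<delta> < 1 / 10" and \<epsilon>: "\<epsilon> > 0" and N: "N > 0" "1 / real N \<le> \<epsilon>"
    and A: "real_nonprincipal q1 chi1" and \<beta>1: "Dirichlet_L chi1 (of_real \<beta>1) = 0" "\<beta>1 < 1"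
    and close: "4 * (1 - \<beta>1) / \<delta> \<le> 1 / 4 ^ (N + 1)"
  shows "\<exists>c>0. \<forall>q chi \<sigma>. q > 1 \<and> real_nonprincipal q chi
      \<and> real_nonprincipal (q1 * q) (\<lambda>n. chi1 n * chi n)
      \<and> Dirichlet_L chi (of_real \<sigma>) = 0 \<longrightarrow> \<sigma> < 1 - c * ln (real q) powr (- \<epsilon>)"
proof -
  interpret A: real_nonprincipal q1 chi1 by (rule A)
  define \<eta> where "\<eta> = 1 - \<beta>1"
  \<comment> \<open>The known zero is then at distance 2 \<open>\<eta>\<close> from \<open>x\<close>
    and the pole at distance \<open>\<eta>\<close>, so the k-th powers of these distances differ by
    exactly 2^k.\<close>
  define x where "x = 1 + \<eta>"
  have \<eta>: "\<eta> > 0" using \<beta>1 by (simp add: \<eta>_def)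
  have "4 * (1 - \<beta>1) / \<delta> \<le> 1 / 4" using close by (rule order_trans) simp
  hence \<eta>\<delta>: "\<eta> \<le> \<delta> / 16" using \<delta> unfolding \<eta>_def by (simp add: field_simps)
  have x: "1 < x" "x - 1 \<le> \<delta> / 4" using \<eta> \<eta>\<delta> \<delta> by (auto simp: x_def)
  obtain K where K: "K \<ge> 1"
    and ineq: "\<forall>q1 chi1 q2 chi2 \<beta>1 \<beta>2 m. real_nonprincipal q1 chi1 \<and> real_nonprincipal q2 chi2
      \<and> real_nonprincipal (q1 * q2) (\<lambda>n. chi1 n * chi2 n)
      \<and> Dirichlet_L chi1 (of_real \<beta>1) = 0 \<and> Dirichlet_L chi2 (of_real \<beta>2) = 0
      \<and> \<bar>\<beta>1 - x\<bar> \<le> \<delta> / 2 \<and> \<bar>\<beta>2 - x\<bar> \<le> \<delta> / 2 \<longrightarrow>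
      1 / (x - \<beta>1) ^ Suc m + 1 / (x - \<beta>2) ^ Suc m \<le> 1 / (x - 1) ^ Suc m
        + 8 * real (Suc m) * (ln (K * real (q1 * q2) ^ 4) + 1) * (4 / \<delta>) ^ Suc m"
    using real_zeros_inequality [OF H \<delta> x] by (elim exE conjE)
  define B where "B = 16 * (ln (K * real q1 ^ 4) + 1)"
  \<comment> \<open>Chosen so that 16 (M + 1) \<le> D ln q: \<open>B\<close>, which is free of q, is
    absorbed through ln q \<ge> ln 2, and 64 = 16 * 4 comes from q^4.\<close>
  define D where "D = B / ln 2 + 64"
  have q1: "real q1 \<ge> 1" using A.q_pos by simp
  have Kq: "K * real q1 ^ 4 \<ge> 1" using K q1 mult_mono [of 1 K 1 "real q1 ^ 4"] by simp
  hence B: "B \<ge> 16" unfolding B_def by simp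
  have D: "D > 0" using B by (simp add: D_def add_pos_pos)
  \<comment> \<open>The first entry has half the constant \<eta>/8 of
    \<open>repulsion_arithmetic\<close>, which produces the contradiction. The second forces 1 -
    \<sigma> \<le> \<eta>/16, so that \<sigma> is close enough to \<open>x\<close> for the
    inequality.\<close>
  define c where "c = min (\<eta> / 16 * D powr (- \<epsilon>)) (\<eta> / 16 * (ln 2) powr \<epsilon>)"
  have c: "c > 0" "c \<le> \<eta> / 16 * D powr (- \<epsilon>)" "c \<le> \<eta> / 16 * (ln 2) powr \<epsilon>"
    using \<eta> D by (auto simp: c_def)
  show ?thesis
  proof (intro exI [of _ c] conjI allI impI c(1), elim conjE, rule ccontr)
    fix q chi \<sigma>
    assume q: "(1 :: nat) < q" and X: "real_nonprincipal q chi"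
      and P: "real_nonprincipal (q1 * q) (\<lambda>n. chi1 n * chi n)"
      and zero: "Dirichlet_L chi (complex_of_real \<sigma>) = 0"
      and "\<not> \<sigma> < 1 - c * ln (real q) powr (- \<epsilon>)"
    hence \<sigma>: "1 - \<sigma> \<le> c * ln (real q) powr (- \<epsilon>)" by simp
    interpret X: real_nonprincipal q chi by (rule X)
    have s1: "\<sigma> < 1" using X.L_nonzero [of \<sigma>] zero unfolding X.Dirichlet_L_eq by linarith
    have lq: "ln (real q) \<ge> ln 2" using q by simp
    hence lq0: "ln (real q) > 0" by (rule less_le_trans [rotated]) simp
    have "ln (real q) powr (- \<epsilon>) \<le> (ln 2) powr (- \<epsilon>)"
      using lq \<epsilon> by (intro powr_mono2') auto
    hence "c * ln (real q) powr (- \<epsilon>) \<le> (\<eta> / 16 * (ln 2) powr \<epsilon>) * (ln 2) powr (- \<epsilon>)"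
      using c \<eta> by (intro mult_mono) auto
    also have "\<dots> = \<eta> / 16" by (simp add: mult.assoc flip: powr_add)
    finally have small: "1 - \<sigma> \<le> \<eta> / 16" using \<sigma> by simp
    define M where "M = ln (K * real (q1 * q) ^ 4)"
    have M_eq: "M = ln (K * real q1 ^ 4) + 4 * ln (real q)"
    proof -
      have "K * real (q1 * q) ^ 4 = (K * real q1 ^ 4) * real q ^ 4" by (simp add: power_mult_distrib)
      thus ?thesis unfolding M_def using K A.q_pos q by (simp add: ln_mult ln_realpow)
    qed
    have M0: "M \<ge> 0" unfolding M_eq using Kq lq0 by simp
    have T: "16 * (M + 1) \<le> D * ln (real q)"
    proof -
      have "B \<le> B / ln 2 * ln (real q)" using lq B by (simp add: field_simps)
      thus ?thesis unfolding M_eq D_def B_def [symmetric] distrib_right by (simp add: B_def)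
    qed
    have "\<eta> / 8 * (16 * (M + 1)) powr (- 1 / real N) \<le> 1 - \<sigma>"
    proof (rule repulsion_arithmetic [OF \<eta> \<delta>(1) _ N(1) M0])
      show "4 * \<eta> / \<delta> \<le> 1 / 4 ^ (N + 1)" using close by (simp add: \<eta>_def)
      show "0 \<le> 1 - \<sigma>" using s1 by simp
      fix m
      have "\<bar>\<beta>1 - x\<bar> \<le> \<delta> / 2" "\<bar>\<sigma> - x\<bar> \<le> \<delta> / 2"
        using \<eta> \<eta>\<delta> small s1 \<delta> by (auto simp: x_def \<eta>_def)
      hence "1 / (x - \<beta>1) ^ Suc m + 1 / (x - \<sigma>) ^ Suc m \<le> 1 / (x - 1) ^ Suc m
        + 8 * real (Suc m) * (ln (K * real (q1 * q) ^ 4) + 1) * (4 / \<delta>) ^ Suc m"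
        by (intro ineq [rule_format, of q1 chi1 q chi \<beta>1 \<sigma> m] conjI A X P \<beta>1(1) zero)
      moreover have "x - \<beta>1 = 2 * \<eta>" "x - \<sigma> = \<eta> + (1 - \<sigma>)" "x - 1 = \<eta>"
        by (simp_all add: x_def \<eta>_def)
      ultimately show "1 / (2 * \<eta>) ^ Suc m + 1 / (\<eta> + (1 - \<sigma>)) ^ Suc m \<le> 1 / \<eta> ^ Suc m
        + 8 * real (Suc m) * (M + 1) * (4 / \<delta>) ^ Suc m"
        unfolding M_def by (simp only:)
    qed
    moreover have "(16 * (M + 1)) powr (- 1 / real N) \<ge> (D * ln (real q)) powr (- \<epsilon>)"
    proof -
      have "(D * ln (real q)) powr (- \<epsilon>) \<le> (16 * (M + 1)) powr (- \<epsilon>)"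
        using T M0 \<epsilon> by (intro powr_mono2') auto
      also have "\<dots> \<le> (16 * (M + 1)) powr (- 1 / real N)"
        using N M0 by (intro powr_mono) auto
      finally show ?thesis .
    qed
    hence "\<eta> / 8 * (16 * (M + 1)) powr (- 1 / real N) \<ge> \<eta> / 8 * (D * ln (real q)) powr (- \<epsilon>)"
      using \<eta> by (intro mult_left_mono) auto
    moreover have "(D * ln (real q)) powr (- \<epsilon>) = D powr (- \<epsilon>) * ln (real q) powr (- \<epsilon>)"
      by (rule powr_mult)
    moreover have "c * ln (real q) powr (- \<epsilon>) \<le> \<eta> / 16 * D powr (- \<epsilon>) * ln (real q) powr (- \<epsilon>)"
      using c(2) by (rule mult_right_mono) simp
    ultimately have "\<eta> / 8 * (D powr (- \<epsilon>) * ln (real q) powr (- \<epsilon>))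
        \<le> \<eta> / 16 * (D powr (- \<epsilon>) * ln (real q) powr (- \<epsilon>))"
      using \<sigma> by (simp add: mult.assoc)
    moreover have "D powr (- \<epsilon>) * ln (real q) powr (- \<epsilon>) > 0" using D lq0 by simp
    ultimately show False using \<eta> by simp
  qed
qed

theorem corollary1p4:
  fixes \<delta> :: real
  assumes "0 < \<delta>" and "\<delta> < 1 / 10"
    and "\<forall>(q, chi) \<in> real_primitive_characters.
           \<forall>z::complex. cmod (z - 1) < \<delta> \<and> Dirichlet_L chi z = 0 \<longrightarrow> z \<in> \<real>"
  shows "\<forall>\<epsilon>::real. \<epsilon> > 0 \<longrightarrow> (\<exists>c::real. c > 0 \<and>
           (\<forall>(q, chi) \<in> real_primitive_characters. \<forall>\<sigma>::real.
              q > 1 \<and> \<sigma> \<ge> 1 - c * ln (real q) powr (- \<epsilon>) \<longrightarrow>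
              Dirichlet_L chi (complex_of_real \<sigma>) \<noteq> 0))"
proof (intro allI impI)
  fix \<epsilon> :: real assume \<epsilon>: "\<epsilon> > 0"
  have region: "e / 2 \<ge> e * (ln 2) powr \<epsilon> / 2 * ln (real q) powr (- \<epsilon>)" if "e > 0" "q > 1" for e :: real and q :: nat
  proof -
    have "ln (real q) powr (- \<epsilon>) \<le> (ln 2) powr (- \<epsilon>)"
      using that \<epsilon> by (intro powr_mono2') auto
    hence "e * (ln 2) powr \<epsilon> / 2 * ln (real q) powr (- \<epsilon>) \<le> e * (ln 2) powr \<epsilon> / 2 * (ln 2) powr (- \<epsilon>)"
      using that by (intro mult_left_mono) auto
    also have "\<dots> = e / 2" by (simp add: mult.assoc flip: powr_add)
    finally show ?thesis .
  qed
  \<comment> \<open>Only \<sigma> > 1 - e need be examined: since ln q \<ge> ln 2, shrinking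
    \<open>c\<close> keeps the whole region inside that range.\<close>
  have suffices: "\<exists>c::real. c > 0 \<and> (\<forall>(q, chi) \<in> real_primitive_characters. \<forall>\<sigma>::real.
              q > 1 \<and> \<sigma> \<ge> 1 - c * ln (real q) powr (- \<epsilon>) \<longrightarrow> Dirichlet_L chi (complex_of_real \<sigma>) \<noteq> 0)"
    if e: "e > 0" and c: "c > 0"
      and zf: "\<And>q chi \<sigma>. (q, chi) \<in> real_primitive_characters \<Longrightarrow> q > 1 \<Longrightarrow> \<sigma> > 1 - e \<Longrightarrow>
        \<sigma> \<ge> 1 - c * ln (real q) powr (- \<epsilon>) \<Longrightarrow> Dirichlet_L chi (complex_of_real \<sigma>) \<noteq> 0" for e c
  proof (intro exI [of _ "min c (e * (ln 2) powr \<epsilon> / 2)"] conjI ballI)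
    let ?c = "min c (e * (ln 2) powr \<epsilon> / 2)"
    show "?c > 0" using e c by simp
    fix p :: "nat \<times> (int \<Rightarrow> complex)" assume p: "p \<in> real_primitive_characters"
    show "case p of (q, chi) \<Rightarrow> \<forall>\<sigma>::real. q > 1 \<and> \<sigma> \<ge> 1 - ?c * ln (real q) powr (- \<epsilon>)
        \<longrightarrow> Dirichlet_L chi (complex_of_real \<sigma>) \<noteq> 0"
    proof (cases p, simp only: prod.case, intro allI impI notI, elim conjE)
      fix q chi \<sigma>
      assume "p = (q, chi)" and "1 < q"
        and \<sigma>: "1 - ?c * ln (real q) powr (- \<epsilon>) \<le> \<sigma>" and z: "Dirichlet_L chi (complex_of_real \<sigma>) = 0"
      hence q: "(q, chi) \<in> real_primitive_characters" "1 < q" using p by auto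
      have "?c * ln (real q) powr (- \<epsilon>) \<le> c * ln (real q) powr (- \<epsilon>)"
        and "?c * ln (real q) powr (- \<epsilon>) \<le> e * (ln 2) powr \<epsilon> / 2 * ln (real q) powr (- \<epsilon>)"
        by (intro mult_right_mono; simp)+
      hence "\<sigma> > 1 - e" "\<sigma> \<ge> 1 - c * ln (real q) powr (- \<epsilon>)"
        using \<sigma> region [OF e q(2)] e by linarith+
      from zf [OF q this] z show False by simp
    qed
  qed
  obtain N where N: "N > 0" "1 / real N \<le> \<epsilon>"
    using \<epsilon> by (metis inverse_eq_divide less_imp_le reals_Archimedean of_nat_0_less_iff zero_less_Suc)
  \<comment> \<open>Exactly the closeness that makes 4 (1 - \<beta>) / \<delta> at most 4^-(N +
    1).\<close>
  define e0 where "e0 = \<delta> / 4 / 4 ^ (N + 1)"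
  have e0: "e0 > 0" using assms(1) by (simp add: e0_def)
  show "\<exists>c::real. c > 0 \<and> (\<forall>(q, chi) \<in> real_primitive_characters. \<forall>\<sigma>::real.
              q > 1 \<and> \<sigma> \<ge> 1 - c * ln (real q) powr (- \<epsilon>) \<longrightarrow> Dirichlet_L chi (complex_of_real \<sigma>) \<noteq> 0)"
  \<comment> \<open>Either no zero lies within \<open>e0\<close> of 1, or one such zero is fixed and
    repels the others. The argument neither decides between the cases nor locates that zero, so the
    constant is not computed.\<close>
  proof (cases "\<exists>q chi \<beta>. (q, chi) \<in> real_primitive_characters \<and> q > 1 \<and> \<beta> > 1 - e0 \<and> Dirichlet_L chi (complex_of_real \<beta>) = 0")
    case False
    thus ?thesis by (intro suffices [OF e0 zero_less_one]) blast
  next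
    case True
    then obtain q1 chi1 \<beta>1 where A: "(q1, chi1) \<in> real_primitive_characters" "q1 > 1" "\<beta>1 > 1 - e0"
        "Dirichlet_L chi1 (complex_of_real \<beta>1) = 0" by blast
    note A' = real_primitive_nonprincipal [OF A(1,2)]
    interpret A: real_nonprincipal q1 chi1 by (rule A')
    have \<beta>1: "\<beta>1 < 1" using A.L_nonzero [of \<beta>1] A(4) unfolding A.Dirichlet_L_eq by linarith
    have "4 * (1 - \<beta>1) / \<delta> \<le> 4 * e0 / \<delta>" using A(3) assms(1) by (intro divide_right_mono) auto
    hence close: "4 * (1 - \<beta>1) / \<delta> \<le> 1 / 4 ^ (N + 1)" using assms(1) by (simp add: e0_def)
    obtain c where c: "c > 0" "\<And>q chi \<sigma>. q > 1 \<Longrightarrow> real_nonprincipal q chi \<Longrightarrow>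
        real_nonprincipal (q1 * q) (\<lambda>n. chi1 n * chi n) \<Longrightarrow> Dirichlet_L chi (of_real \<sigma>) = 0 \<Longrightarrow>
        \<sigma> < 1 - c * ln (real q) powr (- \<epsilon>)"
      using repulsion [OF assms(3,1,2) \<epsilon> N A' A(4) \<beta>1 close] by metis
    obtain e where e: "e > 0" "\<And>x. x > 1 - e \<Longrightarrow> A.L (of_real x) \<noteq> 0"
      using A.L_zero_free_near_1 by blast
    show ?thesis
    \<comment> \<open>\<open>e\<close> rules out zeros shared with chi1, and the 1 keeps \<sigma>
      positive for the transfer of zeros.\<close>
    proof (rule suffices [of "min e 1" c])
      fix q chi \<sigma>
      assume q: "(q, chi) \<in> real_primitive_characters" "1 < q" and \<sigma>: "\<sigma> > 1 - min e 1"
        "\<sigma> \<ge> 1 - c * ln (real q) powr (- \<epsilon>)"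
      note X' = real_primitive_nonprincipal [OF q]
      interpret X: real_nonprincipal q chi by (rule X')
      show "Dirichlet_L chi (complex_of_real \<sigma>) \<noteq> 0"
      proof
        assume zero: "Dirichlet_L chi (complex_of_real \<sigma>) = 0"
        have char: "dirichlet_character (q1 * q) (\<lambda>n. chi1 n * chi n)"
          by (rule dirichlet_character_mult [OF A.character X.character])
        show False
        proof (cases "\<exists>n. coprime n (int (q1 * q)) \<and> chi1 n * chi n \<noteq> 1")
          case True
          hence "real_nonprincipal (q1 * q) (\<lambda>n. chi1 n * chi n)"
            using char A.real X.real by unfold_locales (auto intro: Reals_mult)
          from c(2) [OF q(2) X' this zero] \<sigma>(2) show False by simp
        next
          case False
          \<comment> \<open>The product is principal, for instance when chi = chi1. At n coprime to
            q1 q the value of chi1 is 1 or -1, hence its own inverse.\<close>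
          have "chi n = chi1 n" if n: "coprime n (int (q1 * q))" for n
          proof -
            have one: "chi1 n * chi n = 1" using False n by blast
            have unit: "norm (chi1 n) \<le> 1" "norm (chi n) \<le> 1"
              using A.norm_chi X.norm_chi by auto
            have "norm (chi1 n) * norm (chi n) = 1" using one by (metis norm_mult norm_one)
            hence n1: "norm (chi1 n) = 1"
              using unit by (metis mult.right_neutral mult_left_mono norm_ge_zero order_antisym)
            obtain y where y: "chi1 n = of_real y" using A.real [of n] by (auto elim: Reals_cases)
            hence "y * y = 1" using n1 by (simp add: abs_if split: if_splits)
            hence "chi1 n * chi1 n = 1" unfolding y by (metis of_real_1 of_real_mult)
            thus ?thesis using one by (metis mult_cancel_left zero_neq_one mult_zero_left)
          qed
          hence "Dirichlet_L chi1 (complex_of_real \<sigma>) = 0"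
            using A.q_pos X.q_pos \<sigma>(1) zero
            by (intro Dirichlet_L_zero_transfer [OF X' A', of "q1 * q"]) auto
          thus False using e(2) [of \<sigma>] \<sigma>(1) by (simp add: A.Dirichlet_L_eq)
        qed
      qed
    qed (use e c in auto)
  qed
qed

end
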